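(* Let $G$ be the Gupta--Sidki $3$-group. Every infinite finitely generated subgroup of $G$ is (abstractly) commensurable with $G$ or with $G\times G$.
   Context: Let $T$ be the $3$-regular rooted tree: its vertices are the finite words over the alphabet $\{0,1,2\}$, the root is the empty word, and each word $u$ is joined by an edge to $ux$ for every letter $x$. $\mathrm{Aut}\,T$ is the group of root-preserving (equivalently, level-preserving) automorphisms of $T$, acting on the right, $v\mapsto v^g$. An automorphism $x$ fixing all three vertices of level $1$ is written $x=(x_0,x_1,x_2)$, where $x_i\in\mathrm{Aut}\,T$ is defined by $(iw)^x=i\,w^{x_i}$ for all words $w$. The Gupta--Sidki $3$-group is $G=\langle a,b\rangle\le \mathrm{Aut}\,T$, where $a$ is defined by $(iw)^a=(i+1 \bmod 3)w$ for every letter $i$ and word $w$, and $b$ is defined recursively by $b=(a,a^{-1},b)$. Two groups are (abstractly) commensurable if they have isomorphic subgroups of finite index. *)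

theory Defs
  imports "HOL-Algebra.Algebra" "HOL-Library.Numeral_Type"
begin

text \<open>
  Words over \<open>{0,1,2}\<close> are lists over the type \<open>3\<close> of integers modulo 3, so \<open>i + 1\<close> on letters is
  addition modulo 3.
\<close>

type_synonym word3 = "3 list"

definition tree_adj :: "word3 \<Rightarrow> word3 \<Rightarrow> bool" where
  "tree_adj u v \<longleftrightarrow> (\<exists>x. v = u @ [x]) \<or> (\<exists>x. u = v @ [x])"

text \<open>Automorphisms act on the right, so the product of \<open>f\<close> and \<open>g\<close> applies \<open>f\<close> first.\<close>

definition Aut_T :: "(word3 \<Rightarrow> word3) monoid" where
  "Aut_T = \<lparr>carrier = {f. bij f \<and> f [] = [] \<and> (\<forall>u v. tree_adj (f u) (f v) \<longleftrightarrow> tree_adj u v)},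
            monoid.mult = (\<lambda>f g. g \<circ> f), one = id\<rparr>"

fun gs_a :: "word3 \<Rightarrow> word3" where
  "gs_a [] = []"
| "gs_a (i # w) = (i + 1) # w"

fun gs_b :: "word3 \<Rightarrow> word3" where
  "gs_b [] = []"
| "gs_b (i # w) =
     i # (if i = 0 then gs_a w else if i = 1 then (inv\<^bsub>Aut_T\<^esub> gs_a) w else gs_b w)"

definition Gupta_Sidki :: "(word3 \<Rightarrow> word3) monoid" where
  "Gupta_Sidki = Aut_T\<lparr>carrier := generate Aut_T {gs_a, gs_b}\<rparr>"

definition fin_gen :: "('a, 'm) monoid_scheme \<Rightarrow> bool" where
  "fin_gen G \<longleftrightarrow> (\<exists>S. finite S \<and> S \<subseteq> carrier G \<and> generate G S = carrier G)"

definition finite_index :: "'a set \<Rightarrow> ('a, 'm) monoid_scheme \<Rightarrow> bool" where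
  "finite_index A G \<longleftrightarrow> subgroup A G \<and> finite (rcosets\<^bsub>G\<^esub> A)"

definition commensurable :: "('a, 'm) monoid_scheme \<Rightarrow> ('b, 'n) monoid_scheme \<Rightarrow> bool" where
  "commensurable G H \<longleftrightarrow>
     (\<exists>A B. finite_index A G \<and> finite_index B H \<and> G\<lparr>carrier := A\<rparr> \<cong> H\<lparr>carrier := B\<rparr>)"

lemma letter_cases: "(i::3) = 0 \<or> i = 1 \<or> i = 2"
proof (induct i)
  case (of_int z)
  then have "z = 0 \<or> z = 1 \<or> z = 2" by auto
  then show ?case by auto
qed

lemma tree_adj_sym: "tree_adj u v \<Longrightarrow> tree_adj v u"
  by (auto simp: tree_adj_def)

lemma group_Aut_T: "group Aut_T"
proof (rule groupI)
  fix f assume "f \<in> carrier Aut_T"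
  then have f: "bij f" "f [] = []" "\<And>u v. tree_adj (f u) (f v) \<longleftrightarrow> tree_adj u v"
    by (auto simp: Aut_T_def)
  have "tree_adj (inv_into UNIV f u) (inv_into UNIV f v) \<longleftrightarrow> tree_adj u v" for u v
    using f(3)[of "inv_into UNIV f u" "inv_into UNIV f v"] f(1)
    by (simp add: bij_is_surj surj_f_inv_f)
  moreover have "inv_into UNIV f [] = []"
    using f(1,2) by (metis bij_inv_eq_iff)
  ultimately have "inv_into UNIV f \<in> carrier Aut_T"
    using f(1) by (auto simp: Aut_T_def bij_imp_bij_inv)
  moreover have "inv_into UNIV f \<otimes>\<^bsub>Aut_T\<^esub> f = \<one>\<^bsub>Aut_T\<^esub>"
    using f(1) by (auto simp: Aut_T_def fun_eq_iff bij_is_surj surj_f_inv_f)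
  ultimately show "\<exists>g\<in>carrier Aut_T. g \<otimes>\<^bsub>Aut_T\<^esub> f = \<one>\<^bsub>Aut_T\<^esub>" by blast
qed (auto simp: Aut_T_def bij_comp comp_assoc)

lemma Aut_T_memI:
  assumes gf: "\<And>w. g (f w) = w" and fg: "\<And>w. f (g w) = w" and "f [] = []"
    and f: "\<And>u x. \<exists>y. f (u @ [x]) = f u @ [y]" and g: "\<And>u x. \<exists>y. g (u @ [x]) = g u @ [y]"
  shows "f \<in> carrier Aut_T"
proof -
  have bij: "bij f" using gf fg by (metis bijI')
  have f': "tree_adj (f u) (f v)" if "tree_adj u v" for u v
    using that f unfolding tree_adj_def by metis
  have g': "tree_adj (g u) (g v)" if "tree_adj u v" for u v
    using that g unfolding tree_adj_def by metis
  have "tree_adj (f u) (f v) \<longleftrightarrow> tree_adj u v" for u v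
    using f'[of u v] g'[of "f u" "f v"] gf by auto
  with bij assms(3) show ?thesis by (auto simp: Aut_T_def)
qed

lemma three_eq_zero: "(i::3) + 1 + 1 + 1 = i"
  using letter_cases[of i] by auto

lemma gs_a_cube: "gs_a (gs_a (gs_a w)) = w"
  by (cases w) (simp_all add: three_eq_zero)

lemma gs_a_snoc: "\<exists>y. gs_a (u @ [x]) = gs_a u @ [y]"
  by (cases u) auto

lemma gs_a_in: "gs_a \<in> carrier Aut_T"
proof (rule Aut_T_memI[where g = "gs_a \<circ> gs_a"])
  show "\<exists>y. (gs_a \<circ> gs_a) (u @ [x]) = (gs_a \<circ> gs_a) u @ [y]" for u x
    using gs_a_snoc by (metis comp_apply)
qed (auto simp: gs_a_cube gs_a_snoc)

lemma inv_gs_a: "inv\<^bsub>Aut_T\<^esub> gs_a = gs_a \<circ> gs_a"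
proof -
  interpret group Aut_T by (rule group_Aut_T)
  have "(gs_a \<circ> gs_a) \<otimes>\<^bsub>Aut_T\<^esub> gs_a = \<one>\<^bsub>Aut_T\<^esub>"
    by (auto simp: Aut_T_def gs_a_cube)
  moreover have "gs_a \<circ> gs_a \<in> carrier Aut_T"
    using m_closed[OF gs_a_in gs_a_in] by (simp add: Aut_T_def)
  ultimately show ?thesis using gs_a_in by (metis inv_equality)
qed

lemma gs_b_cube: "gs_b (gs_b (gs_b w)) = w"
  by (induction w) (auto simp: inv_gs_a gs_a_cube)

lemma gs_b_snoc: "\<exists>y. gs_b (u @ [x]) = gs_b u @ [y]"
proof (induction u)
  case (Cons i u)
  have "\<exists>y. (gs_a \<circ> gs_a) (u @ [x]) = (gs_a \<circ> gs_a) u @ [y]"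
    using gs_a_snoc by (metis comp_apply)
  with Cons gs_a_snoc[of u x] show ?case by (auto simp: inv_gs_a)
qed (auto simp: inv_gs_a)

lemma gs_b_in: "gs_b \<in> carrier Aut_T"
proof (rule Aut_T_memI[where g = "gs_b \<circ> gs_b"])
  show "\<exists>y. (gs_b \<circ> gs_b) (u @ [x]) = (gs_b \<circ> gs_b) u @ [y]" for u x
    using gs_b_snoc by (metis comp_apply)
qed (auto simp: gs_b_cube gs_b_snoc)

lemma group_Gupta_Sidki: "group Gupta_Sidki"
  unfolding Gupta_Sidki_def
  by (intro subgroup.subgroup_is_group group_Aut_T group.generate_is_subgroup)
     (use gs_a_in gs_b_in in auto)

end

theory Submission
  imports Defs
begin

text \<open>
  For a finitely generated \<open>H \<le> G\<close> one finds a subgroup \<open>K\<close> of finite index and finitely many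
  homomorphisms \<open>K \<rightarrow> G\<close> with images of finite index that are jointly injective. If all first level
  sections of \<open>St\<^sub>H(1)\<close> admit such data then so does \<open>H\<close>, which allows an induction on the length
  of generators. If \<open>H \<le> St(1)\<close>, passing to sections halves lengths. If \<open>H\<close> is transitive on level 1,
  then either all its sections map onto \<open>G/G'\<close>, or they all lie in \<open>St(1)\<close>; in the latter case two
  successive passages to sections shorten the Schreier generators. A subgroup that maps onto \<open>G/G'\<close>
  has a section equal to \<open>G\<close>: short elements outside \<open>\<langle>a\<rangle>G'\<close> lead to a section containing conjugates of
  \<open>a\<close> and \<open>b\<close>, and the conjugators shrink on the way down the tree.

  Given such data, each homomorphism can be made independent of the others: if the elements of \<open>K\<close>
  killed by the other homomorphisms have an image \<open>N\<close>, then \<open>N\<close> is normal in a subgroup of finite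
  index, and since \<open>G\<close> is regular branch over \<open>G'\<close>, below each vertex of a deep level \<open>N\<close> is either
  trivial or contains a subgroup of finite index of \<open>G\<close>; one replaces the homomorphism by its sections at
  the vertices of the second kind. So \<open>K\<close> becomes commensurable with a power of \<open>G\<close>, and as
  \<open>G' \<times> G' \<times> G'\<close> embeds in \<open>G\<close> with finite index, three factors can be merged into one until at most two remain.
\<close>

section \<open>Tree automorphisms with cyclic labels\<close>

text \<open>Lengths count only the syllables \<open>bpow j\<close>, because the sections of powers
  of \<open>a\<close> vanish. Passing to sections does not raise the total length and halves single
  lengths, but the bound \<open>(n + 1) div 2\<close> is stationary at 1, so every induction treats
  length 1 explicitly; Schreier generators may grow to about three halves of the original length,
  which makes length 2 exceptional as well.

  Joint injectivity with images of finite index does not determine a group up to commensurability: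
  the diagonal of G x G, with its two projections, is an example. This is why independence is a
  separate stage. Finite index of the images makes it possible, since a subgroup normalized by a
  finite index subgroup of a branch group is all or nothing below each sufficiently deep vertex. The
  bound 2 appears because merging consumes three homomorphisms and returns one.

  With coinductive automorphisms, identities are checked on rotations and sections and proved by
  bisimulation; permutations of words return only at the end, through the injective map
  \<open>ac\<close>.\<close>

text \<open>Automorphisms acting on the children of each vertex by a power of \<open>i \<mapsto> i + 1\<close>. The group is written
  additively because the class for noncommutative groups is; \<open>x + y\<close> acts by \<open>x\<close> first.\<close>

codatatype aut = Node (rot: 3) (sec: "3 \<Rightarrow> aut")

lemma aut_eqI: "rot x = rot y \<Longrightarrow> (\<And>i. sec x i = sec y i) \<Longrightarrow> x = y"
  by (rule aut.expand) auto

lemma aut_bisim: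
  assumes "R x y" "\<And>x y. R x y \<Longrightarrow> rot x = rot y \<and> (\<forall>i. R (sec x i) (sec y i))"
  shows "x = y"
  using assms by (coinduction arbitrary: x y) (auto simp: rel_fun_def)

instantiation aut :: group_add
begin

primcorec zero_aut :: aut where "zero_aut = Node 0 (\<lambda>_. zero_aut)"

primcorec plus_aut :: "aut \<Rightarrow> aut \<Rightarrow> aut" where
  "plus_aut x y = Node (rot x + rot y) (\<lambda>i. plus_aut (sec x i) (sec y (i + rot x)))"

primcorec uminus_aut :: "aut \<Rightarrow> aut" where
  "uminus_aut x = Node (- rot x) (\<lambda>i. uminus_aut (sec x (i - rot x)))"

definition minus_aut :: "aut \<Rightarrow> aut \<Rightarrow> aut" where "minus_aut x y = x + - y"

instance
proof
  fix x y z :: aut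
  show "x + y + z = x + (y + z)"
    by (rule aut_bisim[where R = "\<lambda>s t. \<exists>x y z. s = x + y + z \<and> t = x + (y + z)"])
       (blast, force simp: add.assoc)
  show "0 + x = x"
    by (rule aut_bisim[where R = "\<lambda>s t. s = 0 + t"]) auto
  show "x + 0 = x"
    by (rule aut_bisim[where R = "\<lambda>s t. s = t + 0"]) auto
  show "- x + x = 0"
    by (rule aut_bisim[where R = "\<lambda>s t. (\<exists>x. s = - x + x) \<and> t = 0"]) auto
  show "x + - y = x - y" by (simp add: minus_aut_def)
qed

end

lemma sec_add [simp]: "sec (x + y) i = sec x i + sec y (i + rot x)"
  and sec_zero [simp]: "sec 0 i = 0"
  and sec_uminus [simp]: "sec (- x) i = - sec x (i - rot x)"
  by simp_all

declare plus_aut.sel(2) [simp del] zero_aut.sel(2) [simp del] uminus_aut.sel(2) [simp del]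

declare add_uminus_conv_diff [simp del]

lemma add_uminus3 [simp]: "(i::3) + - j = i - j"
  by (rule add_uminus_conv_diff)

lemma rot_diff [simp]: "rot (x - y) = rot x - rot y"
  by (simp add: minus_aut_def)

lemma sec_diff [simp]: "sec (x - y) i = sec x i - sec y (i + rot x - rot y)"
  by (simp add: minus_aut_def)

text \<open>Normal form for words in a noncommutative group: sums nested to the right, signs on the
  atoms. The opposite rule \<open>add_uminus_conv_diff\<close> was removed from the simplifier, and
  kept for letters only, so that the two do not loop.\<close>

lemmas aut_simps = add.assoc[where 'a = aut] minus_add[where 'a = aut] diff_conv_add_uminus[where 'a = aut]


lemma ball3: "(\<forall>i::3. P i) \<longleftrightarrow> P 0 \<and> P 1 \<and> P 2"
  using letter_cases by metis

lemma ex3: "(\<exists>i::3. P i) \<longleftrightarrow> P 0 \<or> P 1 \<or> P 2"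
  using letter_cases by metis

lemma numerals3 [simp]: "(3::3) = 0" "(4::3) = 1" "- (1::3) = 2" "- (2::3) = 1"
  by simp_all

lemma UNIV3: "(UNIV :: 3 set) = {0, 1, 2}"
  using letter_cases by auto

section \<open>Subgroups, homomorphisms and finite index\<close>

definition subgp :: "aut set \<Rightarrow> bool" where
  "subgp H \<longleftrightarrow> 0 \<in> H \<and> (\<forall>x\<in>H. \<forall>y\<in>H. x + y \<in> H) \<and> (\<forall>x\<in>H. - x \<in> H)"

lemma subgpI:
  "0 \<in> H \<Longrightarrow> (\<And>x y. x \<in> H \<Longrightarrow> y \<in> H \<Longrightarrow> x + y \<in> H) \<Longrightarrow> (\<And>x. x \<in> H \<Longrightarrow> - x \<in> H) \<Longrightarrow> subgp H"
  by (auto simp: subgp_def)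

lemma subgp_zero: "subgp H \<Longrightarrow> 0 \<in> H"
  and subgp_add: "subgp H \<Longrightarrow> x \<in> H \<Longrightarrow> y \<in> H \<Longrightarrow> x + y \<in> H"
  and subgp_uminus: "subgp H \<Longrightarrow> x \<in> H \<Longrightarrow> - x \<in> H"
  and subgp_diff: "subgp H \<Longrightarrow> x \<in> H \<Longrightarrow> y \<in> H \<Longrightarrow> x - y \<in> H"
  by (auto simp: subgp_def diff_conv_add_uminus)

lemmas subgp_closed = subgp_zero subgp_add subgp_uminus subgp_diff

inductive_set gen :: "aut set \<Rightarrow> aut set" for S where
  gen_base: "x \<in> S \<Longrightarrow> x \<in> gen S"
| gen_zero: "0 \<in> gen S"
| gen_add: "x \<in> gen S \<Longrightarrow> y \<in> gen S \<Longrightarrow> x + y \<in> gen S"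
| gen_uminus: "x \<in> gen S \<Longrightarrow> - x \<in> gen S"

lemma subgp_gen: "subgp (gen S)"
  by (auto intro: subgpI gen.intros)

lemma gen_least: "subgp H \<Longrightarrow> S \<subseteq> H \<Longrightarrow> gen S \<subseteq> H"
proof
  fix x assume "subgp H" "S \<subseteq> H" "x \<in> gen S"
  from this(3,1,2) show "x \<in> H" by induction (auto intro: subgp_closed)
qed

definition hom_on :: "aut set \<Rightarrow> (aut \<Rightarrow> aut) \<Rightarrow> bool" where
  "hom_on K f \<longleftrightarrow> (\<forall>x\<in>K. \<forall>y\<in>K. f (x + y) = f x + f y)"

lemma hom_onD: "hom_on K f \<Longrightarrow> x \<in> K \<Longrightarrow> y \<in> K \<Longrightarrow> f (x + y) = f x + f y"
  by (auto simp: hom_on_def)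

lemma hom_on_subset: "hom_on K f \<Longrightarrow> L \<subseteq> K \<Longrightarrow> hom_on L f"
  by (auto simp: hom_on_def)

lemma hom_on_zero: "hom_on K f \<Longrightarrow> subgp K \<Longrightarrow> f 0 = 0"
  by (metis add.right_neutral add_left_cancel hom_onD subgp_zero)

lemma hom_on_uminus: "hom_on K f \<Longrightarrow> subgp K \<Longrightarrow> x \<in> K \<Longrightarrow> f (- x) = - f x"
  using hom_onD[of K f "- x" x] hom_on_zero[of K f]
  by (simp add: subgp_uminus eq_neg_iff_add_eq_0)

lemma hom_on_diff: "hom_on K f \<Longrightarrow> subgp K \<Longrightarrow> x \<in> K \<Longrightarrow> y \<in> K \<Longrightarrow> f (x - y) = f x - f y"
  using hom_onD[of K f x "- y"] hom_on_uminus[of K f y]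
  by (simp add: diff_conv_add_uminus subgp_uminus)

lemma subgp_image:
  assumes f: "hom_on K f" and K: "subgp K" shows "subgp (f ` K)"
proof (rule subgpI)
  show "0 \<in> f ` K" using imageI[OF subgp_zero[OF K], of f] by (simp add: hom_on_zero[OF f K])
  show "u + v \<in> f ` K" if "u \<in> f ` K" "v \<in> f ` K" for u v
  proof -
    from that obtain x y where "x \<in> K" "y \<in> K" "u = f x" "v = f y" by auto
    then have "u + v = f (x + y)" "x + y \<in> K" by (simp_all add: hom_onD[OF f] subgp_add[OF K])
    then show ?thesis by blast
  qed
  show "- u \<in> f ` K" if "u \<in> f ` K" for u
  proof -
    from that obtain x where "x \<in> K" "u = f x" by auto
    then have "- u = f (- x)" "- x \<in> K" by (simp_all add: hom_on_uminus[OF f K] subgp_uminus[OF K])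
    then show ?thesis by blast
  qed
qed

lemma subgp_vimage:
  assumes f: "hom_on K f" and K: "subgp K" and L: "subgp L" shows "subgp {k \<in> K. f k \<in> L}"
  by (rule subgpI)
     (auto simp: hom_on_zero[OF f K] hom_onD[OF f] hom_on_uminus[OF f K] subgp_closed[OF K] subgp_closed[OF L])

lemma gen_image: "hom_on (gen S) f \<Longrightarrow> f ` gen S = gen (f ` S)"
proof
  assume f: "hom_on (gen S) f"
  show "f ` gen S \<subseteq> gen (f ` S)"
  proof clarify
    fix x assume "x \<in> gen S"
    then show "f x \<in> gen (f ` S)"
      by induction
         (auto simp: hom_onD[OF f] hom_on_uminus[OF f subgp_gen] hom_on_zero[OF f subgp_gen] intro: gen.intros)
  qed
  show "gen (f ` S) \<subseteq> f ` gen S"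
    by (rule gen_least[OF subgp_image[OF f subgp_gen]]) (auto intro: gen_base)
qed

lemma subgp_Int: "subgp H \<Longrightarrow> subgp K \<Longrightarrow> subgp (H \<inter> K)"
  by (auto simp: subgp_def)

text \<open>\<open>fi L K\<close> says that finitely many right cosets of \<open>L\<close> cover \<open>K\<close>; neither
  \<open>L \<subseteq> K\<close> nor being a subgroup is part of it.\<close>

definition fi :: "aut set \<Rightarrow> aut set \<Rightarrow> bool" where
  "fi L K \<longleftrightarrow> (\<exists>T. finite T \<and> T \<subseteq> K \<and> (\<forall>x\<in>K. \<exists>t\<in>T. x - t \<in> L))"

text \<open>Together with the converse \<open>fiE\<close>, this expresses finite index by a
  labelling with finitely many values whose fibres lie in single cosets. Labels pass to subgroups
  and preimages without a choice of new representatives.\<close>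

lemma fiI:
  assumes "finite (f ` K)" "\<And>x y. x \<in> K \<Longrightarrow> y \<in> K \<Longrightarrow> f x = f y \<Longrightarrow> x - y \<in> L"
  shows "fi L K"
proof -
  define r where "r = (\<lambda>v. SOME t. t \<in> K \<and> f t = v)"
  have r: "r (f x) \<in> K \<and> f (r (f x)) = f x" if "x \<in> K" for x
    unfolding r_def by (rule someI[where x = x]) (use that in auto)
  show ?thesis unfolding fi_def
  proof (intro exI[of _ "r ` f ` K"] conjI ballI)
    fix x assume x: "x \<in> K"
    then have "x - r (f x) \<in> L" using r by (intro assms(2)) auto
    with x show "\<exists>t\<in>r ` f ` K. x - t \<in> L" by blast
  qed (use assms(1) r in auto)
qed

lemma fi_mono: "fi L K \<Longrightarrow> L \<subseteq> M \<Longrightarrow> fi M K"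
  unfolding fi_def by (meson subsetD)

lemma fi_refl: "subgp K \<Longrightarrow> fi K K"
  unfolding fi_def by (intro exI[of _ "{0}"]) (auto simp: subgp_zero)

lemma fiE:
  assumes "fi L K" "subgp L"
  shows "\<exists>f :: aut \<Rightarrow> aut. finite (f ` K) \<and> (\<forall>x\<in>K. \<forall>y\<in>K. f x = f y \<longrightarrow> x - y \<in> L)"
proof -
  from assms(1) obtain T where T: "finite T" "\<And>x. x \<in> K \<Longrightarrow> \<exists>t\<in>T. x - t \<in> L"
    by (auto simp: fi_def)
  then obtain f where f: "\<And>x. x \<in> K \<Longrightarrow> f x \<in> T \<and> x - f x \<in> L" by metis
  have "x - y \<in> L" if "x \<in> K" "y \<in> K" "f x = f y" for x y
  proof -
    have "(x - f x) - (y - f y) \<in> L" by (rule subgp_diff[OF assms(2)]) (use f that(1,2) in auto)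
    then show ?thesis using that(3) by (simp add: aut_simps)
  qed
  moreover have "finite (f ` K)" using f T(1) by (auto intro: finite_subset)
  ultimately show ?thesis by blast
qed

lemma fi_trans:
  assumes "fi L K" "fi K H" "subgp L" "subgp K" "K \<subseteq> H" "subgp H" shows "fi L H"
proof -
  from assms(1,2) obtain S T where S: "finite S" "S \<subseteq> K" "\<And>x. x \<in> K \<Longrightarrow> \<exists>s\<in>S. x - s \<in> L"
    and T: "finite T" "T \<subseteq> H" "\<And>x. x \<in> H \<Longrightarrow> \<exists>t\<in>T. x - t \<in> K" by (auto simp: fi_def)
  show ?thesis unfolding fi_def
  proof (intro exI[of _ "(\<lambda>(s,t). s + t) ` (S \<times> T)"] conjI ballI)
    fix x assume "x \<in> H"
    then obtain t where t: "t \<in> T" "x - t \<in> K" using T by blast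
    then obtain s where s: "s \<in> S" "x - t - s \<in> L" using S by blast
    then show "\<exists>y\<in>(\<lambda>(s,t). s + t) ` (S \<times> T). x - y \<in> L"
      using t by (auto intro!: bexI[of _ "(s,t)"] simp: aut_simps)
  qed (use S T assms in \<open>auto intro!: subgp_add\<close>)
qed

lemma fi_Int: 
  assumes "fi L H" "subgp L" "K \<subseteq> H" "subgp K" shows "fi (L \<inter> K) K"
proof -
  from fiE[OF assms(1,2)] obtain f :: "aut \<Rightarrow> aut" where f: "finite (f ` H)"
    "\<And>x y. x \<in> H \<Longrightarrow> y \<in> H \<Longrightarrow> f x = f y \<Longrightarrow> x - y \<in> L" by blast
  show ?thesis
  proof (rule fiI[of f])
    show "finite (f ` K)" using f(1) assms(3) by (meson finite_subset image_mono)
  qed (use f(2) assms(3,4) in \<open>auto intro: subgp_diff\<close>)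
qed

lemma fi_image:
  assumes "fi L K" "hom_on K f" "subgp K" "L \<subseteq> K" shows "fi (f ` L) (f ` K)"
proof -
  from assms obtain T where T: "finite T" "T \<subseteq> K" "\<And>x. x \<in> K \<Longrightarrow> \<exists>t\<in>T. x - t \<in> L"
    by (auto simp: fi_def)
  show ?thesis unfolding fi_def
  proof (intro exI[of _ "f ` T"] conjI ballI)
    fix y assume "y \<in> f ` K"
    then obtain x where x: "x \<in> K" "y = f x" by auto
    then obtain t where t: "t \<in> T" "x - t \<in> L" using T by blast
    then have "y - f t = f (x - t)" using x T(2) hom_on_diff[OF assms(2,3), of x t] by auto
    with t show "\<exists>t\<in>f ` T. y - t \<in> f ` L" by auto
  qed (use T in auto)
qed

lemma fi_vimage:
  assumes "fi M G" "subgp M" "hom_on K f" "subgp K" "f ` K \<subseteq> G"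
  shows "fi {k \<in> K. f k \<in> M} K"
proof -
  from fiE[OF assms(1,2)] obtain h :: "aut \<Rightarrow> aut" where h: "finite (h ` G)"
    "\<And>x y. x \<in> G \<Longrightarrow> y \<in> G \<Longrightarrow> h x = h y \<Longrightarrow> x - y \<in> M" by blast
  show ?thesis
  proof (rule fiI[of "h \<circ> f"])
    show "finite ((h \<circ> f) ` K)" using h(1) assms(5)
      by (metis finite_subset image_comp image_mono)
    fix x y assume xy: "x \<in> K" "y \<in> K" "(h \<circ> f) x = (h \<circ> f) y"
    then have "f x - f y \<in> M" using assms(5) by (intro h(2)) auto
    then show "x - y \<in> {k \<in> K. f k \<in> M}"
      using xy hom_on_diff[OF assms(3,4)] subgp_diff[OF assms(4)] by auto
  qed
qed

primrec act :: "3 list \<Rightarrow> aut \<Rightarrow> 3 list" where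
  "act [] x = []"
| "act (i # w) x = (i + rot x) # act w (sec x i)"

primrec secw :: "aut \<Rightarrow> 3 list \<Rightarrow> aut" where
  "secw x [] = x"
| "secw x (i # w) = secw (sec x i) w"

section \<open>The Gupta--Sidki group: lengths and abelianization\<close>

definition apow :: "3 \<Rightarrow> aut" where "apow k = Node k (\<lambda>_. 0)"

text \<open>The power b^j in closed form. The exponent is a parameter so that a whole syllable is
  one term with known sections.\<close>

primcorec bpow :: "3 \<Rightarrow> aut" where
  "bpow j = Node 0 (\<lambda>i. if i = 0 then apow j else if i = 1 then apow (- j) else bpow j)"

lemma rot_apow [simp]: "rot (apow k) = k" and sec_apow [simp]: "sec (apow k) i = 0"
  by (simp_all add: apow_def)

lemma rot_bpow [simp]: "rot (bpow j) = 0"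
  and sec_bpow [simp]: "sec (bpow j) i = (if i = 0 then apow j else if i = 1 then apow (- j) else bpow j)"
  by simp_all

declare bpow.sel(2) [simp del]

lemma apow_add: "apow (i + j) = apow i + apow j"
  by (rule aut_eqI) auto

lemma apow_zero [simp]: "apow 0 = 0"
  by (rule aut_eqI) auto

lemma apow_uminus: "apow (- i) = - apow i"
  by (rule aut_eqI) auto

lemma bpow_add: "bpow (i + j) = bpow i + bpow j"
proof (rule aut_bisim[where R = "\<lambda>x y. x = y \<or> x = bpow (i + j) \<and> y = bpow i + bpow j"])
  show "rot x = rot y \<and> (\<forall>k. sec x k = sec y k \<or> sec x k = bpow (i + j) \<and> sec y k = bpow i + bpow j)"
    if "x = y \<or> x = bpow (i + j) \<and> y = bpow i + bpow j" for x y
  proof -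
    have "apow (- i - j) = - apow i + - apow j"
      by (simp only: diff_conv_add_uminus apow_add apow_uminus)
    then show ?thesis using that by (auto simp: apow_add apow_uminus)
  qed
qed simp

lemma bpow_zero [simp]: "bpow 0 = 0"
  using bpow_add[of 0 0] by (metis add_left_cancel add.right_neutral)

lemma bpow_uminus: "bpow (- i) = - bpow i"
  using bpow_add[of "- i" i] by (simp add: eq_neg_iff_add_eq_0)

definition GS :: "aut set" where "GS = gen {apow 1, bpow 1}"

lemma subgp_GS: "subgp GS"
  by (simp add: GS_def subgp_gen)

lemmas GS_closed = subgp_closed[OF subgp_GS]

lemma pow_subgp:
  assumes "subgp H"
  shows "apow 1 \<in> H \<Longrightarrow> apow k \<in> H" and "bpow 1 \<in> H \<Longrightarrow> bpow k \<in> H"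
  using letter_cases[of k] apow_add[of 1 1] bpow_add[of 1 1] assms by (auto simp: subgp_closed)

lemma apow_in_GS: "apow k \<in> GS" and bpow_in_GS: "bpow k \<in> GS"
  using pow_subgp[OF subgp_GS] by (auto simp: GS_def gen_base)

lemma pow_subgp_nonzero:
  assumes "subgp H" "k \<noteq> 0"
  shows "apow k \<in> H \<Longrightarrow> apow i \<in> H" and "bpow k \<in> H \<Longrightarrow> bpow i \<in> H"
proof -
  have "i = 0 \<or> i = k \<or> i = k + k" using letter_cases[of k] letter_cases[of i] assms(2) by auto
  then show "apow k \<in> H \<Longrightarrow> apow i \<in> H" "bpow k \<in> H \<Longrightarrow> bpow i \<in> H"
    using apow_add[of k k] bpow_add[of k k] assms(1) by (auto simp: subgp_closed)
qed

lemma GS_subset: "subgp H \<Longrightarrow> apow i \<in> H \<Longrightarrow> bpow j \<in> H \<Longrightarrow> i \<noteq> 0 \<Longrightarrow> j \<noteq> 0 \<Longrightarrow> GS \<subseteq> H"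
  unfolding GS_def by (rule gen_least) (auto intro: pow_subgp_nonzero)

text \<open>Elements with at most \<open>n\<close> syllables of \<open>b\<close>; "at most" because
  the exponents \<open>j\<close> and \<open>i\<close> may be 0.\<close>

primrec Len :: "nat \<Rightarrow> aut set" where
  "Len 0 = range apow"
| "Len (Suc n) = {x + (bpow j + apow i) | x j i. x \<in> Len n}"

lemma Len_Suc_mono: "Len n \<subseteq> Len (Suc n)"
proof
  fix x assume "x \<in> Len n"
  then have "x = x + (bpow 0 + apow 0)" "x \<in> Len n" by auto
  then show "x \<in> Len (Suc n)" by (auto simp del: bpow_zero apow_zero)
qed

lemma Len_mono: "m \<le> n \<Longrightarrow> Len m \<subseteq> Len n"
  by (rule lift_Suc_mono_le[of Len]) (rule Len_Suc_mono)

lemma Len_apow: "x \<in> Len n \<Longrightarrow> x + apow i \<in> Len n"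
proof (cases n)
  case (Suc m)
  moreover assume "x \<in> Len n"
  ultimately obtain y j k where "x = y + (bpow j + apow k)" "y \<in> Len m" by auto
  then have "x + apow i = y + (bpow j + apow (k + i))" by (simp add: aut_simps apow_add)
  with \<open>y \<in> Len m\<close> Suc show ?thesis by auto
qed (auto simp flip: apow_add)

lemma Len_add: "x \<in> Len m \<Longrightarrow> y \<in> Len n \<Longrightarrow> x + y \<in> Len (m + n)"
proof (induction n arbitrary: y)
  case (Suc n)
  then obtain z j k where "y = z + (bpow j + apow k)" "z \<in> Len n" by auto
  with Suc have "x + y = (x + z) + (bpow j + apow k)" "x + z \<in> Len (m + n)" by (auto simp: aut_simps)
  then show ?case by auto
qed (auto simp: Len_apow)

lemma zero_in_Len: "0 \<in> Len n"
  using Len_mono[of 0 n] rangeI[of apow 0] by auto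

lemma bpow_in_Len: "bpow j \<in> Len 1"
proof -
  have "bpow j = apow 0 + (bpow j + apow 0)" by simp
  then show ?thesis unfolding One_nat_def Len.simps by blast
qed

lemma apow_in_Len: "apow i \<in> Len n"
  using Len_mono[of 0 n] by auto

lemma Len_uminus: "x \<in> Len n \<Longrightarrow> - x \<in> Len n"
proof (induction n arbitrary: x)
  case (Suc n)
  then obtain z j k where x: "x = z + (bpow j + apow k)" "z \<in> Len n" by auto
  have "apow (- k) + (bpow (- j) + - z) \<in> Len (0 + (1 + n))"
    using x(2) Suc.IH by (intro Len_add bpow_in_Len apow_in_Len)
  with x show ?case by (simp add: aut_simps apow_uminus bpow_uminus)
qed (auto simp flip: apow_uminus)

lemma Len_subset_GS: "Len n \<subseteq> GS"
  by (induction n) (auto intro!: GS_closed apow_in_GS bpow_in_GS)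

lemma GS_Len: "x \<in> GS \<Longrightarrow> \<exists>n. x \<in> Len n"
  unfolding GS_def
proof (induction rule: gen.induct)
  case (gen_base x)
  then show ?case using apow_in_Len bpow_in_Len by blast
qed (blast intro: zero_in_Len Len_add Len_uminus)+

lemma sec_in_GS: "x \<in> GS \<Longrightarrow> sec x i \<in> GS"
  unfolding GS_def
proof (induction arbitrary: i rule: gen.induct)
  case (gen_base x)
  then show ?case
    using apow_in_GS bpow_in_GS GS_closed(1) unfolding GS_def by auto
qed (auto intro: gen.intros)

lemma rot_sec_syllable: "\<exists>e. sec (bpow j + apow i) p = apow e \<or> sec (bpow j + apow i) p = bpow j \<and> p = 2"
  using letter_cases[of p] by auto

text \<open>Each syllable of \<open>b\<close> contributes a syllable to exactly one of the three
  sections, and powers of \<open>a\<close>, which cost nothing, to the other two.\<close>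

lemma sec_Len_total:
  "x \<in> Len n \<Longrightarrow> \<exists>k. k 0 + k 1 + k (2::3) \<le> n \<and> (\<forall>i. sec x i \<in> Len (k i))"
proof (induction n arbitrary: x)
  case 0
  then show ?case by (intro exI[of _ "\<lambda>_. 0"]) (auto simp: intro!: zero_in_Len[of 0, simplified])
next
  case (Suc n)
  then obtain y j i where x: "x = y + (bpow j + apow i)" "y \<in> Len n" by auto
  with Suc.IH obtain k where k: "k 0 + k 1 + k 2 \<le> n" "\<And>i. sec y i \<in> Len (k i)" by blast
  \<comment> \<open>The only vertex that \<open>y\<close> carries to 2, where \<open>bpow j\<close>
    has the section \<open>bpow j\<close>.\<close>
  define p where "p = 2 - rot y"
  have "sec x q \<in> Len ((k(p := Suc (k p))) q)" for q
  proof (cases "q = p")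
    case True
    then have "sec x q = sec y q + (bpow j + apow 0)" by (simp add: x p_def)
    with k(2)[of q] True show ?thesis by (auto simp del: apow_zero)
  next
    case False
    then have "q + rot y \<noteq> 2" by (auto simp: p_def eq_diff_eq)
    then obtain e where "sec x q = sec y q + apow e"
      using rot_sec_syllable[of j i "q + rot y"] by (auto simp: x)
    with k(2)[of q] False show ?thesis by (auto intro: Len_apow)
  qed
  moreover have "(k(p := Suc (k p))) 0 + (k(p := Suc (k p))) 1 + (k(p := Suc (k p))) 2 \<le> Suc n"
    using k(1) letter_cases[of p] by auto
  ultimately show ?case by blast
qed

lemma Len_SucE:
  assumes "x \<in> Len (Suc n)"
  obtains y j i where "x = y + (bpow j + apow i)" "y \<in> Len n"
  using assms by auto

text \<open>Two successive syllables either merge or are separated by a nontrivial rotation; in the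
  latter case a path cannot meet vertex 2 at both, so the pair yields at most one syllable in a
  given section.\<close>

lemma sec_Len_half: "x \<in> Len n \<Longrightarrow> sec x i \<in> Len ((n + 1) div 2)"
proof (induction n arbitrary: x i rule: less_induct)
  case (less n)
  consider "n = 0" | "n = 1" | m where "n = Suc (Suc m)"
    by (metis One_nat_def not0_implies_Suc)
  then show ?case
  proof cases
    case 1
    with less.prems have "sec x i = 0" by auto
    then show ?thesis by (simp only: zero_in_Len)
  next
    case 2
    from sec_Len_total[OF less.prems] obtain k where
      k: "k 0 + k 1 + k (2::3) \<le> n" "sec x i \<in> Len (k i)" by blast
    then have "k i \<le> (n + 1) div 2" using letter_cases[of i] 2 by auto
    with k(2) Len_mono show ?thesis by blast
  next
    case (3 m)
    with less.prems obtain z j i' y j' i'' where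
      x: "x = y + (bpow j' + apow i'')" "y = z + (bpow j + apow i')" "z \<in> Len m"
      by (metis Len_SucE)
    show ?thesis
    proof (cases "i' = 0")
      case True
      then have "x = z + (bpow (j + j') + apow i'')" by (simp add: x aut_simps bpow_add)
      then have "x \<in> Len (Suc m)" using x(3) by auto
      then have "sec x i \<in> Len ((Suc m + 1) div 2)" by (rule less.IH[rotated]) (use 3 in simp)
      then show ?thesis
        using Len_mono[of "(Suc m + 1) div 2" "(n + 1) div 2"] 3 by (auto simp del: Len.simps)
    next
      case False
      let ?p = "i + rot z"
      have z: "sec z i \<in> Len ((m + 1) div 2)" by (rule less.IH[OF _ x(3)]) (use 3 in simp)
      obtain e where e: "sec (bpow j + apow i') ?p = apow e \<or> sec (bpow j + apow i') ?p = bpow j \<and> ?p = 2"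
        using rot_sec_syllable by blast
      obtain e' where e': "sec (bpow j' + apow i'') (?p + i') = apow e' \<or>
          sec (bpow j' + apow i'') (?p + i') = bpow j' \<and> ?p + i' = 2"
        using rot_sec_syllable by blast
      have s: "sec x i = sec z i + (sec (bpow j + apow i') ?p + sec (bpow j' + apow i'') (?p + i'))"
        by (simp add: x aut_simps add.assoc)
      have "sec (bpow j + apow i') ?p + sec (bpow j' + apow i'') (?p + i') \<in> Len 1"
        using e e' False Len_add[OF apow_in_Len[of _ 0] apow_in_Len[of _ 1]]
          Len_add[OF apow_in_Len[of _ 0] bpow_in_Len] Len_add[OF bpow_in_Len apow_in_Len[of _ 0]]
        by auto
      then have "sec x i \<in> Len ((m + 1) div 2 + 1)" unfolding s using z Len_add by blast
      then show ?thesis using 3 by simp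
    qed
  qed
qed

text \<open>On \<open>GS\<close> this is the exponent sum of \<open>b\<close> modulo 3: the three sections of \<open>b\<close> rotate by \<open>1, -1, 0\<close>,
  and on the plane \<open>u + v + w = 0\<close> the functional \<open>u - w\<close> is invariant under cyclic shifts.\<close>

definition bet :: "aut \<Rightarrow> 3" where "bet x = rot (sec x 0) - rot (sec x 2)"

lemma GS_rot_sec_sum: "x \<in> GS \<Longrightarrow> rot (sec x p) + rot (sec x (p + 1)) + rot (sec x (p + 2)) = 0"
  unfolding GS_def
proof (induction arbitrary: p rule: gen.induct)
  case (gen_base x)
  then show ?case using letter_cases[of p] by auto
next
  case (gen_add x y)
  from gen_add.IH(1)[of p] gen_add.IH(2)[of "p + rot x"] show ?case
    by (simp add: algebra_simps)
next
  case (gen_uminus x)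
  have "rot (sec (- x) p) + rot (sec (- x) (p + 1)) + rot (sec (- x) (p + 2)) =
      - (rot (sec x (p - rot x)) + rot (sec x (p - rot x + 1)) + rot (sec x (p - rot x + 2)))"
    by (simp add: algebra_simps)
  with gen_uminus.IH[of "p - rot x"] show ?case by simp
qed simp

text \<open>Independence of the base vertex gives additivity of \<open>bet\<close>, because in a sum
  the sections of the second term are read at shifted positions.\<close>

lemma bet_shift: "x \<in> GS \<Longrightarrow> rot (sec x p) - rot (sec x (p + 2)) = bet x"
  using GS_rot_sec_sum[of x 0] letter_cases[of p] letter_cases[of "rot (sec x 0)"]
    letter_cases[of "rot (sec x 1)"] letter_cases[of "rot (sec x 2)"]
  unfolding bet_def by auto

lemma bet_add: "x \<in> GS \<Longrightarrow> y \<in> GS \<Longrightarrow> bet (x + y) = bet x + bet y"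
  using bet_shift[of y "rot x"] by (simp add: bet_def algebra_simps)

lemma bet_apow [simp]: "bet (apow k) = 0" and bet_bpow [simp]: "bet (bpow k) = k" and bet_zero [simp]: "bet 0 = 0"
  by (simp_all add: bet_def)

lemma bet_uminus: "x \<in> GS \<Longrightarrow> bet (- x) = - bet x"
  using bet_add[of x "- x"] GS_closed(3)[of x] by (simp add: eq_neg_iff_add_eq_0 add.commute)

text \<open>For \<open>b\<close> the rotations (1, -1, 0) are the cyclic differences of the
  exponents (0, 0, 1), and both sides are additive up to a common shift. This ties the classes
  modulo \<open>G'\<close> of the three sections together, which \<open>dense_secsI\<close>
  exploits.\<close>

lemma GS_rot_sec_bet: "x \<in> GS \<Longrightarrow> rot (sec x p) = bet (sec x (p + 2)) - bet (sec x (p + 1))"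
  unfolding GS_def
proof (induction arbitrary: p rule: gen.induct)
  case (gen_base x)
  then show ?case using letter_cases[of p] by auto
next
  case (gen_add x y)
  then have b: "bet (sec (x + y) q) = bet (sec x q) + bet (sec y (q + rot x))" for q
    using sec_in_GS[of x] sec_in_GS[of y] bet_add by (simp add: GS_def)
  have "rot (sec (x + y) p) = rot (sec x p) + rot (sec y (p + rot x))" by simp
  then show ?case
    unfolding b gen_add.IH(1)[of p] gen_add.IH(2)[of "p + rot x"] by (simp add: algebra_simps)
next
  case (gen_uminus x)
  then have b: "bet (sec (- x) q) = - bet (sec x (q - rot x))" for q
    using sec_in_GS[of x] bet_uminus by (simp add: GS_def)
  have "rot (sec (- x) p) = - rot (sec x (p - rot x))" by simp
  then show ?case
    unfolding b gen_uminus.IH[of "p - rot x"] by (simp add: algebra_simps)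
qed simp

lemma bet_sum: "x \<in> GS \<Longrightarrow> bet x = bet (sec x 0) + bet (sec x 1) + bet (sec x 2)"
  using GS_rot_sec_bet[of x 0] GS_rot_sec_bet[of x 2] letter_cases[of "bet (sec x 0)"]
    letter_cases[of "bet (sec x 1)"] letter_cases[of "bet (sec x 2)"]
  unfolding bet_def by auto

section \<open>Regular branching\<close>

definition embed :: "3 \<Rightarrow> aut \<Rightarrow> aut" where
  "embed i x = Node 0 (\<lambda>j. if j = i then x else 0)"

lemma rot_embed [simp]: "rot (embed i x) = 0"
  and sec_embed [simp]: "sec (embed i x) j = (if j = i then x else 0)"
  by (simp_all add: embed_def)

lemma embed_zero [simp]: "embed i 0 = 0"
  and embed_add: "embed i (x + y) = embed i x + embed i y"
  and embed_uminus: "embed i (- x) = - embed i x"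
  by (rule aut_eqI; simp)+

lemma embed_eq_zero [simp]: "embed i x = 0 \<longleftrightarrow> x = 0"
  by (metis embed_zero sec_embed)

primrec embedw :: "3 list \<Rightarrow> aut \<Rightarrow> aut" where
  "embedw [] x = x"
| "embedw (i # w) x = embed i (embedw w x)"

lemma embedw_zero [simp]: "embedw w 0 = 0"
  and embedw_add: "embedw w (x + y) = embedw w x + embedw w y"
  and embedw_uminus: "embedw w (- x) = - embedw w x"
  by (induction w) (auto simp: embed_add embed_uminus)

lemma apow_eq_zero [simp]: "apow k = 0 \<longleftrightarrow> k = 0"
  by (metis apow_zero rot_apow)

lemma embedw_eq_zero [simp]: "embedw w x = 0 \<longleftrightarrow> x = 0"
  by (induction w) auto

lemma embedw_append: "embedw (v @ w) x = embedw v (embedw w x)"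
  by (induction v) auto

lemma secw_append: "secw x (v @ w) = secw (secw x v) w"
  by (induction v arbitrary: x) auto

lemma secw_zero [simp]: "secw 0 w = 0"
  by (induction w) auto

lemma act_add: "act w (x + y) = act (act w x) y"
  by (induction w arbitrary: x y) (auto simp: add.assoc)

lemma act_zero [simp]: "act w 0 = w"
  by (induction w) auto

lemma length_act [simp]: "length (act w x) = length w"
  by (induction w arbitrary: x) auto

lemma act_uminus_cancel [simp]: "act (act w x) (- x) = w"
  by (simp flip: act_add)

lemma secw_in_GS: "x \<in> GS \<Longrightarrow> secw x w \<in> GS"
  by (induction w arbitrary: x) (auto intro: sec_in_GS)

lemma secw_embedw: "length v = length w \<Longrightarrow> secw (embedw v x) w = (if v = w then x else 0)"
  by (induction v w rule: list_induct2) auto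

section \<open>Vertex stabilizers, level stabilizers and commutators\<close>

primrec fixv :: "aut \<Rightarrow> 3 list \<Rightarrow> bool" where
  "fixv x [] = True"
| "fixv x (i # w) \<longleftrightarrow> rot x = 0 \<and> fixv (sec x i) w"

primrec stab :: "nat \<Rightarrow> aut \<Rightarrow> bool" where
  "stab 0 x = True"
| "stab (Suc n) x \<longleftrightarrow> rot x = 0 \<and> (\<forall>i. stab n (sec x i))"

lemma stab_zero [simp]: "stab n 0"
  by (induction n) auto

lemma stab_add: "stab n x \<Longrightarrow> stab n y \<Longrightarrow> stab n (x + y)"
  by (induction n arbitrary: x y) auto

lemma stab_uminus: "stab n x \<Longrightarrow> stab n (- x)"
  by (induction n arbitrary: x) auto

lemma stab_fixv: "stab n x \<Longrightarrow> length w \<le> n \<Longrightarrow> fixv x w"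
  by (induction n arbitrary: x w) (case_tac w; auto)+

lemma fixv_secw_add: "fixv x w \<Longrightarrow> secw (x + y) w = secw x w + secw y w"
  by (induction w arbitrary: x y) auto

lemma stab_eq_zero: "stab n x \<Longrightarrow> (\<And>w. length w = n \<Longrightarrow> secw x w = 0) \<Longrightarrow> x = 0"
proof (induction n arbitrary: x)
  case (Suc n)
  have s: "sec x i = 0" for i
  proof (rule Suc.IH)
    show "secw (sec x i) w = 0" if "length w = n" for w
      using Suc.prems(2)[of "i # w"] that by simp
  qed (use Suc.prems in auto)
  show ?case by (rule aut_eqI) (use Suc.prems(1) in \<open>simp_all add: s\<close>)
next
  case 0
  from 0(2)[of "[]"] show ?case by simp
qed

lemma fixv_all_eq_zero: "(\<And>w. fixv x w) \<Longrightarrow> x = 0"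
proof -
  assume a: "\<And>w. fixv x w"
  show "x = 0"
  proof (rule aut_bisim[where R = "\<lambda>x y. (\<forall>w. fixv x w) \<and> y = 0"])
    fix x y :: aut assume *: "(\<forall>w. fixv x w) \<and> y = 0"
    have "rot x = 0 \<and> fixv (sec x i) w" for i w using *[THEN conjunct1, rule_format, of "i # w"] by simp
    with * show "rot x = rot y \<and> (\<forall>i. (\<forall>w. fixv (sec x i) w) \<and> sec y i = 0)" by auto
  qed (use a in auto)
qed

text \<open>The portrait down to level \<open>n\<close>, flattened to a list: there are finitely
  many lists of a given length over three letters, so level stabilizers have finite index.\<close>

fun prof :: "nat \<Rightarrow> aut \<Rightarrow> 3 list" where
  "prof 0 x = []"
| "prof (Suc n) x = rot x # prof n (sec x 0) @ prof n (sec x 1) @ prof n (sec x 2)"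

lemma length_prof: "length (prof n x) = length (prof n 0)"
proof -
  have "length (prof n x) = length (prof n y)" for x y
  proof (induction n arbitrary: x y)
    case (Suc n)
    from Suc[of "sec x 0" "sec y 0"] Suc[of "sec x 1" "sec y 1"] Suc[of "sec x 2" "sec y 2"]
    show ?case by simp
  qed simp
  then show ?thesis .
qed

lemma prof_eq_stab: "prof n x = prof n y \<Longrightarrow> stab n (x - y)"
proof (induction n arbitrary: x y)
  case (Suc n)
  have l: "length (prof n u) = length (prof n v)" for u v
    using length_prof[of n u] length_prof[of n v] by simp
  from Suc.prems have r: "rot x = rot y" and "\<forall>i. prof n (sec x i) = prof n (sec y i)"
    by (auto simp: ball3 append_eq_append_conv[OF disjI1, OF l])
  with Suc.IH have "\<forall>i. stab n (sec x i - sec y i)" by blast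
  with r show ?case by simp
qed simp

lemma finite_prof: "finite (prof n ` K)"
proof (rule finite_subset)
  show "prof n ` K \<subseteq> {w :: 3 list. set w \<subseteq> UNIV \<and> length w = length (prof n 0)}"
    using length_prof by auto
  show "finite {w :: 3 list. set w \<subseteq> UNIV \<and> length w = length (prof n 0)}"
    by (rule finite_lists_length_eq) (simp add: UNIV3)
qed

lemma fi_stab: "subgp K \<Longrightarrow> fi {x \<in> K. stab n x} K"
  by (rule fiI[of "prof n"]) (auto simp: finite_prof prof_eq_stab intro: subgp_diff)

lemma subgp_stab: "subgp K \<Longrightarrow> subgp {x \<in> K. stab n x}"
  by (rule subgpI) (auto simp: stab_add stab_uminus intro: subgp_closed)

definition comm :: "aut \<Rightarrow> aut \<Rightarrow> aut" where "comm x y = x + y - x - y"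

lemma comm_embed: "rot g = 0 \<Longrightarrow> comm g (embed i x) = embed i (comm (sec g i) x)"
  by (rule aut_eqI) (auto simp: comm_def aut_simps)

lemma comm_embedw: "fixv g w \<Longrightarrow> comm g (embedw w x) = embedw w (comm (secw g w) x)"
  by (induction w arbitrary: g) (auto simp: comm_embed)

text \<open>As \<open>g\<close> moves \<open>i\<close>, the inner commutator is \<open>- x\<close>
  at \<open>i\<close> and a conjugate of \<open>x\<close> at another vertex; commuting with an
  element supported at \<open>i\<close> sees only the first.\<close>

lemma comm_comm_embed:
  "rot g \<noteq> 0 \<Longrightarrow> comm (comm g (embed i x)) (embed i y) = embed i (comm (- x) y)"
  by (rule aut_eqI) (auto simp: comm_def aut_simps)

lemma comm_comm_embedw:
  "\<not> fixv g w \<Longrightarrow> comm (comm g (embedw w x)) (embedw w y) = embedw w (comm (- x) y)"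
proof (induction w arbitrary: g)
  case (Cons i w)
  show ?case
  proof (cases "rot g = 0")
    case True
    with Cons show ?thesis by (simp add: comm_embed)
  next
    case False
    have "comm (comm g (embed i (embedw w x))) (embed i (embedw w y)) = embed i (comm (- embedw w x) (embedw w y))"
      using False by (rule comm_comm_embed)
    also have "comm (- embedw w x) (embedw w y) = embedw w (comm (- x) y)"
      by (simp add: comm_def diff_conv_add_uminus embedw_add embedw_uminus)
    finally show ?thesis by simp
  qed
qed simp

lemma conj_embed: "- g + embed i x + g = embed (i + rot g) (- sec g i + x + sec g i)"
  by (rule aut_eqI) (auto simp: aut_simps)

lemma conj_embedw: "- g + embedw w x + g = embedw (act w g) (- secw g w + x + secw g w)"
  by (induction w arbitrary: g) (auto simp: conj_embed)

text \<open>Self-replication: conjugating \<open>b\<close> by powers of \<open>a\<close> brings both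
  section \<open>a\<close> and section \<open>b\<close> to the vertex \<open>i\<close>.\<close>

lemma lift_sec: "g \<in> GS \<Longrightarrow> \<exists>h\<in>GS. rot h = 0 \<and> sec h i = g"
proof -
  define S where "S = (\<lambda>h. sec h i) ` {h \<in> GS. rot h = 0}"
  have S: "subgp S" unfolding S_def
    by (rule subgp_image) (auto simp: hom_on_def intro!: subgpI GS_closed)
  have "sec (bpow 1) (i - k) \<in> S" for k
    unfolding S_def
    by (rule image_eqI[of _ _ "- apow k + bpow 1 + apow k"]) (auto intro!: GS_closed apow_in_GS bpow_in_GS)
  from this[of i] this[of "i - 2"] have "apow 1 \<in> S" "bpow 1 \<in> S" by auto
  then have "GS \<subseteq> S" using GS_subset[OF S] by auto
  then show "g \<in> GS \<Longrightarrow> ?thesis" unfolding S_def by auto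
qed

lemma act_transitive: "length v = length w \<Longrightarrow> \<exists>g\<in>GS. act v g = w"
proof (induction v w rule: list_induct2)
  case (Cons i v j w)
  then obtain g where "g \<in> GS" "act v g = w" by auto
  moreover from lift_sec[OF this(1)] obtain h where "h \<in> GS" "rot h = 0" "sec h i = g" by blast
  ultimately show ?case
    by (intro bexI[of _ "h + apow (j - i)"]) (auto intro: GS_closed apow_in_GS)
qed (auto intro: GS_closed)

text \<open>The commutator subgroup of \<open>GS\<close>.\<close>

definition GSD :: "aut set" where "GSD = {x \<in> GS. rot x = 0 \<and> bet x = 0}"

lemma GSD_iff: "x \<in> GSD \<longleftrightarrow> x \<in> GS \<and> rot x = 0 \<and> bet x = 0"
  by (simp add: GSD_def)

lemma subgp_GSD: "subgp GSD"
  by (rule subgpI) (auto simp: GSD_iff bet_add bet_uminus intro: GS_closed)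

lemmas GSD_closed = subgp_closed[OF subgp_GSD]

lemma GSD_conj: "x \<in> GSD \<Longrightarrow> g \<in> GS \<Longrightarrow> - g + x + g \<in> GSD"
  by (auto simp: GSD_iff bet_add bet_uminus GS_closed)

definition normalGS :: "aut set \<Rightarrow> bool" where
  "normalGS N \<longleftrightarrow> subgp N \<and> N \<subseteq> GS \<and> (\<forall>g\<in>GS. \<forall>x\<in>N. - g + x + g \<in> N)"

lemma normalGS_conj: "normalGS N \<Longrightarrow> g \<in> GS \<Longrightarrow> x \<in> N \<Longrightarrow> - g + x + g \<in> N"
  by (simp add: normalGS_def)

lemma normalGS_conj': "normalGS N \<Longrightarrow> g \<in> GS \<Longrightarrow> x \<in> N \<Longrightarrow> g + x + - g \<in> N"
  using normalGS_conj[of N "- g" x] by (simp add: GS_closed)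

lemma normalGS_subgp: "normalGS N \<Longrightarrow> subgp N" and normalGS_subset: "normalGS N \<Longrightarrow> N \<subseteq> GS"
  by (simp_all add: normalGS_def)

lemma normalGS_comm: "normalGS N \<Longrightarrow> g \<in> N \<Longrightarrow> y \<in> GS \<Longrightarrow> comm g y \<in> N"
  using normalGS_conj'[of N y "- g"] subgp_add[OF normalGS_subgp, of N g "y + - g + - y"]
  by (simp add: comm_def aut_simps normalGS_subgp subgp_closed)

lemma subgp_comm:
  assumes "normalGS N" "y \<in> GS" shows "subgp {x \<in> GS. comm x y \<in> N}"
proof (rule subgpI)
  note N = normalGS_subgp[OF assms(1)]
  show "0 \<in> {x \<in> GS. comm x y \<in> N}" by (auto simp: comm_def GS_closed subgp_closed[OF N])
  show "u + v \<in> {x \<in> GS. comm x y \<in> N}" if "u \<in> {x \<in> GS. comm x y \<in> N}" "v \<in> {x \<in> GS. comm x y \<in> N}" for u v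
  proof -
    have "(u + comm v y + - u) + comm u y \<in> N"
      using that by (auto intro!: subgp_add[OF N] normalGS_conj'[OF assms(1)])
    moreover have "(u + comm v y + - u) + comm u y = comm (u + v) y" by (simp add: comm_def aut_simps)
    ultimately show ?thesis using that by (auto intro: GS_closed)
  qed
  show "- u \<in> {x \<in> GS. comm x y \<in> N}" if "u \<in> {x \<in> GS. comm x y \<in> N}" for u
  proof -
    have "- u + - comm u y + u \<in> N"
      using that by (auto intro!: subgp_uminus[OF N] normalGS_conj[OF assms(1)])
    moreover have "- u + - comm u y + u = comm (- u) y" by (simp add: comm_def aut_simps)
    ultimately show ?thesis using that by (auto intro: GS_closed)
  qed
qed

lemma comm_swap: "comm y x = - comm x y"
  by (simp add: comm_def aut_simps)

text \<open>Modulo \<open>N\<close> the generators commute, so powers can be collected along a word: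
  \<open>x\<close> is congruent to \<open>apow (rot x) + bpow (bet x)\<close>, which vanishes on
  \<open>GSD\<close>.\<close>

lemma GSD_least:
  assumes N: "normalGS N" and c: "comm (apow 1) (bpow 1) \<in> N" shows "GSD \<subseteq> N"
proof -
  note Ns = normalGS_subgp[OF N]
  have sub: "GS \<subseteq> {x \<in> GS. comm x y \<in> N}" 
    if "y \<in> GS" "comm (apow 1) y \<in> N" "comm (bpow 1) y \<in> N" for y
    by (rule GS_subset[OF subgp_comm[OF N that(1)], of 1 1]) (use that apow_in_GS bpow_in_GS in auto)
  have c0: "comm x x = 0" for x by (simp add: comm_def aut_simps)
  have "comm x (apow 1) \<in> N \<and> comm x (bpow 1) \<in> N" if "x \<in> GS" for x
    using sub[of "apow 1"] sub[of "bpow 1"] c that subgp_closed[OF Ns]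
    by (auto simp: c0 apow_in_GS bpow_in_GS comm_swap[of "bpow 1" "apow 1"])
  then have com: "comm x y \<in> N" if "x \<in> GS" "y \<in> GS" for x y
    using sub[of x] that subgp_uminus[OF Ns] comm_swap by (metis (no_types, lifting) mem_Collect_eq subsetD)
  have "x - (apow (rot x) + bpow (bet x)) \<in> N" if "x \<in> Len n" for n x
    using that
  proof (induction n arbitrary: x)
    case 0
    then show ?case by (auto simp: aut_simps subgp_closed[OF Ns])
  next
    case (Suc n)
    then obtain y j i where x: "x = y + (bpow j + apow i)" "y \<in> Len n" by auto
    then have y: "y \<in> GS" using Len_subset_GS by auto
    define r s where "r = rot y" and "s = bet y"
    have "(y - (apow r + bpow s)) + (apow r + comm (bpow (s + j)) (apow i) + - apow r) \<in> N"
      using Suc.IH[OF x(2)] com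
      by (auto simp: r_def s_def intro!: subgp_add[OF Ns] normalGS_conj'[OF N] apow_in_GS bpow_in_GS)
    also have "(y - (apow r + bpow s)) + (apow r + comm (bpow (s + j)) (apow i) + - apow r) =
      x - (apow (rot x) + bpow (bet x))"
      using y by (simp add: x comm_def aut_simps bet_add apow_in_GS bpow_in_GS GS_closed apow_add bpow_add r_def s_def)
    finally show ?case .
  qed
  then show ?thesis using GS_Len by (fastforce simp: GSD_iff)
qed

text \<open>Differences of conjugates of \<open>b\<close> by powers of \<open>a\<close> have
  \<open>bet\<close> equal to 0. Their sections at \<open>i\<close> include
  \<open>apow 1 - apow 2\<close> and \<open>bpow 1 - apow 1\<close>, which generate the
  group.\<close>

lemma lift_sec_GSD: "g \<in> GS \<Longrightarrow> \<exists>d\<in>GSD. sec d i = g"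
proof -
  define S where "S = (\<lambda>h. sec h i) ` GSD"
  have S: "subgp S" unfolding S_def
    by (rule subgp_image) (auto simp: hom_on_def GSD_iff intro!: GSD_closed subgp_GSD)
  define b where "b k = - apow k + bpow 1 + apow k" for k
  have b: "b k \<in> GS" "rot (b k) = 0" "bet (b k) = 1" "sec (b k) i = sec (bpow 1) (i - k)" for k
    by (auto simp: b_def bet_add bet_uminus GS_closed apow_in_GS bpow_in_GS)
  have *: "sec (bpow 1) (i - k) - sec (bpow 1) (i - l) \<in> S" for k l
    unfolding S_def
    by (rule image_eqI[of _ _ "b k - b l"])
       (auto simp: b GSD_iff aut_simps bet_add bet_uminus GS_closed)
  have "apow 1 - apow 2 = apow 2" by (rule aut_eqI) auto
  with *[of i "i - 1"] have "apow 2 \<in> S" by simp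
  moreover have "(bpow 1 - apow 1) + apow 1 \<in> S"
    using *[of "i - 2" i] pow_subgp_nonzero(1)[OF S _ \<open>apow 2 \<in> S\<close>, of 1]
    by (intro subgp_add[OF S]) auto
  ultimately have "GS \<subseteq> S" using GS_subset[OF S, of 2 1] by auto
  then show "g \<in> GS \<Longrightarrow> ?thesis" unfolding S_def by auto
qed

text \<open>For \<open>N\<close> inside \<open>GS\<close>, the part of \<open>N\<close> supported
  below \<open>w\<close> (its rigid stabilizer), read as a subgroup of \<open>GS\<close> through the
  section at \<open>w\<close>.\<close>

definition pull :: "3 list \<Rightarrow> aut set \<Rightarrow> aut set" where
  "pull w N = {x \<in> GS. embedw w x \<in> N}"

lemma subgp_pull: "subgp N \<Longrightarrow> subgp (pull w N)"
  by (rule subgpI)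
     (auto simp: pull_def embedw_add embedw_uminus subgp_zero GS_closed intro: subgp_add subgp_uminus)

lemma pull_Cons: "N \<subseteq> GS \<Longrightarrow> pull (i # w) N = pull w (pull [i] N)"
proof -
  have "embedw w x \<in> GS" if "N \<subseteq> GS" "embed i (embedw w x) \<in> N" for x
    using that sec_in_GS[of "embed i (embedw w x)" i] by auto
  then show "N \<subseteq> GS \<Longrightarrow> ?thesis" by (auto simp: pull_def)
qed

text \<open>Conjugation by \<open>g\<close> below \<open>i\<close> is induced by an element of the
  first level stabilizer with section \<open>g\<close> at \<open>i\<close>.\<close>

lemma normalGS_pull1: "normalGS N \<Longrightarrow> normalGS (pull [i] N)"
  unfolding normalGS_def[of "pull [i] N"]
proof (intro conjI ballI)
  assume N: "normalGS N"
  fix g x assume g: "g \<in> GS" and x: "x \<in> pull [i] N"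
  obtain h where h: "h \<in> GS" "rot h = 0" "sec h i = g" using lift_sec[OF g] by blast
  have "- h + embed i x + h \<in> N" using normalGS_conj[OF N h(1)] x by (auto simp: pull_def)
  then show "- g + x + g \<in> pull [i] N" using g x h by (auto simp: pull_def conj_embed GS_closed)
next
  show "normalGS N \<Longrightarrow> subgp (pull [i] N)" by (intro subgp_pull normalGS_subgp)
  show "pull [i] N \<subseteq> GS" by (auto simp: pull_def)
qed

lemma normalGS_pull: "normalGS N \<Longrightarrow> normalGS (pull w N)"
proof (induction w arbitrary: N)
  case Nil
  then have "pull [] N = N" using normalGS_subset[of N] by (auto simp: pull_def)
  with Nil show ?case by simp
next
  case (Cons i w)
  have "normalGS (pull w (pull [i] N))" by (intro Cons.IH normalGS_pull1 Cons.prems)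
  then show ?case by (simp only: pull_Cons[OF normalGS_subset[OF Cons.prems], of i w])
qed

definition three :: "aut \<Rightarrow> aut" where "three x = x + (x + x)"

lemma three_apow: "three (apow k) = 0" and three_bpow: "three (bpow k) = 0"
proof -
  have k: "k + (k + k) = 0" using letter_cases[of k] by auto
  have "three (apow k) = apow (k + (k + k))" "three (bpow k) = bpow (k + (k + k))"
    by (simp_all only: three_def apow_add bpow_add)
  then show "three (apow k) = 0" "three (bpow k) = 0" by (simp_all only: k apow_zero bpow_zero)
qed

lemma three_conj: "three (- g + x + g) = - g + three x + g"
  by (simp add: three_def aut_simps)

lemma three_zero [simp]: "three 0 = 0"
  by (simp add: three_def)

lemma three_sec: "rot x = 0 \<Longrightarrow> sec (three x) i = three (sec x i)"
  by (simp add: three_def)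

text \<open>The sections of [a, b] are \<open>a\<close>, \<open>ba\<close> and the inverse of
  \<open>ba^2\<close>. The cube of \<open>ba^k\<close> fixes level 1, and its sections are
  conjugates of \<open>b\<close>, which has order 3.\<close>

lemma nine_comm: "three (three (comm (apow 1) (bpow 1))) = 0"
proof -
  have a2: "apow 2 = - apow 1" using apow_uminus[of 1] by simp
  have *: "three (three (bpow 1 + apow k)) = 0" if k: "k = 1 \<or> k = 2" for k
  proof (rule aut_eqI)
    have r: "rot (three (bpow 1 + apow k)) = 0" using k by (auto simp: three_def)
    then show "rot (three (three (bpow 1 + apow k))) = rot 0" by (simp add: three_def)
    fix i :: 3
    \<comment> \<open>Each section of the cube is a cyclic rotation of the product of
      \<open>a\<close>, \<open>a^-1\<close> and \<open>b\<close>; \<open>e\<close> is the exponent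
      of the power of \<open>a\<close> by which this rotation conjugates \<open>b\<close>.\<close>
    define e :: 3 where "e = (if k = 1 \<and> i = 1 then 1 else if k = 2 \<and> i = 0 then 2 else 0)"
    have "sec (three (bpow 1 + apow k)) i = - apow e + bpow 1 + apow e"
      using k letter_cases[of i]
      by (elim disjE) (simp_all add: three_def aut_simps e_def a2)
    then show "sec (three (three (bpow 1 + apow k))) i = sec 0 i"
      by (simp add: three_sec r three_conj three_bpow)
  qed
  have a3: "- apow 1 + - apow 1 = apow 1" by (rule aut_eqI) auto
  let ?c = "comm (apow 1) (bpow 1)"
  have c: "sec ?c 0 = apow 1" "sec ?c 1 = bpow 1 + apow 1" "sec ?c 2 = - (bpow 1 + apow 2)"
    using a3 by (simp_all add: comm_def aut_simps a2)
  show ?thesis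
  proof (rule aut_eqI)
    fix i
    have u: "three (- x) = - three x" for x by (simp add: three_def aut_simps)
    have r: "rot ?c = 0" "rot (three ?c) = 0" by (simp_all add: comm_def three_def)
    have "three (three (sec ?c i)) = 0"
      using letter_cases[of i] *[of 1] *[of 2] c by (auto simp: three_apow u)
    then show "sec (three (three ?c)) i = sec 0 i" by (simp add: three_sec r)
  qed (simp add: comm_def three_def)
qed

text \<open>With \<open>c = [a, b]\<close> and \<open>c\<^sup>a\<close> its conjugate, \<open>[b, b\<^sup>a] = (c, 0, c\<^sup>a)\<close>; combining conjugates of it isolates
  \<open>(c\<^sup>a + c, 0, 0)\<close>. Modulo the normal closure of \<open>c\<^sup>a + c\<close>, conjugation by \<open>a\<close> inverts \<open>c\<close>, so \<open>a\<^sup>3 = 1\<close> gives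
  \<open>2c = 0\<close>, and \<open>9c = 0\<close> by direct computation.\<close>

lemma branching:
  assumes N: "normalGS N" and c: "comm (bpow 1) (- apow 1 + bpow 1 + apow 1) \<in> N" and x: "x \<in> GSD"
  shows "embed i x \<in> N"
proof -
  note Ns = normalGS_subgp[OF N]
  define a b where "a = apow 1" and "b = bpow 1"
  have aG: "a \<in> GS" "b \<in> GS" by (simp_all add: a_def b_def apow_in_GS bpow_in_GS)
  define c where "c = comm a b"
  define c' where "c' = - a + c + a"
  define u where "u = comm (bpow 1) (- apow 1 + bpow 1 + apow 1)"
  define v where "v = - apow 1 + u + apow 1"
  define v' where "v' = - apow 2 + u + apow 2"
  define h where "h = - (- apow 1 + bpow 1 + apow 1)"
  have a': "apow 2 = - a" using apow_uminus[of 1] by (simp add: a_def)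
  have hG: "h \<in> GS" by (auto simp: h_def intro!: GS_closed apow_in_GS bpow_in_GS)
  have uN: "u \<in> N" using c by (simp add: u_def)
  have vN: "v \<in> N" "v' \<in> N"
    unfolding v_def v'_def by (intro normalGS_conj[OF N] apow_in_GS uN)+
  note uN = uN vN normalGS_conj[OF N hG vN(2)]
  \<comment> \<open>Here u = (c, 0, c'), v = (c', c, 0), v' = (0, c', c), and conjugation by
    \<open>h\<close> turns v' into (0, c, c'). Subtracting this from u cancels the third coordinate,
    and adding v cancels the second.\<close>
  then have "v + (u - (- h + v' + h)) \<in> N" by (intro subgp_add[OF Ns] subgp_diff[OF Ns] uN)
  also have "v + (u - (- h + v' + h)) = embed 0 (c' + c)"
  proof (rule aut_eqI)
    fix i
    have su: "sec u 0 = c" "sec u 1 = 0" "sec u 2 = c'"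
      by (simp_all add: u_def comm_def c_def c'_def a_def b_def aut_simps a'[unfolded a_def])
    have sv: "sec v 0 = c'" "sec v 1 = c" "sec v 2 = 0" "sec v' 0 = 0" "sec v' 1 = c'" "sec v' 2 = c"
      by (simp_all add: v_def v'_def su)
    have r: "rot u = 0" "rot v = 0" "rot v' = 0" "rot h = 0" by (simp_all add: u_def v_def v'_def h_def comm_def)
    have sh: "sec h 0 = - b" "sec h 1 = - a" "sec h 2 = a"
      by (simp_all add: h_def a_def b_def a'[unfolded a_def])
    show "sec (v + (u - (- h + v' + h))) i = sec (embed 0 (c' + c)) i"
      using letter_cases[of i] by (auto simp: su sv r sh aut_simps c'_def)
  qed (simp add: u_def v_def v'_def h_def comm_def)
  finally have "c' + c \<in> pull [0] N"
    using aG by (auto simp: pull_def c'_def c_def comm_def GS_closed)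
  moreover define M where "M = pull [0] N"
  ultimately have 1: "c' + c \<in> M" by simp
  have M: "normalGS M" unfolding M_def by (rule normalGS_pull[OF N])
  note Ms = normalGS_subgp[OF M]
  have cG: "c \<in> GS" using aG by (auto simp: c_def comm_def GS_closed)
  define c'' where "c'' = - a + c' + a"
  have aaa: "a + (a + a) = 0" using three_apow[of 1] by (simp add: three_def a_def)
  have 2: "c'' + c' \<in> M" using normalGS_conj[OF M aG(1) 1] by (simp add: c''_def c'_def aut_simps)
  have "- a + c'' + a = c"
  proof -
    have "- a + c'' + a = - (a + (a + a)) + c + (a + (a + a))" by (simp add: c''_def c'_def aut_simps)
    then show ?thesis by (simp only: aaa) simp
  qed
  moreover have "- a + (c'' + c') + a = (- a + c'' + a) + c''" by (simp add: c''_def aut_simps)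
  ultimately have 3: "c + c'' \<in> M" using normalGS_conj[OF M aG(1) 2] by simp
  \<comment> \<open>In c + c'' + c' + c the middle pair is removed by a conjugate of itself, leaving
    c + c.\<close>
  have "- (c + (c'' + c') + - c) + ((c + c'') + (c' + c)) \<in> M"
    by (intro subgp_closed[OF Ms] normalGS_conj'[OF M cG] 1 2 3)
  then have 4: "c + c \<in> M" by (simp add: aut_simps)
  have "c + ((c + c) + (c + c) + (c + c) + (c + c)) = 0"
    using nine_comm by (simp add: three_def c_def a_def b_def aut_simps)
  then have "c = - ((c + c) + (c + c) + (c + c) + (c + c))" by (simp add: eq_neg_iff_add_eq_0)
  also have "\<dots> \<in> M" by (intro subgp_closed[OF Ms] 4)
  finally have "GSD \<subseteq> M" by (intro GSD_least[OF M]) (simp add: c_def a_def b_def)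
  with x have "embed 0 x \<in> N" by (auto simp: M_def pull_def)
  from normalGS_conj[OF N apow_in_GS this, of i] show ?thesis by (simp add: conj_embed)
qed

lemma embed_GSD: "x \<in> GSD \<Longrightarrow> embed i x \<in> GSD"
proof -
  have "normalGS GS" by (auto simp: normalGS_def subgp_GS GS_closed)
  moreover have "comm (bpow 1) (- apow 1 + bpow 1 + apow 1) \<in> GS"
    by (auto simp: comm_def GS_closed apow_in_GS bpow_in_GS)
  moreover assume x: "x \<in> GSD"
  ultimately have "embed i x \<in> GS" by (rule branching)
  with x show ?thesis by (auto simp: GSD_iff bet_def)
qed

lemma embedw_GSD: "x \<in> GSD \<Longrightarrow> embedw w x \<in> GSD"
  by (induction w) (auto intro: embed_GSD)

lemma fixv_moved_prefix: "x \<noteq> 0 \<Longrightarrow> \<exists>v. \<not> fixv x v"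
  using fixv_all_eq_zero by blast

lemma comm_in_GS: "x \<in> GS \<Longrightarrow> y \<in> GS \<Longrightarrow> comm x y \<in> GS"
  by (simp add: comm_def GS_closed)

lemma GSD_subset: "GSD \<subseteq> GS"
  by (auto simp: GSD_iff)

text \<open>An element of \<open>GSD\<close> with section \<open>a\<close> at 0 does not commute
  with a nontrivial copy at the vertex 00, because \<open>a\<close> moves that copy away.\<close>

lemma GSD_nonabelian: "\<exists>x\<in>GSD. \<exists>y\<in>GSD. comm x y \<noteq> 0"
proof -
  obtain d where d: "d \<in> GSD" "sec d 0 = apow 1" using lift_sec_GSD apow_in_GS by blast
  then have "embed 0 d \<in> GSD" "rot d = 0" "d \<noteq> 0"
    using embed_GSD[of d 0] by (auto simp: GSD_iff)
  have "comm (apow 1) (embed 0 d) \<noteq> 0"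
  proof
    assume "comm (apow 1) (embed 0 d) = 0"
    then have "sec (comm (apow 1) (embed 0 d)) 0 = 0" by simp
    with \<open>d \<noteq> 0\<close> show False by (simp add: comm_def)
  qed
  then have "comm d (embed 0 (embed 0 d)) \<noteq> 0"
    using d \<open>rot d = 0\<close> by (simp add: comm_embed)
  moreover have "embed 0 (embed 0 d) \<in> GSD" using d(1) by (intro embed_GSD)
  ultimately show ?thesis using d(1) by blast
qed

text \<open>At a vertex moved by \<open>k\<close>, a double commutator with \<open>k\<close> yields
  a nontrivial commutator of elements of \<open>GSD\<close>; this is impossible if \<open>k\<close>
  commutes with the inner one.\<close>

lemma GSD_centralizer:
  assumes "k \<noteq> 0" shows "\<exists>x\<in>GSD. comm k x \<noteq> 0"
proof (rule ccontr)
  assume a: "\<not> ?thesis"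
  obtain p where p: "\<not> fixv k p" using fixv_moved_prefix[OF assms] by blast
  obtain x y where xy: "x \<in> GSD" "y \<in> GSD" "comm x y \<noteq> 0" using GSD_nonabelian by blast
  have "embedw p (- x) \<in> GSD" using xy(1) by (intro embedw_GSD GSD_closed(3))
  with a have "comm k (embedw p (- x)) = 0" by simp
  then have "embedw p (comm (- (- x)) y) = comm 0 (embedw p y)"
    using comm_comm_embedw[OF p, of "- x" y] by simp
  with xy(3) show False by (simp add: comm_def)
qed

lemma infinite_GSD: "infinite GSD"
proof
  assume fin: "finite GSD"
  obtain d where d: "d \<in> GSD" "sec d 1 = apow 1" using lift_sec_GSD apow_in_GS by blast
  have "inj_on (embed 0) GSD" by (rule inj_onI) (metis sec_embed)
  moreover have "embed 0 ` GSD \<subseteq> GSD" using embed_GSD by auto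
  ultimately have "d \<in> embed 0 ` GSD" using endo_inj_surj[OF fin] d(1) by blast
  then have "sec d 1 = 0" by auto
  then have "rot (apow 1) = rot 0" using d(2) by metis
  then show False by simp
qed

lemma infinite_GS: "infinite GS"
  using infinite_GSD GSD_subset finite_subset by blast

lemma embed_decompose: "rot g = 0 \<Longrightarrow> g = embed 0 (sec g 0) + (embed 1 (sec g 1) + embed 2 (sec g 2))"
proof (rule aut_eqI)
  show "sec g i = sec (embed 0 (sec g 0) + (embed 1 (sec g 1) + embed 2 (sec g 2))) i" for i
    using letter_cases[of i] by auto
qed simp

section \<open>Deep copies of the commutator subgroup\<close>

definition deep :: "nat \<Rightarrow> aut set \<Rightarrow> bool" where
  "deep l L \<longleftrightarrow> (\<forall>w. length w = l \<longrightarrow> embedw w ` GSD \<subseteq> L)"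

text \<open>The two extra levels come from \<open>l = 0\<close>: fixing level 2 forces the rotations
  at the root and on level 1 to vanish, hence also \<open>bet\<close>, so the element lies in
  \<open>GSD\<close>.\<close>

lemma deep_stab: "subgp L \<Longrightarrow> deep l L \<Longrightarrow> g \<in> GS \<Longrightarrow> stab (l + 2) g \<Longrightarrow> g \<in> L"
proof (induction l arbitrary: g L)
  case 0
  then have "g \<in> GSD" by (auto simp: GSD_iff bet_def eval_nat_numeral)
  with 0 show ?case by (auto simp: deep_def)
next
  case (Suc l)
  have "sec g i \<in> {x. embed i x \<in> L}" for i
  proof (rule Suc.IH)
    show "subgp {x. embed i x \<in> L}"
      by (rule subgpI) (auto simp: embed_add embed_uminus subgp_closed[OF Suc.prems(1)])
    show "deep l {x. embed i x \<in> L}" unfolding deep_def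
    proof (intro allI impI)
      fix w :: "3 list" assume "length w = l"
      then have "embedw (i # w) ` GSD \<subseteq> L" using Suc.prems(2) unfolding deep_def by (metis length_Cons)
      then show "embedw w ` GSD \<subseteq> {x. embed i x \<in> L}" by auto
    qed
  qed (use Suc.prems sec_in_GS in auto)
  moreover have "rot g = 0" using Suc.prems by simp
  ultimately have "embed 0 (sec g 0) + (embed 1 (sec g 1) + embed 2 (sec g 2)) \<in> L"
    by (intro subgp_add[OF Suc.prems(1)]) auto
  then show ?case by (simp only: embed_decompose[OF \<open>rot g = 0\<close>, symmetric])
qed

lemma deep_fi: "subgp L \<Longrightarrow> deep l L \<Longrightarrow> fi L GS"
  using fi_mono[OF fi_stab[OF subgp_GS, of "l + 2"], of L] deep_stab by blast

text \<open>If \<open>g \<in> N\<close> moves \<open>v\<close>, double commutators with \<open>g\<close> put a copy of \<open>[G', G']\<close> at \<open>v\<close> into \<open>N\<close>; two levels further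
  down this contains \<open>[b, b\<^sup>a]\<close>, so branching applies.\<close>

lemma normal_deep:
  assumes N: "normalGS N" and "N \<noteq> {0}" shows "\<exists>l. deep l N"
proof -
  obtain g where g: "g \<in> N" "g \<noteq> 0" using assms subgp_zero[OF normalGS_subgp[OF N]] by blast
  obtain v where v: "\<not> fixv g v" using fixv_moved_prefix[OF g(2)] by blast
  define M where "M = pull v N"
  have M: "normalGS M" unfolding M_def by (rule normalGS_pull[OF N])
  have comm_M: "comm x y \<in> M" if "x \<in> GSD" "y \<in> GSD" for x y
  proof -
    have "comm (comm g (embedw v (- x))) (embedw v y) \<in> N"
      using that by (intro normalGS_comm[OF N] g subsetD[OF GSD_subset] embedw_GSD GSD_closed(3))
    then show ?thesis
      using comm_comm_embedw[OF v, of "- x" y] comm_in_GS[of x y] that GSD_subset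
      by (auto simp: M_def pull_def)
  qed
  define M0 where "M0 = pull [0] M"
  have M0: "normalGS M0" unfolding M0_def by (rule normalGS_pull[OF M])
  \<comment> \<open>One level lower the first argument becomes arbitrary, since the section at 0 of
    an element of \<open>GSD\<close> can be any element of \<open>GS\<close>.\<close>
  have comm_M0: "comm x y \<in> M0" if "x \<in> GS" "y \<in> GSD" for x y
  proof -
    obtain d where d: "d \<in> GSD" "sec d 0 = x" using lift_sec_GSD[OF \<open>x \<in> GS\<close>] by blast
    have "comm d (embed 0 y) \<in> M" using d that by (intro comm_M embed_GSD)
    moreover have "comm d (embed 0 y) = embed 0 (comm x y)" using d by (simp add: comm_embed GSD_iff)
    ultimately show ?thesis using that GSD_subset by (auto simp: M0_def pull_def comm_in_GS)
  qed
  define b where "b = bpow 1"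
  define d where "d = - b + (- apow 1 + bpow 1 + apow 1)"
  have bG: "b \<in> GS" by (simp add: b_def bpow_in_GS)
  have d: "d \<in> GSD"
    by (auto simp: d_def b_def GSD_iff bet_add bet_uminus intro!: GS_closed bpow_in_GS apow_in_GS)
       (simp_all add: bet_add bet_uminus GS_closed bpow_in_GS apow_in_GS)
  \<comment> \<open>As \<open>b + d\<close> is the conjugate of \<open>b\<close> by
    \<open>a\<close>, this is [b, b^a].\<close>
  have "b + comm b d + - b \<in> M0" using comm_M0[OF bG d] by (rule normalGS_conj'[OF M0 bG])
  then have c: "comm (bpow 1) (- apow 1 + bpow 1 + apow 1) \<in> M0"
    by (simp add: comm_def d_def b_def aut_simps)
  \<comment> \<open>One letter 0 leads from \<open>M\<close> to \<open>M0\<close>, the other is the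
    level lost in \<open>branching\<close>.\<close>
  define q :: "3 list" where "q = v @ [0, 0]"
  have q: "embedw q x \<in> N" if "x \<in> GSD" for x
    using branching[OF M0 c that, of 0] that embedw_GSD[of x "[0]"] branching[OF M0 c, of x 0]
    by (simp add: q_def M0_def M_def pull_def embedw_append)
  have "embedw w x \<in> N" if w: "length w = length q" and x: "x \<in> GSD" for w x
  proof -
    obtain g where g: "g \<in> GS" "act q g = w" using act_transitive[OF w[symmetric]] by blast
    define k where "k = secw g q"
    have k: "k \<in> GS" unfolding k_def using g(1) by (rule secw_in_GS)
    have "k + x + - k \<in> GSD" using GSD_conj[OF x, of "- k"] k GS_closed by simp
    then have "- g + embedw q (k + x + - k) + g \<in> N" by (intro normalGS_conj[OF N g(1)] q)
    then have "embedw w (- k + (k + x + - k) + k) \<in> N"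
      by (simp only: conj_embedw g(2) k_def[symmetric])
    moreover have "- k + (k + x + - k) + k = x" by (simp add: aut_simps)
    ultimately show ?thesis by (simp only:)
  qed
  then show ?thesis unfolding deep_def by blast
qed

lemma normal_fi: "normalGS N \<Longrightarrow> N \<noteq> {0} \<Longrightarrow> fi N GS"
  using normal_deep deep_fi normalGS_subgp by blast

text \<open>The map \<open>h\<close> below records the action by right multiplication on the cosets of \<open>L\<close>; as \<open>GS\<close> is infinite, the
  normal core of \<open>L\<close> is not trivial.\<close>

lemma fi_deep:
  assumes L: "subgp L" "L \<subseteq> GS" and fi: "fi L GS" shows "\<exists>l. deep l L"
proof -
  obtain f :: "aut \<Rightarrow> aut" where f: "finite (f ` GS)"
    "\<And>x y. x \<in> GS \<Longrightarrow> y \<in> GS \<Longrightarrow> f x = f y \<Longrightarrow> x - y \<in> L"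
    using fiE[OF fi L(1)] by blast
  define h where "h x = {c. \<exists>g\<in>GS. \<exists>g'\<in>GS. g' - g \<in> L \<and> c = (f g, f (g' + x))}" for x
  have "h ` GS \<subseteq> Pow (f ` GS \<times> f ` GS)" by (auto simp: h_def GS_closed)
  then have "finite (h ` GS)" using f(1) by (meson finite_Pow_iff finite_SigmaI finite_subset)
  then obtain x y where xy: "x \<in> GS" "y \<in> GS" "x \<noteq> y" "h x = h y"
    using infinite_GS by (metis finite_imageD inj_onI)
  have key: "g + (x - y) - g \<in> L" if g: "g \<in> GS" for g
  proof -
    have "g - g \<in> L" using subgp_zero[OF L(1)] by simp
    then have "(f g, f (g + x)) \<in> h x" unfolding h_def using g by blast
    then have "(f g, f (g + x)) \<in> h y" by (simp only: xy(4))
    then obtain u u' where u: "u \<in> GS" "u' \<in> GS" "u' - u \<in> L" "f g = f u" "f (g + x) = f (u' + y)"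
      by (auto simp: h_def)
    have "g + x - (u' + y) \<in> L" "g - u \<in> L"
      by (intro f(2); use u xy g in \<open>auto intro: GS_closed\<close>)+
    then have "(g + x - (u' + y)) + ((u' - u) - (g - u)) \<in> L"
      using u(3) by (intro subgp_add[OF L(1)] subgp_diff[OF L(1), of "u' - u"])
    then show ?thesis by (simp add: aut_simps)
  qed
  define N where "N = {x \<in> GS. \<forall>g\<in>GS. g + x - g \<in> L}"
  have N: "normalGS N" unfolding normalGS_def
  proof (intro conjI ballI)
    show "subgp N"
    proof (rule subgpI)
      show "u + v \<in> N" if "u \<in> N" "v \<in> N" for u v
      proof -
        have "(g + u - g) + (g + v - g) \<in> L" if "g \<in> GS" for g
          using \<open>u \<in> N\<close> \<open>v \<in> N\<close> that by (intro subgp_add[OF L(1)]) (auto simp: N_def)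
        with that show ?thesis by (auto simp: N_def aut_simps GS_closed)
      qed
      show "- u \<in> N" if "u \<in> N" for u
      proof -
        have "- (g + u - g) \<in> L" if "g \<in> GS" for g
          using \<open>u \<in> N\<close> that by (intro subgp_uminus[OF L(1)]) (auto simp: N_def)
        with that show ?thesis by (auto simp: N_def aut_simps GS_closed)
      qed
    qed (auto simp: N_def GS_closed subgp_zero[OF L(1)])
    show "- g + x + g \<in> N" if "g \<in> GS" "x \<in> N" for g x
    proof -
      have "(k - g) + x - (k - g) \<in> L" if "k \<in> GS" for k
        using \<open>g \<in> GS\<close> \<open>x \<in> N\<close> that by (auto simp: N_def GS_closed)
      with that show ?thesis by (auto simp: N_def aut_simps GS_closed)
    qed
  qed (auto simp: N_def)
  have "x - y \<in> N" "x - y \<noteq> 0" using key xy by (auto simp: N_def GS_closed)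
  then obtain l where "deep l N" using normal_deep[OF N] by blast
  moreover have "N \<subseteq> L" using GS_closed(1) by (force simp: N_def)
  ultimately show ?thesis unfolding deep_def by blast
qed

text \<open>Copies of \<open>GSD\<close> at \<open>w\<close> lie in \<open>L\<close> and have every
  section at the child \<open>i\<close>, so the pullback to that child is normal in all of
  \<open>GS\<close>. Activity of \<open>g\<close> at or below the child makes it nontrivial: by a
  double commutator if the child is moved, by the trivial centralizer of \<open>GSD\<close>
  otherwise.\<close>

lemma active_fi:
  assumes L: "subgp L" "deep l L" and N: "subgp N" "N \<subseteq> GS"
    and nrm: "\<And>g x. g \<in> L \<Longrightarrow> x \<in> N \<Longrightarrow> - g + x + g \<in> N"
    and w: "length w = l" and g: "g \<in> N" "\<not> (fixv g (w @ [i]) \<and> secw g (w @ [i]) = 0)"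
  shows "fi (pull (w @ [i]) N) GS"
proof (rule normal_fi)
  define p where "p = w @ [i]"
  have dL: "embedw w x \<in> L" if "x \<in> GSD" for x using L(2) w that unfolding deep_def by blast
  have pL: "embedw p x \<in> L" if "x \<in> GSD" for x 
    using dL[of "embed i x"] that by (simp add: p_def embedw_append embed_GSD)
  have commN: "comm x y \<in> N" if "x \<in> N" "y \<in> L" for x y
    using nrm[of "- y" "- x"] subgp_add[OF N(1), of x "y + - x + - y"] that
    by (simp add: comm_def aut_simps subgp_closed[OF N(1)] subgp_closed[OF L(1)])
  show "normalGS (pull (w @ [i]) N)" unfolding normalGS_def
  proof (intro conjI ballI)
    fix h x assume h: "h \<in> GS" and x: "x \<in> pull (w @ [i]) N"
    obtain d where d: "d \<in> GSD" "sec d i = h" using lift_sec_GSD[OF h] by blast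
    have "- embedw w d + embedw p x + embedw w d \<in> N"
      using d x by (intro nrm dL) (auto simp: pull_def p_def)
    also have "- embedw w d + embedw p x + embedw w d = embedw w (- d + embed i x + d)"
      by (simp add: p_def embedw_append embedw_add embedw_uminus)
    also have "\<dots> = embedw p (- h + x + h)"
      using d by (simp add: p_def embedw_append conj_embed GSD_iff)
    finally show "- h + x + h \<in> pull (w @ [i]) N" using h x by (auto simp: pull_def p_def GS_closed)
  qed (auto simp: pull_def subgp_pull[OF N(1), unfolded pull_def])
  have "\<exists>z\<in>GS. z \<noteq> 0 \<and> embedw p z \<in> N"
  proof (cases "fixv g p")
    case True
    with g have "secw g p \<noteq> 0" by (auto simp: p_def)
    then obtain x where x: "x \<in> GSD" "comm (secw g p) x \<noteq> 0" using GSD_centralizer by blast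
    have "comm g (embedw p x) \<in> N" using x g by (intro commN pL)
    then have "embedw p (comm (secw g p) x) \<in> N" by (simp add: comm_embedw[OF True])
    moreover have "comm (secw g p) x \<in> GS"
      using x g N(2) GSD_subset by (intro comm_in_GS secw_in_GS) auto
    ultimately show ?thesis using x by blast
  next
    case False
    obtain x y where xy: "x \<in> GSD" "y \<in> GSD" "comm x y \<noteq> 0" using GSD_nonabelian by blast
    have "comm (comm g (embedw p (- x))) (embedw p y) \<in> N"
      using xy g by (intro commN pL) (auto intro: GSD_closed)
    then have "embedw p (comm x y) \<in> N" using comm_comm_embedw[OF False, of "- x" y] by simp
    moreover have "comm x y \<in> GS" using xy GSD_subset by (intro comm_in_GS) auto
    ultimately show ?thesis using xy by blast
  qed
  then show "pull (w @ [i]) N \<noteq> {0}" by (auto simp: pull_def p_def)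
qed

section \<open>Subgroups that are dense modulo the commutator subgroup\<close>

lemma finite3 [simp]: "finite (A :: 3 set)"
  by (rule finite_subset[of _ "{0, 1, 2}"]) (use letter_cases in auto)

text \<open>Only the joint kernel is controlled; the image of \<open>K\<close> in the product of the
  targets may have infinite index.\<close>

definition coords :: "aut set \<Rightarrow> (aut \<Rightarrow> aut) set \<Rightarrow> bool" where
  "coords K U \<longleftrightarrow> subgp K \<and> finite U \<and>
    (\<forall>f\<in>U. hom_on K f \<and> f ` K \<subseteq> GS \<and> fi (f ` K) GS) \<and> (\<forall>k\<in>K. (\<forall>f\<in>U. f k = 0) \<longrightarrow> k = 0)"

definition virt :: "aut set \<Rightarrow> bool" where
  "virt H \<longleftrightarrow> (\<exists>K U. K \<subseteq> H \<and> fi K H \<and> coords K U)"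

lemma virt_finite: "finite H \<Longrightarrow> subgp H \<Longrightarrow> virt H"
  unfolding virt_def coords_def
  by (intro exI[of _ "{0}"] exI[of _ "{}"]) (auto simp: subgp_closed intro!: subgpI fiI[of id])

lemma virt_GS: "virt GS"
  unfolding virt_def coords_def
  by (intro exI[of _ GS] exI[of _ "{id}"]) (auto simp: subgp_GS hom_on_def fi_refl)

lemma virt_upward: "virt M \<Longrightarrow> fi M H \<Longrightarrow> M \<subseteq> H \<Longrightarrow> subgp M \<Longrightarrow> subgp H \<Longrightarrow> virt H"
proof -
  assume *: "virt M" "fi M H" "M \<subseteq> H" "subgp M" "subgp H"
  then obtain K U where "K \<subseteq> M" "fi K M" "coords K U" by (auto simp: virt_def)
  moreover from this * have "fi K H" by (intro fi_trans[of K M H]) (auto simp: coords_def)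
  ultimately show ?thesis using * unfolding virt_def by blast
qed

lemma fi_Int2: "fi A H \<Longrightarrow> fi B H \<Longrightarrow> subgp A \<Longrightarrow> subgp B \<Longrightarrow> B \<subseteq> H \<Longrightarrow> subgp H \<Longrightarrow> fi (A \<inter> B) H"
  by (rule fi_trans[of _ B]) (auto intro: fi_Int subgp_Int)

text \<open>The homomorphisms for the images are composed with the \<open>\<phi> i\<close> on the
  intersection of the preimages; finite index survives both passages.\<close>

lemma virt_pullback:
  fixes \<phi> :: "3 \<Rightarrow> aut \<Rightarrow> aut"
  assumes H: "subgp H" and hom: "\<And>i. hom_on H (\<phi> i)" and virt: "\<And>i. virt (\<phi> i ` H)"
    and inj: "\<And>h. h \<in> H \<Longrightarrow> \<forall>i. \<phi> i h = 0 \<Longrightarrow> h = 0"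
  shows "virt H"
proof -
  from virt have "\<forall>i. \<exists>K U. K \<subseteq> \<phi> i ` H \<and> fi K (\<phi> i ` H) \<and> coords K U" by (simp add: virt_def)
  then obtain K U where K: "\<And>i. K i \<subseteq> \<phi> i ` H" "\<And>i. fi (K i) (\<phi> i ` H)" "\<And>i. coords (K i) (U i)"
    by metis
  have Ks: "subgp (K i)" for i using K(3)[of i] by (simp add: coords_def)
  define P where "P i = {h \<in> H. \<phi> i h \<in> K i}" for i
  have P: "subgp (P i)" "fi (P i) H" "P i \<subseteq> H" for i
    using subgp_vimage[OF hom H Ks] fi_vimage[OF K(2) Ks hom H] by (auto simp: P_def)
  define Q where "Q = P 0 \<inter> (P 1 \<inter> P 2)"
  have Q: "subgp Q" "fi Q H" "Q \<subseteq> H"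
    unfolding Q_def by (intro subgp_Int fi_Int2 P H le_infI1)+
  have QP: "\<phi> i h \<in> K i" if "h \<in> Q" for h i
    using that letter_cases[of i] by (auto simp: Q_def P_def)
  define V where "V = (\<Union>i. (\<lambda>f. f \<circ> \<phi> i) ` U i)"
  have "coords Q V" unfolding coords_def
  proof (intro conjI ballI impI)
    show "subgp Q" by fact
    show "finite V" using K(3) by (auto simp: V_def coords_def)
    show "k = 0" if k: "k \<in> Q" "\<forall>f\<in>V. f k = 0" for k
    proof (rule inj)
      show "\<forall>i. \<phi> i k = 0"
      proof
        show "\<phi> i k = 0" for i using k QP[OF k(1), of i] K(3)[of i] by (auto simp: V_def coords_def)
      qed
    qed (use k Q in auto)
  next
    fix g assume "g \<in> V"
    then obtain i f where g: "g = f \<circ> \<phi> i" "f \<in> U i" by (auto simp: V_def)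
    have f: "hom_on (K i) f" "f ` K i \<subseteq> GS" "fi (f ` K i) GS" using K(3)[of i] g(2) by (auto simp: coords_def)
    have q: "\<phi> i ` Q \<subseteq> K i" using QP by auto
    show "hom_on Q g" unfolding hom_on_def
      using Q(3) QP by (auto simp: g hom_onD[OF hom] hom_onD[OF f(1)] subset_iff)
    show "g ` Q \<subseteq> GS" using q f(2) by (auto simp: g)
    have sq: "subgp (\<phi> i ` Q)" using subgp_image[OF hom_on_subset[OF hom Q(3)] Q(1)] .
    have "fi (\<phi> i ` Q) (\<phi> i ` H)" by (rule fi_image[OF Q(2) hom H Q(3)])
    then have "fi (\<phi> i ` Q \<inter> K i) (K i)" by (rule fi_Int[OF _ sq K(1) Ks])
    then have "fi (\<phi> i ` Q) (K i)" by (rule fi_mono) auto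
    then have "fi (f ` \<phi> i ` Q) (f ` K i)" by (rule fi_image[OF _ f(1) Ks q])
    then have "fi (f ` \<phi> i ` Q) GS"
      by (rule fi_trans) 
         (use f subgp_image[OF hom_on_subset[OF f(1) q] sq] subgp_image[OF f(1) Ks] subgp_GS in auto)
    then show "fi (g ` Q) GS" by (simp add: g image_comp)
  qed
  with Q show ?thesis unfolding virt_def by blast
qed

lemma virt_conj:
  assumes "subgp H" "virt ((\<lambda>x. - g + x + g) ` H)" shows "virt H"
proof (rule virt_pullback[where \<phi> = "\<lambda>_ x. - g + x + g"])
  show "h = 0" if "\<forall>i::3. - g + h + g = 0" for h :: aut
    using arg_cong[OF that[rule_format], of "\<lambda>x. g + x - g"] by (simp add: aut_simps)
qed (use assms in \<open>auto simp: hom_on_def aut_simps\<close>)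

section \<open>Section groups\<close>

definition secs :: "3 \<Rightarrow> aut set \<Rightarrow> aut set" where
  "secs i H = (\<lambda>h. sec h i) ` {h \<in> H. rot h = 0}"

lemma hom_on_sec: "hom_on {h \<in> H. rot h = 0} (\<lambda>h. sec h i)"
  by (auto simp: hom_on_def)

lemma subgp_rot: "subgp H \<Longrightarrow> subgp {h \<in> H. rot h = 0}"
  by (rule subgpI) (auto intro: subgp_closed)

lemma subgp_secs: "subgp H \<Longrightarrow> subgp (secs i H)"
  unfolding secs_def by (intro subgp_image hom_on_sec subgp_rot)

lemma secs_subset: "H \<subseteq> GS \<Longrightarrow> secs i H \<subseteq> GS"
  by (auto simp: secs_def intro: sec_in_GS)

lemma virt_secs: assumes "subgp H" "\<And>i. virt (secs i H)" shows "virt H"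
proof (rule virt_upward)
  show "fi {h \<in> H. rot h = 0} H"
    by (rule fiI[of rot]) (auto intro: subgp_diff[OF assms(1)])
  show "virt {h \<in> H. rot h = 0}"
    by (rule virt_pullback[where \<phi> = "\<lambda>i h. sec h i"])
       (use assms in \<open>auto simp: secs_def hom_on_sec subgp_rot intro: aut_eqI\<close>)
qed (use assms subgp_rot in auto)

lemma secs_conj_subset:
  assumes "subgp H" "t \<in> H" shows "(\<lambda>x. - sec t i + x + sec t i) ` secs i H \<subseteq> secs (i + rot t) H"
proof
  fix y assume "y \<in> (\<lambda>x. - sec t i + x + sec t i) ` secs i H"
  then obtain h where h: "h \<in> H" "rot h = 0" "y = - sec t i + sec h i + sec t i" by (auto simp: secs_def)
  then have "- t + h + t \<in> H" using assms by (auto intro: subgp_closed)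
  then show "y \<in> secs (i + rot t) H"
    unfolding secs_def by (intro image_eqI[where x = "- t + h + t"]) (use h in auto)
qed

lemma secs_conj:
  assumes "subgp H" "t \<in> H" shows "(\<lambda>x. - sec t i + x + sec t i) ` secs i H = secs (i + rot t) H"
proof (rule antisym[OF secs_conj_subset[OF assms]], rule subsetI)
  fix y assume y: "y \<in> secs (i + rot t) H"
  have "- sec (- t) (i + rot t) + y + sec (- t) (i + rot t) \<in> secs (i + rot t + rot (- t)) H"
    using secs_conj_subset[OF assms(1) subgp_uminus[OF assms], of "i + rot t"] y by blast
  then have "sec t i + y + - sec t i \<in> secs i H" by simp
  moreover have "y = - sec t i + (sec t i + y + - sec t i) + sec t i" by (simp add: aut_simps)
  ultimately show "y \<in> (\<lambda>x. - sec t i + x + sec t i) ` secs i H" by blast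
qed

lemma transitive3:
  assumes "subgp H" "t \<in> H" "rot t \<noteq> 0" shows "\<exists>s\<in>H. i + rot s = j"
proof -
  have "j = i + 0 \<or> j = i + rot t \<or> j = i + rot (t + t)"
    using letter_cases[of i] letter_cases[of j] letter_cases[of "rot t"] assms(3) by auto
  then show ?thesis
  proof (elim disjE)
    show ?thesis if "j = i + 0" using that subgp_zero[OF assms(1)] by (intro bexI[of _ 0]) auto
    show ?thesis if "j = i + rot t" using that assms(2) by blast
    show ?thesis if "j = i + rot (t + t)" using that subgp_add[OF assms(1,2,2)] by blast
  qed
qed

text \<open>Elements of \<open>H\<close> moving level 1 conjugate the three section groups into one
  another, so one of them suffices.\<close>

lemma virt_transitive:
  assumes "subgp H" "t \<in> H" "rot t \<noteq> 0" "virt (secs i H)" shows "virt H"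
proof (rule virt_secs[OF assms(1)])
  fix j
  obtain s where s: "s \<in> H" "j + rot s = i" using transitive3[OF assms(1-3)] by metis
  have "virt ((\<lambda>x. - sec s j + x + sec s j) ` secs j H)"
    using secs_conj[OF assms(1) s(1), of j] s(2) assms(4) by simp
  then show "virt (secs j H)" by (rule virt_conj[OF subgp_secs[OF assms(1)]])
qed

lemma secs_move:
  assumes "subgp H" "H \<subseteq> GS" "t \<in> H" "rot t \<noteq> 0" "x \<in> secs i H"
  shows "\<exists>k\<in>GS. - k + x + k \<in> secs j H"
proof -
  obtain s where s: "s \<in> H" "i + rot s = j" using transitive3[OF assms(1,3,4)] by metis
  have "- sec s i + x + sec s i \<in> secs j H"
    using secs_conj_subset[OF assms(1) s(1), of i] s(2) assms(5) by auto
  then show ?thesis using sec_in_GS s(1) assms(2) by blast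
qed

text \<open>A nonzero determinant in the coordinates (\<open>rot\<close>, \<open>bet\<close>): two
  elements form a basis of \<open>G/G'\<close>, the plane over the field with three
  elements.\<close>

definition dense :: "aut set \<Rightarrow> bool" where
  "dense H \<longleftrightarrow> (\<exists>x\<in>H. \<exists>y\<in>H. rot x * bet y \<noteq> rot y * bet x)"

lemma dense_transitive: "dense H \<Longrightarrow> \<exists>t\<in>H. rot t \<noteq> 0"
  unfolding dense_def by (metis mult_zero_left)

lemma bet_diff: "x \<in> GS \<Longrightarrow> y \<in> GS \<Longrightarrow> bet (x - y) = bet x - bet y"
  by (simp add: aut_simps bet_add bet_uminus GS_closed)

lemma independent_mod3:
  "a * d \<noteq> c * b \<Longrightarrow> (a = 0 \<and> b \<noteq> 0) \<or> (c = 0 \<and> d \<noteq> 0) \<or> (a + c = 0 \<and> b + d \<noteq> 0) \<or> (a - c = 0 \<and> b - d \<noteq> 0)"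
  for a b c d :: 3
  using letter_cases[of a] letter_cases[of b] letter_cases[of c] letter_cases[of d]
  by (elim disjE) simp_all

lemma dense_bet: assumes "subgp H" "H \<subseteq> GS" "dense H" shows "\<exists>y\<in>H. rot y = 0 \<and> bet y \<noteq> 0"
proof -
  obtain x y where xy: "x \<in> H" "y \<in> H" "rot x * bet y \<noteq> rot y * bet x" using assms(3) by (auto simp: dense_def)
  then have G: "x \<in> GS" "y \<in> GS" using assms(2) by auto
  have "(rot x = 0 \<and> bet x \<noteq> 0) \<or> (rot y = 0 \<and> bet y \<noteq> 0) \<or> (rot (x + y) = 0 \<and> bet (x + y) \<noteq> 0) \<or>
    (rot (x - y) = 0 \<and> bet (x - y) \<noteq> 0)"
    unfolding rot_diff plus_aut.sel bet_add[OF G] bet_diff[OF G] by (rule independent_mod3[OF xy(3)])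
  then show ?thesis using xy(1,2) subgp_add[OF assms(1)] subgp_diff[OF assms(1)] by blast
qed

text \<open>By \<open>GS_rot_sec_bet\<close> the classes of the sections of \<open>h\<close> are (e2
  - e1, e0), (e0 - e2, e1), (e1 - e0, e2). They lie on one line only if all \<open>e\<close> agree,
  which a rotating section excludes. Conjugation into \<open>secs j H\<close> preserves
  classes.\<close>

lemma dense_secsI:
  assumes H: "subgp H" "H \<subseteq> GS" and t: "t \<in> H" "rot t \<noteq> 0"
    and h: "h \<in> H" "rot h = 0" "rot (sec h i) \<noteq> 0"
  shows "dense (secs j H)"
proof -
  have hG: "h \<in> GS" using h H by auto
  have *: "\<exists>z\<in>secs j H. rot z = rot (sec h q) \<and> bet z = bet (sec h q)" for q
  proof -
    have "sec h q \<in> secs q H" using h by (auto simp: secs_def)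
    then obtain k where k: "k \<in> GS" "- k + sec h q + k \<in> secs j H" using secs_move[OF H t] by blast
    have "sec h q \<in> GS" using hG sec_in_GS by blast
    then have "rot (- k + sec h q + k) = rot (sec h q)" "bet (- k + sec h q + k) = bet (sec h q)"
      using k(1) by (simp_all add: bet_add bet_uminus GS_closed)
    then show ?thesis using k(2) by blast
  qed
  define e where "e q = bet (sec h q)" for q
  have r: "rot (sec h 0) = e 2 - e 1" "rot (sec h 1) = e 0 - e 2" "rot (sec h 2) = e 1 - e 0"
    using GS_rot_sec_bet[OF hG, of 0] GS_rot_sec_bet[OF hG, of 1] GS_rot_sec_bet[OF hG, of 2]
    by (simp_all add: e_def)
  have "\<not> (e 0 = e 1 \<and> e 1 = e 2)" using h(3) letter_cases[of i] r by auto
  then have "rot (sec h 0) * e 1 \<noteq> rot (sec h 1) * e 0 \<or> rot (sec h 0) * e 2 \<noteq> rot (sec h 2) * e 0 \<or>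
      rot (sec h 1) * e 2 \<noteq> rot (sec h 2) * e 1"
    unfolding r using letter_cases[of "e 0"] letter_cases[of "e 1"] letter_cases[of "e 2"] by auto
  then obtain p q where "rot (sec h p) * bet (sec h q) \<noteq> rot (sec h q) * bet (sec h p)"
    unfolding e_def by blast
  then show ?thesis using *[of p] *[of q] unfolding dense_def by metis
qed

lemma dense_secs: assumes "subgp H" "H \<subseteq> GS" "dense H" shows "dense (secs j H)"
proof -
  obtain t where t: "t \<in> H" "rot t \<noteq> 0" using dense_transitive[OF assms(3)] by blast
  obtain y where y: "y \<in> H" "rot y = 0" "bet y \<noteq> 0" using dense_bet[OF assms] by blast
  then have yG: "y \<in> GS" using assms(2) by auto
  have "\<exists>i. rot (sec y i) \<noteq> 0"
    using y(3) unfolding bet_def by (metis diff_self)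
  then show ?thesis using dense_secsI[OF assms(1,2) t y(1,2)] by blast
qed

lemma conj_pow:
  assumes "subgp K" "j \<noteq> 0"
  shows "- k + apow j + k \<in> K \<Longrightarrow> - k + apow i + k \<in> K" and "- k + bpow j + k \<in> K \<Longrightarrow> - k + bpow i + k \<in> K"
proof -
  have "subgp {x \<in> UNIV. - k + x + k \<in> K}"
    by (rule subgp_vimage[OF _ _ assms(1)]) (auto simp: hom_on_def aut_simps intro: subgpI)
  from pow_subgp_nonzero[OF this assms(2), of i]
  show "- k + apow j + k \<in> K \<Longrightarrow> - k + apow i + k \<in> K" and "- k + bpow j + k \<in> K \<Longrightarrow> - k + bpow i + k \<in> K"
    by auto
qed

lemma virt_pair_conj:
  assumes IH: "\<And>K l. subgp K \<Longrightarrow> K \<subseteq> GS \<Longrightarrow> l \<in> Len m \<Longrightarrow> apow 1 \<in> K \<Longrightarrow> - l + bpow 1 + l \<in> K \<Longrightarrow> virt K"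
    and K: "subgp K" "K \<subseteq> GS" and p: "p \<in> GS" "- p + apow 1 + p \<in> K"
    and q: "- q + bpow 1 + q \<in> K" "q - p \<in> Len m"
  shows "virt K"
proof (rule virt_conj[OF K(1), of "- p"], rule IH)
  let ?c = "\<lambda>x. - (- p) + x + - p"
  show "subgp (?c ` K)" by (rule subgp_image[OF _ K(1)]) (auto simp: hom_on_def aut_simps)
  show "?c ` K \<subseteq> GS" using K(2) p(1) by (auto intro!: GS_closed)
  show "q - p \<in> Len m" by fact
  show "apow 1 \<in> ?c ` K" by (rule image_eqI[OF _ p(2)]) (simp add: aut_simps)
  show "- (q - p) + bpow 1 + (q - p) \<in> ?c ` K" by (rule image_eqI[OF _ q(1)]) (simp add: aut_simps)
qed

lemma Len_diff: "x \<in> Len m \<Longrightarrow> y \<in> Len n \<Longrightarrow> x - y \<in> Len (m + n)"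
  by (simp add: diff_conv_add_uminus Len_add Len_uminus)

lemma Len1_rot_zero:
  assumes "x \<in> Len 1" "rot x = 0"
  obtains i j where "x = apow i + bpow j + apow (- i)"
proof -
  from assms(1) obtain i j k where x: "x = apow i + (bpow j + apow k)" by auto
  with assms(2) have "k = - i" by (simp add: eq_neg_iff_add_eq_0 add.commute)
  with x that show ?thesis by (simp add: add.assoc)
qed

text \<open>The sections of \<open>l\<^sup>-\<^sup>1 b l\<close> for \<open>l = (l\<^sub>0, l\<^sub>1, l\<^sub>2)\<close> are conjugates of \<open>a, a\<^sup>-\<^sup>1, b\<close>; pairing that of \<open>b\<close> with the
  shorter of \<open>l\<^sub>0, l\<^sub>1\<close> gives a shorter conjugator.\<close>

lemma virt_apow_conj_bpow:
  "subgp K \<Longrightarrow> K \<subseteq> GS \<Longrightarrow> l \<in> Len n \<Longrightarrow> apow 1 \<in> K \<Longrightarrow> - l + bpow 1 + l \<in> K \<Longrightarrow> virt K"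
proof (induction n arbitrary: K l rule: less_induct)
  case (less n)
  note K = less.prems(1,2) and a = less.prems(4)
  \<comment> \<open>As \<open>a\<close> lies in \<open>K\<close>, the conjugator matters only up to
    a power of \<open>a\<close> on the right, so it may be taken to fix level 1.\<close>
  define l' where "l' = l + apow (- rot l)"
  have l': "l' \<in> Len n" "rot l' = 0" using less.prems(3) by (auto simp: l'_def intro: Len_apow)
  have "apow (- rot l) \<in> K" by (rule pow_subgp(1)[OF K(1) a])
  then have "- apow (- rot l) + (- l + bpow 1 + l) + apow (- rot l) \<in> K"
    by (intro subgp_add[OF K(1) subgp_add[OF K(1) _ less.prems(5)]] subgp_uminus[OF K(1)])
  then have B: "- l' + bpow 1 + l' \<in> K" by (simp add: l'_def aut_simps)
  have full: "virt K" if "bpow 1 \<in> K"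
  proof -
    have "K = GS" using GS_subset[OF K(1) a that] K(2) by auto
    then show ?thesis by (simp add: virt_GS)
  qed
  define K0 where "K0 = secs 0 K"
  have K0: "subgp K0" "K0 \<subseteq> GS" unfolding K0_def using K by (auto intro: subgp_secs dest: secs_subset)
  \<comment> \<open>Conjugating by powers of \<open>a\<close> brings the sections at all three
    vertices into the same section group.\<close>
  have sec: "- sec l' q + sec (bpow 1) q + sec l' q \<in> K0" for q
  proof -
    have "apow (- q) \<in> K" by (rule pow_subgp(1)[OF K(1) a])
    then have "- apow (- q) + (- l' + bpow 1 + l') + apow (- q) \<in> K"
      by (intro subgp_add[OF K(1) subgp_add[OF K(1) _ B]] subgp_uminus[OF K(1)])
    moreover have "sec (- apow (- q) + (- l' + bpow 1 + l') + apow (- q)) 0 = - sec l' q + sec (bpow 1) q + sec l' q"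
      using l'(2) by simp
    ultimately show ?thesis unfolding K0_def secs_def using l'(2) by force
  qed
  have up: "virt K" if "virt K0" using virt_transitive[OF K(1) a, of 0] that by (simp add: K0_def)
  have G: "sec l' q \<in> GS" for q using l'(1) Len_subset_GS sec_in_GS by blast
  have A: "- sec l' 0 + apow 1 + sec l' 0 \<in> K0" "- sec l' 1 + apow 1 + sec l' 1 \<in> K0" "- sec l' 2 + bpow 1 + sec l' 2 \<in> K0"
    using sec[of 0] sec[of 2] sec[of 1] conj_pow(1)[OF K0(1), of 2 "sec l' 1" 1] by auto
  have step: "virt K" if "sec l' 2 - sec l' p \<in> Len m" "m < n" "p = 0 \<or> p = 1" for p m
  proof (rule up, rule virt_pair_conj[OF less.IH[OF that(2)] K0 G[of p] _ A(3) that(1)])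
    show "- sec l' p + apow 1 + sec l' p \<in> K0" using that(3) A by auto
  qed
  obtain k where k: "k 0 + k 1 + k (2::3) \<le> n" "\<And>i. sec l' i \<in> Len (k i)" using sec_Len_total[OF l'(1)] by blast
  consider "n = 0" | "n = 1" | "n \<ge> 2" by linarith
  then show ?case
  proof cases
    case 1
    with l' have "l' = 0" by auto
    with B show ?thesis by (intro full) simp
  next
    case 2
    then obtain i j where l: "l' = apow i + bpow j + apow (- i)" using Len1_rot_zero l' by metis
    \<comment> \<open>For \<open>i = 0\<close> the conjugator is a power of \<open>b\<close> and
      disappears. For other \<open>i\<close> the two sections compared below are powers of
      \<open>a\<close>, so the new conjugator has length 0.\<close>
    have cm: "- bpow j + bpow 1 + bpow j = bpow 1"
    proof -
      have "bpow 1 + bpow j = bpow j + bpow 1" by (simp only: add.commute[of 1 j] flip: bpow_add)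
      then show ?thesis by (simp add: aut_simps)
    qed
    show ?thesis
    proof (cases "i = 0")
      case True
      with B l cm show ?thesis by (intro full) simp
    next
      case False
      then consider "i = 1" | "i = 2" using letter_cases[of i] by auto
      then show ?thesis
      proof cases
        case 1
        have "sec l' 2 - sec l' 0 \<in> Len (0 + 0)" by (rule Len_diff) (use 1 in \<open>simp_all add: l\<close>)
        then show ?thesis by (intro step) (use \<open>n = 1\<close> in auto)
      next
        case 2
        have "sec l' 2 - sec l' 1 \<in> Len (0 + 0)" by (rule Len_diff) (use 2 in \<open>simp_all add: l\<close>)
        then show ?thesis by (intro step) (use \<open>n = 1\<close> in auto)
      qed
    qed
  next
    case 3
    define p :: 3 where "p = (if k 0 \<le> k 1 then 0 else 1)"
    have p: "p = 0 \<or> p = 1" by (simp add: p_def)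
    show ?thesis
    proof (cases "k 2 + k p < n")
      case True
      then show ?thesis using step[OF Len_diff[OF k(2) k(2)] True p] by simp
    next
      case False
      \<comment> \<open>If the two lengths already exhaust \<open>n\<close>, the third one, which is
        at least \<open>k p\<close>, is 0. Then only \<open>sec l' 2\<close> remains, and the
        halving bound is strict for \<open>n >= 2\<close>.\<close>
      then have "k p = 0" using k(1) by (auto simp: p_def split: if_splits)
      moreover have "sec l' 2 - sec l' p \<in> Len ((n + 1) div 2 + k p)"
        by (intro Len_diff k(2) sec_Len_half l')
      ultimately show ?thesis using step[of p "(n + 1) div 2"] 3 p by simp
    qed
  qed
qed

lemma virt_conj_pair:
  assumes "subgp K" "K \<subseteq> GS" "p \<in> GS" "q \<in> GS" "- p + apow 1 + p \<in> K" "- q + bpow 1 + q \<in> K"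
  shows "virt K"
proof -
  obtain m where "q - p \<in> Len m" using GS_Len[OF GS_closed(4)[OF assms(4,3)]] by blast
  show ?thesis by (rule virt_pair_conj[OF virt_apow_conj_bpow assms(1-3,5,6) \<open>q - p \<in> Len m\<close>])
qed

text \<open>The sections of a conjugate of \<open>b^j\<close> by a power of \<open>a\<close> include
  \<open>b^j\<close> and \<open>a^j\<close>; transitivity moves the latter, up to conjugation, into
  the section group containing the former.\<close>

lemma virt_dense_bpow:
  assumes H: "subgp H" "H \<subseteq> GS" "dense H" and y: "apow i + bpow j + apow (- i) \<in> H" "j \<noteq> 0"
  shows "virt H"
proof -
  obtain t where t: "t \<in> H" "rot t \<noteq> 0" using dense_transitive[OF H(3)] by blast
  have sec: "sec (bpow j) (q + i) \<in> secs q H" for q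
    unfolding secs_def by (rule image_eqI[where x = "apow i + bpow j + apow (- i)"]) (use y(1) in auto)
  define x where "x = 2 - i"
  have b: "- 0 + bpow j + 0 \<in> secs x H" using sec[of x] by (simp add: x_def)
  have "apow j \<in> secs (- i) H" using sec[of "- i"] by simp
  then obtain k where k: "k \<in> GS" "- k + apow j + k \<in> secs x H" using secs_move[OF H(1,2) t] by blast
  have "virt (secs x H)"
    by (rule virt_conj_pair[OF subgp_secs[OF H(1)] secs_subset[OF H(2)] k(1) GS_closed(1)
          conj_pow(1)[OF subgp_secs[OF H(1)] y(2) k(2)] conj_pow(2)[OF subgp_secs[OF H(1)] y(2) b]])
  then show ?thesis by (rule virt_transitive[OF H(1) t])
qed

text \<open>The section of the cube is the product of all three sections of \<open>z\<close>, along
  the orbit of 0. Hence rotations cancel, exponents of \<open>b\<close> add up to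
  \<open>bet z\<close>, and the length is bounded by the total.\<close>

lemma sec_cube:
  assumes "z \<in> GS" "rot z \<noteq> 0"
  shows "rot (sec (z + z + z) 0) = 0" "bet (sec (z + z + z) 0) = bet z" "rot (z + z + z) = 0"
    and "z \<in> Len n \<Longrightarrow> sec (z + z + z) 0 \<in> Len n"
proof -
  have G: "sec z i \<in> GS" for i using assms(1) sec_in_GS by blast
  have r: "rot z = 1 \<or> rot z = 2" using assms(2) letter_cases by metis
  then show "rot (z + z + z) = 0" by auto
  have s: "sec (z + z + z) 0 = sec z 0 + sec z (rot z) + sec z (rot z + rot z)" by simp
  show "rot (sec (z + z + z) 0) = 0"
    using r GS_rot_sec_sum[OF assms(1), of 0] unfolding s by (auto simp: algebra_simps)
  show "bet (sec (z + z + z) 0) = bet z"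
    using r bet_sum[OF assms(1)] unfolding s by (auto simp: bet_add G GS_closed algebra_simps)
  assume "z \<in> Len n"
  then obtain k where k: "k 0 + k 1 + k (2::3) \<le> n" "\<And>i. sec z i \<in> Len (k i)" using sec_Len_total by blast
  have "sec (z + z + z) 0 \<in> Len (k 0 + k (rot z) + k (rot z + rot z))"
    unfolding s by (intro Len_add k(2))
  moreover have "k 0 + k (rot z) + k (rot z + rot z) \<le> n" using r k(1) by auto
  ultimately show "sec (z + z + z) 0 \<in> Len n" using Len_mono by blast
qed

text \<open>A section outside \<open>\<langle>a\<rangle>G'\<close> that is not in \<open>St(1)\<close> is replaced by a section of its cube, which is no longer than it.\<close>

lemma virt_dense_bet:
  "subgp H \<Longrightarrow> H \<subseteq> GS \<Longrightarrow> dense H \<Longrightarrow> y \<in> H \<Longrightarrow> y \<in> Len n \<Longrightarrow> rot y = 0 \<Longrightarrow> bet y \<noteq> 0 \<Longrightarrow> virt H"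
proof (induction n arbitrary: H y rule: less_induct)
  case (less n)
  note H = less.prems(1-3) and y = less.prems(4-7)
  obtain t where t: "t \<in> H" "rot t \<noteq> 0" using dense_transitive[OF H(3)] by blast
  show ?case
  proof (cases "n \<le> 1")
    case True
    then have "y \<in> Len 1" using y(2) Len_mono by blast
    then obtain i j where ij: "y = apow i + bpow j + apow (- i)" using Len1_rot_zero y(3) by metis
    with y(4) have "j \<noteq> 0" by (auto simp: apow_uminus)
    with virt_dense_bpow[OF H] y(1) ij show ?thesis by blast
  next
    case False
    have yG: "y \<in> GS" using y H by auto
    obtain i where i: "bet (sec y i) \<noteq> 0" using bet_sum[OF yG] y(4) by (metis add_0)
    define z where "z = sec y i"
    define H1 where "H1 = secs i H"
    have z: "z \<in> H1" "z \<in> Len ((n + 1) div 2)" "z \<in> GS" "bet z \<noteq> 0"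
      using y i sec_Len_half sec_in_GS[OF yG] by (auto simp: z_def H1_def secs_def)
    have H1: "subgp H1" "H1 \<subseteq> GS" "dense H1"
      using H subgp_secs secs_subset dense_secs by (auto simp: H1_def)
    have lt: "(n + 1) div 2 < n" using False by simp
    have "virt H1"
    proof (cases "rot z = 0")
      case True
      then show ?thesis using less.IH[OF lt H1 z(1,2)] z(4) by blast
    next
      case rz: False
      have "z + z + z \<in> H1" using z(1) H1(1) by (intro subgp_add)
      then have "sec (z + z + z) 0 \<in> secs 0 H1" using sec_cube(3)[OF z(3) rz] unfolding secs_def by blast
      then have "virt (secs 0 H1)"
        using less.IH[OF lt subgp_secs[OF H1(1)] secs_subset[OF H1(2)] dense_secs[OF H1]]
          sec_cube(1,2)[OF z(3) rz] sec_cube(4)[OF z(3) rz z(2)] z(4) by metis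
      then show ?thesis using virt_transitive[OF H1(1) z(1) rz] by blast
    qed
    then show ?thesis unfolding H1_def by (rule virt_transitive[OF H(1) t])
  qed
qed

lemma virt_dense: assumes "subgp H" "H \<subseteq> GS" "dense H" shows "virt H"
proof -
  obtain y where y: "y \<in> H" "rot y = 0" "bet y \<noteq> 0" using dense_bet[OF assms] by blast
  obtain n where "y \<in> Len n" using GS_Len y(1) assms(2) by blast
  with virt_dense_bet[OF assms y(1) _ y(2,3)] show ?thesis by blast
qed

section \<open>Finitely generated subgroups\<close>

lemma secs_gen:
  assumes "\<And>s. s \<in> S \<Longrightarrow> rot s = 0"
  shows "secs i (gen S) = gen ((\<lambda>s. sec s i) ` S)"
proof -
  have "gen S \<subseteq> {x \<in> UNIV. rot x = 0}" by (rule gen_least[OF subgp_rot]) (use assms in \<open>auto intro: subgpI\<close>)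
  then have *: "{h \<in> gen S. rot h = 0} = gen S" by auto
  have "hom_on (gen S) (\<lambda>h. sec h i)" using hom_on_sec[of "gen S" i] unfolding * .
  then show ?thesis unfolding secs_def * by (rule gen_image)
qed

lemma virt_gen_stab:
  assumes "\<And>s. s \<in> S \<Longrightarrow> rot s = 0" "\<And>i. virt (gen ((\<lambda>s. sec s i) ` S))"
  shows "virt (gen S)"
  by (rule virt_secs[OF subgp_gen]) (use assms secs_gen in metis)

lemma subgp_range_pow: "subgp (range apow)" "subgp (range bpow)"
proof -
  show "subgp (range apow)"
    by (rule subgpI) (auto simp flip: apow_add apow_uminus intro: range_eqI[of _ _ 0])
  show "subgp (range bpow)"
    by (rule subgpI) (auto simp flip: bpow_add bpow_uminus intro: range_eqI[of _ _ 0])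
qed

text \<open>If nontrivial powers of both generators occur, the group is \<open>GS\<close>; otherwise
  it is finite.\<close>

lemma virt_gen_pow:
  assumes "Q \<subseteq> range apow \<union> range bpow" shows "virt (gen Q)"
proof -
  have fin: "virt (gen Q)" if "Q \<subseteq> R" "subgp R" "finite R" for R
    using gen_least[OF that(2,1)] that(3) by (intro virt_finite subgp_gen) (auto dest: finite_subset)
  consider "Q \<subseteq> range apow" | "Q \<subseteq> range bpow" | "\<not> Q \<subseteq> range apow" "\<not> Q \<subseteq> range bpow" by blast
  then show ?thesis
  proof cases
    case 3
    then obtain x y where xy: "x \<in> Q" "x \<notin> range apow" "y \<in> Q" "y \<notin> range bpow" by blast
    then obtain i j where ij: "y = apow i" "x = bpow j" using assms by blast
    then have "i \<noteq> 0" "j \<noteq> 0" using xy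
      by (metis bpow_zero apow_zero rangeI)+
    then have "GS \<subseteq> gen Q"
      using xy ij by (intro GS_subset[OF subgp_gen, of i _ j]) (auto intro: gen_base)
    moreover have "gen Q \<subseteq> GS"
      using assms apow_in_GS bpow_in_GS by (intro gen_least[OF subgp_GS]) auto
    ultimately show ?thesis using virt_GS by simp
  qed (use fin subgp_range_pow in auto)
qed

lemma virt_gen_Len1:
  assumes "S \<subseteq> Len 1" "\<And>s. s \<in> S \<Longrightarrow> rot s = 0" shows "virt (gen S)"
proof (rule virt_gen_stab[OF assms(2)])
  fix q
  have "sec s q \<in> range apow \<union> range bpow" if "s \<in> S" for s
  proof -
    have "s \<in> Len 1" "rot s = 0" using that assms by auto
    then obtain i j where "s = apow i + bpow j + apow (- i)" by (rule Len1_rot_zero)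
    then show ?thesis by auto
  qed
  then show "virt (gen ((\<lambda>s. sec s q) ` S))" by (intro virt_gen_pow) auto
qed

text \<open>With distinct syllable positions, the rotation patterns (j, -j, 0) and a nontrivial
  shift of (l, -l, 0) cancel only if both vanish; with equal positions the syllables merge. Needed
  where Schreier generators of length 2 would not shrink.\<close>

lemma Len2_stab2:
  assumes "x \<in> Len 2" "rot x = 0" "\<And>v. rot (sec x v) = 0" shows "x = 0"
proof -
  from assms(1) obtain i j k l m where x0: "x = apow i + (bpow j + apow k) + (bpow l + apow m)"
    by (auto simp: eval_nat_numeral)
  have "(i + k) + m = 0" using assms(2) unfolding x0 by (simp add: add.assoc)
  then have "m = - (i + k)" by (rule minus_unique[symmetric])
  then have x: "x = apow i + (bpow j + apow k) + (bpow l + apow (- (i + k)))" using x0 by simp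
  show ?thesis
  proof (cases "k = 0")
    case True
    have "rot (sec x (- i)) = j + l" unfolding x True by simp
    then have "j + l = 0" using assms(3) by simp
    then have "bpow j + bpow l = 0" by (simp flip: bpow_add)
    then have "apow i + ((bpow j + bpow l) + - apow i) = 0" by simp
    then show ?thesis unfolding x True by (simp add: aut_simps apow_uminus)
  next
    case False
    have s: "rot (sec x (- i)) = j + rot (sec (bpow l) k)" "rot (sec x (1 - i)) = - j + rot (sec (bpow l) (1 + k))"
      "rot (sec x (2 - i)) = rot (sec (bpow j) 2) + rot (sec (bpow l) (2 + k))"
      unfolding x by simp_all
    have "j = 0 \<and> l = 0"
      using False s letter_cases[of k] unfolding assms(3) by auto
    then show ?thesis unfolding x by (simp flip: apow_add)
  qed
qed

text \<open>Schreier's lemma for the stabilizer of \<open>i\<close>, with transversal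
  \<open>t\<close>, followed by taking sections; along a product the transversal terms
  telescope.\<close>

lemma secs_schreier:
  assumes t: "\<And>j. t j \<in> gen S" "\<And>j. i + rot (t j) = j" "t i = 0"
  shows "secs i (gen S) = gen {sec (t j) i + sec s j - sec (t (j + rot s)) i | j s. s \<in> S}"
    (is "_ = gen ?E")
proof
  have rt: "rot (t j) = j - i" for j using t(2)[of j] by (simp add: eq_diff_eq add.commute)
  have shape: "rot (t j + h - t (j + rot h)) = 0 \<and>
      sec (t j + h - t (j + rot h)) i = sec (t j) i + sec h j - sec (t (j + rot h)) i" for j h
    by (simp add: rt)
  show "gen ?E \<subseteq> secs i (gen S)"
  proof (rule gen_least[OF subgp_secs[OF subgp_gen]], clarify)
    fix j s assume "s \<in> S"
    then have "t j + s - t (j + rot s) \<in> gen S"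
      by (intro subgp_diff[OF subgp_gen] subgp_add[OF subgp_gen] t gen_base)
    then show "sec (t j) i + sec s j - sec (t (j + rot s)) i \<in> secs i (gen S)"
      unfolding secs_def using shape[of j s]
      by (intro image_eqI[where x = "t j + s - t (j + rot s)"]) auto
  qed
  have *: "sec (t j) i + sec h j - sec (t (j + rot h)) i \<in> gen ?E" if "h \<in> gen S" for h j
    using that
  proof (induction arbitrary: j)
    case (gen_base x)
    then show ?case by (intro gen.gen_base) blast
  next
    case gen_zero
    then show ?case by (simp add: gen.gen_zero)
  next
    case (gen_add x y)
    have "(sec (t j) i + sec x j - sec (t (j + rot x)) i) +
        (sec (t (j + rot x)) i + sec y (j + rot x) - sec (t (j + rot x + rot y)) i) \<in> gen ?E"
      by (intro gen.gen_add gen_add.IH)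
    then show ?case by (simp add: aut_simps add.assoc)
  next
    case (gen_uminus x)
    have "- (sec (t (j - rot x)) i + sec x (j - rot x) - sec (t (j - rot x + rot x)) i) \<in> gen ?E"
      by (intro gen.gen_uminus gen_uminus.IH)
    then show ?case by (simp add: aut_simps)
  qed
  show "secs i (gen S) \<subseteq> gen ?E"
  proof
    fix y assume "y \<in> secs i (gen S)"
    then obtain h where h: "h \<in> gen S" "rot h = 0" "y = sec h i" by (auto simp: secs_def)
    with *[of h i] show "y \<in> gen ?E" by (simp add: t(3))
  qed
qed

text \<open>The base point \<open>i\<close> is chosen so that the transversal avoids the longest section of \<open>h\<close>.\<close>

lemma virt_gen:
  "S \<subseteq> Len m \<Longrightarrow> virt (gen S)"
proof (induction m arbitrary: S rule: less_induct)
  case (less m)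
  define H where "H = gen S"
  have H: "subgp H" "H \<subseteq> GS"
    unfolding H_def using less.prems Len_subset_GS by (intro subgp_gen gen_least[OF subgp_GS]; blast)+
  show ?case
  proof (cases "\<forall>s\<in>S. rot s = 0")
    case True
    show ?thesis
    proof (cases "m \<le> 1")
      case 1: True
      then have "S \<subseteq> Len 1" using less.prems Len_mono by blast
      then show ?thesis using virt_gen_Len1 True by blast
    next
      case False
      show ?thesis
      proof (rule virt_gen_stab)
        fix i
        have "(\<lambda>s. sec s i) ` S \<subseteq> Len ((m + 1) div 2)" using less.prems sec_Len_half by blast
        then show "virt (gen ((\<lambda>s. sec s i) ` S))" by (rule less.IH[rotated]) (use False in simp)
      qed (use True in auto)
    qed
  next
    case False
    then obtain h where h: "h \<in> S" "rot h \<noteq> 0" by blast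
    have hH: "h \<in> H" using h(1) by (auto simp: H_def intro: gen_base)
    show ?thesis
    proof (cases "\<exists>x\<in>H. rot x = 0 \<and> (\<exists>i. rot (sec x i) \<noteq> 0)")
      case True
      then obtain x i where x: "x \<in> H" "rot x = 0" "rot (sec x i) \<noteq> 0" by blast
      have "virt (secs 0 H)"
        using dense_secsI[OF H hH h(2) x] by (intro virt_dense subgp_secs secs_subset H)
      then show ?thesis unfolding H_def[symmetric] by (rule virt_transitive[OF H(1) hH h(2)])
    next
      case st: False
      obtain k where k: "k 0 + k 1 + k (2::3) \<le> m" "\<And>i. sec h i \<in> Len (k i)"
        using sec_Len_total less.prems h(1) by blast
      define r where "r = rot h"
      obtain i where i: "k i \<le> k (i + r)" "k (i - r) \<le> k (i + r)"
      proof -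
        obtain c where c: "\<And>j. k j \<le> k c"
        proof -
          have "\<exists>c. k 0 \<le> k c \<and> k 1 \<le> k c \<and> k 2 \<le> k c"
            unfolding ex3 by linarith
          then show thesis using that letter_cases by metis
        qed
        then show thesis using that[of "c - r"] by simp
      qed
      have sum: "k i + k (i - r) + k (i + r) \<le> m"
        using k(1) h(2) letter_cases[of i] letter_cases[of r] unfolding r_def[symmetric] by auto
      define t where "t j = (if j = i then 0 else if j = i + r then h else - h)" for j
      define p where "p j = sec (t j) i" for j
      \<comment> \<open>Bounds for the sections of the transversal at \<open>i\<close>: that of
        \<open>- h\<close> is the inverse of the section of \<open>h\<close> at
        \<open>i - r\<close>. The longest one, at \<open>i + r\<close>, never enters.\<close>
      define ql where "ql j = (if j = i then 0 else if j = i + r then k i else k (i - r))" for j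
      have t: "t j \<in> gen S" "i + rot (t j) = j" "t i = 0" for j
      proof -
        show "t j \<in> gen S" using hH subgp_closed[OF H(1)] unfolding H_def t_def by auto
        have "j = i \<or> j = i + r \<or> j = i - r"
          using h(2) letter_cases[of i] letter_cases[of r] letter_cases[of j] unfolding r_def[symmetric] by auto
        then show "i + rot (t j) = j" by (auto simp: t_def r_def)
        show "t i = 0" by (simp add: t_def)
      qed
      have p: "p j \<in> Len (ql j)" for j
        using k(2)[of i] k(2)[of "i - r"]
        by (auto simp: p_def t_def ql_def r_def zero_in_Len intro: Len_uminus)
      define E where "E = {p j + sec s j - p (j + rot s) | j s. s \<in> S}"
      have secs: "secs i H = gen E" unfolding H_def E_def p_def by (rule secs_schreier[OF t])
      have rE: "rot e = 0" if "e \<in> E" for e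
      proof -
        have "e \<in> secs i H" using that secs by (auto intro: gen_base)
        then show ?thesis using st by (auto simp: secs_def)
      qed
      have "virt (gen E)"
      proof (cases "m \<le> 1")
        case True
        then have "k i = 0" "k (i - r) = 0" using i sum by auto
        then have "ql j = 0" for j by (simp add: ql_def)
        with p have p0: "p j \<in> Len 0" for j by metis
        have "E \<subseteq> Len 1"
        proof
          fix e assume "e \<in> E"
          then obtain j s where e: "e = p j + sec s j - p (j + rot s)" "s \<in> S" by (auto simp: E_def)
          have "sec s j \<in> Len ((m + 1) div 2)" using e(2) less.prems sec_Len_half by blast
          moreover have "(m + 1) div 2 \<le> 1" using True by simp
          ultimately have "sec s j \<in> Len 1" using Len_mono by blast
          then have "p j + sec s j - p (j + rot s) \<in> Len (0 + 1 + 0)" by (intro Len_diff Len_add p0)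
          then show "e \<in> Len 1" by (simp only: e) simp
        qed
        then show ?thesis using virt_gen_Len1 rE by blast
      next
        case m: False
        \<comment> \<open>The general bound adds two transversal sections of length at most
          \<open>m div 2\<close> to a halved generator. For \<open>m = 2\<close> this would be 3,
          whose half rounds up to 2 again, so a sharper count is made.\<close>
        define n where "n = (if m = 2 then 2 else 2 * (m div 2) + (m + 1) div 2)"
        have "E \<subseteq> Len n"
        proof
          fix e assume "e \<in> E"
          then obtain j s where e: "e = p j + sec s j - p (j + rot s)" "s \<in> S" by (auto simp: E_def)
          have sj: "sec s j \<in> Len ((m + 1) div 2)" using e(2) less.prems sec_Len_half by blast
          have el: "e \<in> Len (ql j + (m + 1) div 2 + ql (j + rot s))"
            unfolding e(1) by (intro Len_diff Len_add p sj)
          show "e \<in> Len n"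
          proof (cases "m = 2")
            case False
            have "ql j \<le> m div 2" for j using i sum by (auto simp: ql_def)
            then have "ql j + (m + 1) div 2 + ql (j + rot s) \<le> n"
              using False add_mono[of "ql j" "m div 2" "ql (j + rot s)" "m div 2"] by (simp add: n_def)
            then show ?thesis using el Len_mono by blast
          next
            case 2: True
            show ?thesis
            proof (cases "rot s = 0")
              case True
              have "s \<in> H" using e(2) by (auto simp: H_def intro: gen_base)
              \<comment> \<open>All of the first level stabilizer of \<open>H\<close> fixes level 2
                here, so such a generator is trivial.\<close>
              then have "s = 0" using e(2) less.prems True 2 st by (intro Len2_stab2) auto
              then have "e = 0" by (simp add: e(1))
              then show ?thesis by (simp only: zero_in_Len)
            next
              case False
              \<comment> \<open>The two transversal elements differ, so their lengths are taken at
                different positions, and the two nonzero values of \<open>ql\<close> sum to at most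
                1.\<close>
              then have "ql j + ql (j + rot s) \<le> k i + k (i - r)"
                using letter_cases[of r] letter_cases[of "rot s"] letter_cases[of i] letter_cases[of j] h(2)
                unfolding r_def[symmetric] ql_def by auto
              also have "\<dots> \<le> 1" using i sum 2 by simp
              finally have "ql j + (m + 1) div 2 + ql (j + rot s) \<le> n" by (simp add: n_def 2)
              then show ?thesis using el Len_mono by blast
            qed
          qed
        qed
        then have sE: "(\<lambda>s. sec s q) ` E \<subseteq> Len ((n + 1) div 2)" for q using sec_Len_half by blast
        moreover have "(n + 1) div 2 < m"
        proof (cases "m = 2")
          case False
          with m have "m \<ge> 3" by simp
          then have "(2 * (m div 2) + (m + 1) div 2 + 1) div 2 < m"
            by (cases "even m") (auto elim!: evenE oddE simp: div_less_iff_less_mult)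
          with False show ?thesis by (simp add: n_def)
        qed (simp add: n_def)
        ultimately have v: "virt (gen ((\<lambda>s. sec s q) ` E))" for q by (intro less.IH[OF _ sE])
        show ?thesis by (rule virt_gen_stab[OF rE v])
      qed
      then show ?thesis
        unfolding H_def[symmetric] by (intro virt_transitive[OF H(1) hH h(2), of i]) (simp add: secs)
    qed
  qed
qed

lemma virt_fin_gen: "finite S \<Longrightarrow> S \<subseteq> GS \<Longrightarrow> virt (gen S)"
proof -
  assume S: "finite S" "S \<subseteq> GS"
  have "\<exists>m. S \<subseteq> Len m" using S
  proof (induction S)
    case (insert x S)
    then obtain m n where "S \<subseteq> Len m" "x \<in> Len n" using GS_Len by blast
    then have "insert x S \<subseteq> Len (max m n)"
      using Len_mono[of m "max m n"] Len_mono[of n "max m n"] by auto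
    then show ?case by blast
  qed simp
  then show ?thesis using virt_gen by blast
qed

section \<open>Independent homomorphisms\<close>

definition others_ker :: "aut set \<Rightarrow> (aut \<Rightarrow> aut) set \<Rightarrow> (aut \<Rightarrow> aut) \<Rightarrow> aut set" where
  "others_ker K U f = {k \<in> K. \<forall>g\<in>U - {f}. g k = 0}"

text \<open>Independence of \<open>f\<close> up to finite index: \<open>f\<close> still has large
  image where all other homomorphisms vanish.\<close>

definition good :: "aut set \<Rightarrow> (aut \<Rightarrow> aut) set \<Rightarrow> (aut \<Rightarrow> aut) \<Rightarrow> bool" where
  "good K U f \<longleftrightarrow> fi (f ` others_ker K U f) GS"

lemma others_kerD:
  "k \<in> others_ker K U f \<Longrightarrow> k \<in> K" "k \<in> others_ker K U f \<Longrightarrow> g \<in> U \<Longrightarrow> g \<noteq> f \<Longrightarrow> g k = 0"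
  by (auto simp: others_ker_def)

lemma others_kerI: "k \<in> K \<Longrightarrow> (\<And>g. g \<in> U \<Longrightarrow> g \<noteq> f \<Longrightarrow> g k = 0) \<Longrightarrow> k \<in> others_ker K U f"
  by (auto simp: others_ker_def)

lemma coordsD:
  assumes "coords K U"
  shows "subgp K" "finite U" "f \<in> U \<Longrightarrow> hom_on K f" "f \<in> U \<Longrightarrow> f ` K \<subseteq> GS" "f \<in> U \<Longrightarrow> fi (f ` K) GS"
    "k \<in> K \<Longrightarrow> \<forall>f\<in>U. f k = 0 \<Longrightarrow> k = 0"
  using assms by (auto simp: coords_def)

lemma subgp_others_ker: assumes "coords K U" shows "subgp (others_ker K U f)"
proof (rule subgpI)
  note K = coordsD(1)[OF assms] and hom = coordsD(3)[OF assms]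
  show "0 \<in> others_ker K U f"
    using hom_on_zero[OF hom K] subgp_zero[OF K] by (auto simp: others_ker_def)
  show "x + y \<in> others_ker K U f" if "x \<in> others_ker K U f" "y \<in> others_ker K U f" for x y
  proof -
    note x = \<open>x \<in> others_ker K U f\<close> and y = \<open>y \<in> others_ker K U f\<close>
    note xy = others_kerD(1)[OF x] others_kerD(1)[OF y]
    have "g (x + y) = 0" if "g \<in> U" "g \<noteq> f" for g
      using hom_onD[OF hom[OF that(1)] xy] others_kerD(2)[OF x that] others_kerD(2)[OF y that] by simp
    then show ?thesis using subgp_add[OF K xy] by (rule others_kerI[rotated])
  qed
  show "- x \<in> others_ker K U f" if "x \<in> others_ker K U f" for x
  proof -
    note x = others_kerD(1)[OF that]
    have "g (- x) = 0" if "g \<in> U" "g \<noteq> f" for g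
      using hom_on_uminus[OF hom[OF that(1)] K x] others_kerD(2)[OF \<open>x \<in> others_ker K U f\<close> that] by simp
    then show ?thesis using subgp_uminus[OF K x] by (rule others_kerI[rotated])
  qed
qed

lemma coords_restrict:
  assumes c: "coords K U" and K': "subgp K'" "K' \<subseteq> K" "fi K' K"
  shows "coords K' U" and "f \<in> U \<Longrightarrow> good K U f \<Longrightarrow> good K' U f"
proof -
  note K = coordsD(1)[OF c] and hom = coordsD(3)[OF c]
  have img: "fi (f ` M') GS" if "f \<in> U" "fi M' M" "subgp M'" "M' \<subseteq> M" "subgp M" "M \<subseteq> K" "fi (f ` M) GS" for f M M'
  proof (rule fi_trans)
    have h: "hom_on M f" "hom_on M' f" using hom[OF that(1)] that(4,6) by (auto intro: hom_on_subset)
    show "fi (f ` M') (f ` M)" by (rule fi_image[OF that(2) h(1) that(5,4)])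
    show "subgp (f ` M')" "subgp (f ` M)" using h that by (auto intro: subgp_image)
    show "f ` M \<subseteq> GS" using coordsD(4)[OF c that(1)] that(6) by blast
  qed (use that subgp_GS in auto)
  have "fi (f ` K') GS" if "f \<in> U" for f
    using img[OF that K'(3,1,2) K order.refl] coordsD(5)[OF c that] by blast
  then show "coords K' U"
    using c K' unfolding coords_def by (meson hom_on_subset image_mono order_trans subsetD)
  assume f: "f \<in> U" and g: "good K U f"
  define N where "N = others_ker K U f"
  have N: "subgp N" "N \<subseteq> K" using subgp_others_ker[OF c] by (auto simp: N_def others_ker_def)
  have e: "others_ker K' U f = K' \<inter> N" using K'(2) by (auto simp: N_def others_ker_def)
  have "fi (K' \<inter> N) N" by (rule fi_Int[OF K'(3,1) N(2,1)])
  then show "good K' U f" unfolding good_def e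
    by (rule img[OF f]) (use N K' g in \<open>auto simp: good_def N_def intro: subgp_Int\<close>)
qed

lemma stab_embedw: "rot x = 0 \<Longrightarrow> stab (Suc (length w)) (embedw w x)"
  by (induction w) auto

lemma stab_length_embedw: "stab (length w) (embedw w x)"
  by (induction w) auto

text \<open>The sections of \<open>u\<close> at vertices below which \<open>N\<close> acts trivially can be dropped without losing injectivity.\<close>

lemma good_step:
  assumes c: "coords K U" and u: "u \<in> U"
  shows "\<exists>K' U'. K' \<subseteq> K \<and> fi K' K \<and> coords K' U' \<and>
    {f \<in> U'. \<not> good K' U' f} \<subseteq> {f \<in> U. \<not> good K U f} - {u}"
proof -
  note K = coordsD(1)[OF c] and hom = coordsD(3)[OF c]
  define L where "L = u ` K"
  have L: "subgp L" "L \<subseteq> GS" "fi L GS"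
    using subgp_image[OF hom[OF u] K] coordsD(4,5)[OF c u] by (auto simp: L_def)
  obtain l where l: "deep l L" using fi_deep[OF L] by blast
  define N where "N = u ` others_ker K U u"
  have sub: "others_ker K U u \<subseteq> K" by (auto simp: others_ker_def)
  have N: "subgp N" "N \<subseteq> GS"
    using subgp_image[OF hom_on_subset[OF hom[OF u] sub] subgp_others_ker[OF c]] coordsD(4)[OF c u] sub
    by (auto simp: N_def)
  have nrm: "- g + x + g \<in> N" if "g \<in> L" "x \<in> N" for g x
  proof -
    obtain k k' where k: "k \<in> K" "g = u k" "k' \<in> others_ker K U u" "x = u k'"
      using \<open>g \<in> L\<close> \<open>x \<in> N\<close> by (auto simp: L_def N_def)
    then have k': "k' \<in> K" using sub by auto
    have e: "f (- k + k' + k) = - f k + f k' + f k" if "f \<in> U" for f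
      using hom_onD[OF hom[OF that]] hom_on_uminus[OF hom[OF that] K] subgp_closed[OF K] k(1) k' by simp
    have "- k + k' + k \<in> others_ker K U u"
    proof (rule others_kerI)
      show "- k + k' + k \<in> K" by (intro subgp_add[OF K] subgp_uminus[OF K] k(1) k')
      show "f (- k + k' + k) = 0" if "f \<in> U" "f \<noteq> u" for f
        unfolding e[OF that(1)] others_kerD(2)[OF k(3) that] by simp
    qed
    then show ?thesis using e[OF u] k by (auto simp: N_def intro: rev_image_eqI)
  qed
  \<comment> \<open>Vertices at or below which \<open>N\<close> is active, one level below
    \<open>l\<close> as \<open>active_fi\<close> requires.\<close>
  define P where "P = {p. length p = Suc l \<and> (\<exists>x\<in>N. \<not> (fixv x p \<and> secw x p = 0))}"
  have "P \<subseteq> {p :: 3 list. set p \<subseteq> UNIV \<and> length p = Suc l}" by (auto simp: P_def)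
  then have finP: "finite P" by (rule finite_subset) (rule finite_lists_length_eq, simp)
  have PE: "\<exists>w i. length w = l \<and> p = w @ [i]" if "p \<in> P" for p
    using that by (auto simp: P_def length_Suc_conv_rev)
  \<comment> \<open>Sections at level \<open>Suc l\<close> are additive only where that level is
    fixed.\<close>
  define K' where "K' = {k \<in> K. stab (Suc l) (u k)}"
  have K'_eq: "K' = {k \<in> K. u k \<in> {x \<in> GS. stab (Suc l) x}}"
    using L(2) by (auto simp: K'_def L_def)
  have K': "subgp K'" "K' \<subseteq> K" "fi K' K"
  proof -
    show "subgp K'" unfolding K'_eq by (rule subgp_vimage[OF hom[OF u] K subgp_stab[OF subgp_GS]])
    show "fi K' K" unfolding K'_eq
      by (rule fi_vimage[OF fi_stab[OF subgp_GS] subgp_stab[OF subgp_GS] hom[OF u] K])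
         (rule coordsD(4)[OF c u])
  qed (simp add: K'_def)
  define F where "F p = (\<lambda>k. secw (u k) p)" for p
  define U' where "U' = (U - {u}) \<union> F ` P"
  note c' = coords_restrict[OF c K']
  have "coords K' U'" unfolding coords_def
  proof (intro conjI ballI impI)
    show "finite U'" using coordsD(2)[OF c] finP by (simp add: U'_def)
    show "k = 0" if k: "k \<in> K'" "\<forall>f\<in>U'. f k = 0" for k
    proof -
      \<comment> \<open>Every member of \<open>U\<close> other than \<open>u\<close> vanishes at
        \<open>k\<close>, so \<open>u k\<close> lies in \<open>N\<close> and is trivial below the
        vertices outside \<open>P\<close>.\<close>
      have kN: "u k \<in> N" using k K' by (auto simp: N_def others_ker_def U'_def)
      have "u k = 0"
      proof (rule stab_eq_zero)
        show "stab (Suc l) (u k)" using k(1) by (simp add: K'_def)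
        show "secw (u k) p = 0" if "length p = Suc l" for p
        proof (cases "p \<in> P")
          case True
          then have "F p k = 0" using k(2) by (simp add: U'_def)
          then show ?thesis by (simp add: F_def)
        next
          case False
          then show ?thesis using kN that by (auto simp: P_def)
        qed
      qed
      then show "k = 0" using k K' by (intro coordsD(6)[OF c]) (auto simp: U'_def)
    qed
  next
    fix f assume "f \<in> U'"
    then consider "f \<in> U" | p where "p \<in> P" "f = F p" by (auto simp: U'_def)
    then have "hom_on K' f \<and> f ` K' \<subseteq> GS \<and> fi (f ` K') GS"
    proof cases
      case 1
      then show ?thesis using coordsD[OF c'(1)] by blast
    next
      case 2
      obtain w i where w: "length w = l" "p = w @ [i]" using PE[OF 2(1)] by blast
      have "hom_on K' f" unfolding hom_on_def
      proof (intro ballI)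
        fix x y assume xy: "x \<in> K'" "y \<in> K'"
        then have "fixv (u x) p" using w by (intro stab_fixv[of "Suc l"]) (auto simp: K'_def)
        moreover have "u (x + y) = u x + u y" using xy K' hom_onD[OF hom[OF u]] by blast
        ultimately show "f (x + y) = f x + f y" by (simp add: 2(2) F_def fixv_secw_add)
      qed
      moreover have s: "f ` K' \<subseteq> GS" using L(2) K'(2) by (auto simp: 2(2) F_def L_def intro!: secw_in_GS)
      \<comment> \<open>The copy of \<open>GSD\<close> at \<open>w\<close> lies in \<open>L\<close>
        and its sections at \<open>i\<close> are all of \<open>GS\<close>.\<close>
      moreover have "GS \<subseteq> f ` K'"
      proof
        fix g assume "g \<in> GS"
        then obtain d where d: "d \<in> GSD" "sec d i = g" using lift_sec_GSD by blast
        then have "embedw w d \<in> L" using l w by (auto simp: deep_def)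
        then obtain k where k: "k \<in> K" "u k = embedw w d" by (auto simp: L_def)
        have "stab (Suc l) (u k)" using stab_embedw[of d w] d(1) w(1) by (simp add: k GSD_iff)
        then have "k \<in> K'" using k by (simp add: K'_def)
        moreover have "f k = g" using d by (simp add: 2(2) F_def k w(2) secw_append secw_embedw)
        ultimately show "g \<in> f ` K'" by blast
      qed
      ultimately show ?thesis using fi_refl[OF subgp_GS] fi_mono by blast
    qed
    then show "hom_on K' f" "f ` K' \<subseteq> GS" "fi (f ` K') GS" by auto
  qed (rule K')
  moreover have "{f \<in> U'. \<not> good K' U' f} \<subseteq> {f \<in> U. \<not> good K U f} - {u}"
  proof -
    have new: "good K' U' (F p)" if "p \<in> P" for p
    proof -
      obtain w i where w: "length w = l" "p = w @ [i]" using PE[OF \<open>p \<in> P\<close>] by blast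
      obtain x where x: "x \<in> N" "\<not> (fixv x (w @ [i]) \<and> secw x (w @ [i]) = 0)" using \<open>p \<in> P\<close> w by (auto simp: P_def)
      have "fi (pull p N) GS" unfolding w(2) by (rule active_fi[OF L(1) l N nrm w(1) x])
      moreover have "pull p N \<subseteq> F p ` others_ker K' U' (F p)"
      proof
        fix m assume "m \<in> pull p N"
        then obtain k where k: "k \<in> others_ker K U u" "u k = embedw p m" by (auto simp: pull_def N_def)
        have "stab (Suc l) (u k)" using stab_length_embedw[of p m] w by (simp add: k)
        then have "k \<in> K'" using k by (simp add: K'_def others_ker_def)
        moreover have "F q k = 0" if "q \<in> P" "F q \<noteq> F p" for q
          using that w by (auto simp: F_def k secw_embedw P_def)
        ultimately have "k \<in> others_ker K' U' (F p)"
          using k(1) by (auto simp: others_ker_def U'_def)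
        moreover have "F p k = m" by (simp add: F_def k secw_embedw)
        ultimately show "m \<in> F p ` others_ker K' U' (F p)" by blast
      qed
      ultimately show ?thesis unfolding good_def by (rule fi_mono)
    qed
    have old: "good K' U' f" if "f \<in> U" "f \<noteq> u" "good K U f" for f
    proof -
      have "others_ker K' U f \<subseteq> others_ker K' U' f"
      proof
        fix k assume k: "k \<in> others_ker K' U f"
        have "u k = 0" using others_kerD(2)[OF k u] that(2) by blast
        then have "F p k = 0" for p by (simp add: F_def)
        then show "k \<in> others_ker K' U' f"
          using others_kerD[OF k] by (intro others_kerI) (auto simp: U'_def)
      qed
      then have "f ` others_ker K' U f \<subseteq> f ` others_ker K' U' f" by (rule image_mono)
      then show ?thesis using c'(2)[OF that(1,3)] unfolding good_def by (rule fi_mono[rotated])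
    qed
    show ?thesis using new old by (auto simp: U'_def)
  qed
  ultimately show ?thesis using K' by blast
qed

lemma virt_good:
  assumes "virt H" "subgp H"
  shows "\<exists>K U. K \<subseteq> H \<and> fi K H \<and> coords K U \<and> (\<forall>f\<in>U. good K U f)"
proof -
  have *: "\<exists>K' U'. K' \<subseteq> H \<and> fi K' H \<and> coords K' U' \<and> (\<forall>f\<in>U'. good K' U' f)"
    if "K \<subseteq> H" "fi K H" "coords K U" for K U
    using that
  proof (induction "card {f \<in> U. \<not> good K U f}" arbitrary: K U rule: less_induct)
    case less
    show ?case
    proof (cases "\<forall>f\<in>U. good K U f")
      case False
      then obtain u where u: "u \<in> U" "\<not> good K U u" by blast
      obtain K' U' where K': "K' \<subseteq> K" "fi K' K" "coords K' U'"
        "{f \<in> U'. \<not> good K' U' f} \<subseteq> {f \<in> U. \<not> good K U f} - {u}"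
        using good_step[OF less.prems(3) u(1)] by blast
      have "{f \<in> U'. \<not> good K' U' f} \<subset> {f \<in> U. \<not> good K U f}" using K'(4) u by blast
      then have "card {f \<in> U'. \<not> good K' U' f} < card {f \<in> U. \<not> good K U f}"
        using coordsD(2)[OF less.prems(3)] by (intro psubset_card_mono) auto
      moreover have "fi K' H"
        by (rule fi_trans[OF K'(2) less.prems(2)])
           (use coordsD(1)[OF K'(3)] coordsD(1)[OF less.prems(3)] less.prems assms in auto)
      ultimately show ?thesis using less.hyps[of U' K'] K' less.prems by blast
    qed (use less.prems in blast)
  qed
  show ?thesis using assms(1) * unfolding virt_def by blast
qed

section \<open>Merging three homomorphisms into one\<close>

definition node3 :: "aut \<Rightarrow> aut \<Rightarrow> aut \<Rightarrow> aut" where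
  "node3 x y z = embed 0 x + (embed 1 y + embed 2 z)"

lemma rot_node3 [simp]: "rot (node3 x y z) = 0"
  and sec_node3 [simp]: "sec (node3 x y z) 0 = x" "sec (node3 x y z) 1 = y" "sec (node3 x y z) 2 = z"
  by (simp_all add: node3_def)

lemma node3_eqI: "rot g = 0 \<Longrightarrow> sec g 0 = x \<Longrightarrow> sec g 1 = y \<Longrightarrow> sec g 2 = z \<Longrightarrow> node3 x y z = g"
  unfolding node3_def using embed_decompose[of g] by simp

lemma node3_add: "node3 (x + x') (y + y') (z + z') = node3 x y z + node3 x' y' z'"
  by (rule node3_eqI) auto

lemma node3_GSD: "x \<in> GSD \<Longrightarrow> y \<in> GSD \<Longrightarrow> z \<in> GSD \<Longrightarrow> node3 x y z \<in> GSD"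
  unfolding node3_def by (intro GSD_closed embed_GSD)

lemma fi_node3:
  assumes "subgp A" "subgp B" "subgp C" "fi A GS" "fi B GS" "fi C GS"
  shows "fi {node3 x y z | x y z. x \<in> A \<and> y \<in> B \<and> z \<in> C} GS"
proof -
  obtain f g h :: "aut \<Rightarrow> aut" where f: "finite (f ` GS)" "\<And>x y. x \<in> GS \<Longrightarrow> y \<in> GS \<Longrightarrow> f x = f y \<Longrightarrow> x - y \<in> A"
    and g: "finite (g ` GS)" "\<And>x y. x \<in> GS \<Longrightarrow> y \<in> GS \<Longrightarrow> g x = g y \<Longrightarrow> x - y \<in> B"
    and h: "finite (h ` GS)" "\<And>x y. x \<in> GS \<Longrightarrow> y \<in> GS \<Longrightarrow> h x = h y \<Longrightarrow> x - y \<in> C"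
    using fiE[OF assms(4,1)] fiE[OF assms(5,2)] fiE[OF assms(6,3)] by blast
  define \<kappa> where "\<kappa> x = (rot x, f (sec x 0), g (sec x 1), h (sec x 2))" for x
  show ?thesis
  proof (rule fiI)
    have "\<kappa> ` GS \<subseteq> UNIV \<times> (f ` GS \<times> (g ` GS \<times> h ` GS))" by (auto simp: \<kappa>_def intro: sec_in_GS)
    then show "finite (\<kappa> ` GS)" by (rule finite_subset) (use f g h in auto)
    fix x y assume xy: "x \<in> GS" "y \<in> GS" "\<kappa> x = \<kappa> y"
    then have r: "rot x = rot y" by (simp add: \<kappa>_def)
    have "sec x 0 - sec y 0 \<in> A" "sec x 1 - sec y 1 \<in> B" "sec x 2 - sec y 2 \<in> C"
      using xy by (auto simp: \<kappa>_def intro!: f g h sec_in_GS)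
    moreover have "x - y = node3 (sec x 0 - sec y 0) (sec x 1 - sec y 1) (sec x 2 - sec y 2)"
      by (rule node3_eqI[symmetric]) (simp_all add: r)
    ultimately show "x - y \<in> {node3 x y z | x y z. x \<in> A \<and> y \<in> B \<and> z \<in> C}" by blast
  qed
qed

lemma fi_GSD: "fi GSD GS"
  by (rule deep_fi[OF subgp_GSD, of 0]) (simp add: deep_def)

text \<open>Three independent homomorphisms become the sections of a single one. Independence of the
  new one holds because its restricted image contains a product of three finite index subgroups
  placed on level 1, which has finite index by \<open>fi_node3\<close>.\<close>

lemma merge_three:
  assumes c: "coords K U" and good: "\<And>f. f \<in> U \<Longrightarrow> good K U f" and card: "card U > 2"
  shows "\<exists>K' U'. K' \<subseteq> K \<and> fi K' K \<and> coords K' U' \<and> (\<forall>f\<in>U'. good K' U' f) \<and> card U' < card U"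
proof -
  note K = coordsD(1)[OF c] and hom = coordsD(3)[OF c]
  obtain A where A: "A \<subseteq> U" "card A = 3" using obtain_subset_with_card_n[of 3 U] card by auto
  then obtain f1 f2 f3 where d: "A = {f1, f2, f3}" "f1 \<noteq> f2" "f1 \<noteq> f3" "f2 \<noteq> f3" by (auto simp: card_3_iff)
  then have fU: "f1 \<in> U" "f2 \<in> U" "f3 \<in> U" using A by auto
  \<comment> \<open>A triple of elements of \<open>GS\<close> need not be the sections of an element
    of \<open>GS\<close>; a triple from \<open>GSD\<close> is, by branching.\<close>
  define V where "V f = {k \<in> K. f k \<in> GSD}" for f
  have V: "subgp (V f)" "fi (V f) K" "V f \<subseteq> K" if "f \<in> U" for f
    using subgp_vimage[OF hom[OF that] K subgp_GSD] fi_vimage[OF fi_GSD subgp_GSD hom[OF that] K coordsD(4)[OF c that]]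
    by (auto simp: V_def)
  define K' where "K' = V f1 \<inter> (V f2 \<inter> V f3)"
  have K': "subgp K'" "K' \<subseteq> K" "fi K' K"
    unfolding K'_def using V fU K by (auto intro!: subgp_Int fi_Int2)
  note c' = coords_restrict[OF c K'] and homK' = coordsD(3)[OF coords_restrict(1)[OF c K']]
  define F where "F k = node3 (f1 k) (f2 k) (f3 k)" for k
  define U' where "U' = insert F (U - {f1, f2, f3})"
  have good': "good K' U f" if "f \<in> U" for f using c'(2)[OF that good[OF that]] .
  have F: "good K' U' F"
  proof -
    define M where "M f = f ` others_ker K' U f" for f
    have M: "subgp (M f)" "fi (M f) GS" if "f \<in> U" for f
    proof -
      show "fi (M f) GS" using good'[OF that] by (simp add: good_def M_def)
      have "others_ker K' U f \<subseteq> K'" by (auto simp: others_ker_def)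
      then show "subgp (M f)" unfolding M_def
        by (intro subgp_image subgp_others_ker c') (rule hom_on_subset[OF homK'[OF that]])
    qed
    have "{node3 x y z | x y z. x \<in> M f1 \<and> y \<in> M f2 \<and> z \<in> M f3} \<subseteq> F ` others_ker K' U' F"
    proof clarify
      fix x y z assume "x \<in> M f1" "y \<in> M f2" "z \<in> M f3"
      then obtain k1 k2 k3 where k: "k1 \<in> others_ker K' U f1" "k2 \<in> others_ker K' U f2" "k3 \<in> others_ker K' U f3"
        "x = f1 k1" "y = f2 k2" "z = f3 k3" by (auto simp: M_def)
      then have kK: "k1 \<in> K'" "k2 \<in> K'" "k3 \<in> K'" by (auto simp: others_ker_def)
      define s where "s = k1 + (k2 + k3)"
      have s: "s \<in> K'" unfolding s_def using kK by (intro subgp_add[OF K'(1)])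
      have e: "f s = f k1 + (f k2 + f k3)" if "f \<in> U" for f
        unfolding s_def using kK subgp_add[OF K'(1)] by (simp add: hom_onD[OF homK'[OF that]])
      have "f1 k2 = 0" "f1 k3 = 0" "f2 k1 = 0" "f2 k3 = 0" "f3 k1 = 0" "f3 k2 = 0"
        using k(1-3) d(2-4) fU unfolding others_ker_def by blast+
      then have "f1 s = x" "f2 s = y" "f3 s = z"
        by (simp_all add: e fU k(4-6))
      then have "F s = node3 x y z" by (simp add: F_def)
      moreover have "s \<in> others_ker K' U' F"
      proof (rule others_kerI[OF s])
        fix g assume "g \<in> U'" "g \<noteq> F"
        then have g: "g \<in> U" "g \<noteq> f1" "g \<noteq> f2" "g \<noteq> f3" by (auto simp: U'_def)
        show "g s = 0" unfolding e[OF g(1)]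
          using others_kerD(2)[OF k(1) g(1,2)] others_kerD(2)[OF k(2) g(1,3)] others_kerD(2)[OF k(3) g(1,4)]
          by simp
      qed
      ultimately show "node3 x y z \<in> F ` others_ker K' U' F" by (metis imageI)
    qed
    then show ?thesis unfolding good_def
      using fi_node3[OF M(1)[OF fU(1)] M(1)[OF fU(2)] M(1)[OF fU(3)] M(2)[OF fU(1)] M(2)[OF fU(2)] M(2)[OF fU(3)]]
      by (rule fi_mono[rotated])
  qed
  have "coords K' U'" unfolding coords_def
  proof (intro conjI ballI impI)
    show "finite U'" using coordsD(2)[OF c] by (simp add: U'_def)
    show "k = 0" if k: "k \<in> K'" "\<forall>f\<in>U'. f k = 0" for k
    proof (rule coordsD(6)[OF c'(1) k(1)], rule ballI)
      fix f assume f: "f \<in> U"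
      have "F k = 0" using k(2) by (simp add: U'_def)
      then have "f1 k = 0" "f2 k = 0" "f3 k = 0" unfolding F_def using sec_node3 by (metis sec_zero)+
      then show "f k = 0" using f k(2) by (cases "f \<in> {f1, f2, f3}") (auto simp: U'_def)
    qed
  next
    fix f assume "f \<in> U'"
    then consider "f \<in> U" | "f = F" by (auto simp: U'_def)
    then have "hom_on K' f \<and> f ` K' \<subseteq> GS \<and> fi (f ` K') GS"
    proof cases
      case 1
      then show ?thesis using coordsD[OF c'(1)] by blast
    next
      case 2
      have "hom_on K' F" unfolding hom_on_def F_def
        by (simp add: hom_onD[OF homK'[OF fU(1)]] hom_onD[OF homK'[OF fU(2)]] hom_onD[OF homK'[OF fU(3)]] node3_add)
      moreover have "F ` K' \<subseteq> GS"
        using GSD_subset by (auto simp: F_def K'_def V_def intro!: subsetD[OF GSD_subset] node3_GSD)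
      moreover have "fi (F ` K') GS"
        using F unfolding good_def by (rule fi_mono) (auto simp: others_ker_def)
      ultimately show ?thesis using 2 by simp
    qed
    then show "hom_on K' f" "f ` K' \<subseteq> GS" "fi (f ` K') GS" by auto
  qed (rule K')
  moreover have "good K' U' f" if f: "f \<in> U'" for f
  proof (cases "f = F")
    case False
    with f have f: "f \<in> U" "f \<notin> {f1, f2, f3}" by (auto simp: U'_def)
    have "F k = 0" if "k \<in> others_ker K' U f" for k
      using that f fU by (auto simp: others_ker_def F_def intro!: node3_eqI)
    then have "others_ker K' U f \<subseteq> others_ker K' U' f" by (auto simp: others_ker_def U'_def)
    then have "f ` others_ker K' U f \<subseteq> f ` others_ker K' U' f" by (rule image_mono)
    then show ?thesis using good'[OF f(1)] unfolding good_def by (rule fi_mono[rotated])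
  qed (use F in simp)
  moreover have "card U' < card U"
  proof -
    have "card U' \<le> Suc (card (U - A))" unfolding U'_def d(1)
      using coordsD(2)[OF c] by (simp add: card_insert_if)
    also have "card (U - A) = card U - 3" using A coordsD(2)[OF c] by (simp add: card_Diff_subset finite_subset)
    finally show ?thesis using card by simp
  qed
  ultimately show ?thesis using K' by blast
qed

lemma virt_coords2:
  assumes "virt H" "subgp H"
  shows "\<exists>K U. K \<subseteq> H \<and> fi K H \<and> coords K U \<and> (\<forall>f\<in>U. good K U f) \<and> card U \<le> 2"
proof -
  have *: "\<exists>K' U'. K' \<subseteq> H \<and> fi K' H \<and> coords K' U' \<and> (\<forall>f\<in>U'. good K' U' f) \<and> card U' \<le> 2"
    if "K \<subseteq> H" "fi K H" "coords K U" "\<forall>f\<in>U. good K U f" for K U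
    using that
  proof (induction "card U" arbitrary: K U rule: less_induct)
    case less
    show ?case
    proof (cases "card U \<le> 2")
      case False
      then obtain K' U' where K': "K' \<subseteq> K" "fi K' K" "coords K' U'" "\<forall>f\<in>U'. good K' U' f" "card U' < card U"
        using merge_three[OF less.prems(3)] less.prems(4) by (meson not_le)
      moreover have "fi K' H"
        by (rule fi_trans[OF K'(2) less.prems(2)])
           (use coordsD(1)[OF K'(3)] coordsD(1)[OF less.prems(3)] less.prems assms in auto)
      ultimately show ?thesis using less.hyps[of U' K'] less.prems by blast
    qed (use less.prems in blast)
  qed
  show ?thesis using virt_good[OF assms] * by blast
qed

section \<open>Commensurability\<close>

definition ac :: "aut \<Rightarrow> word3 \<Rightarrow> word3" where "ac x w = act w x"

lemma ac_add: "ac (x + y) = ac y \<circ> ac x"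
  by (rule ext) (simp add: ac_def act_add)

lemma ac_zero: "ac 0 = id"
  by (rule ext) (simp add: ac_def)

lemma act_eq_self_fixv: "act w x = w \<Longrightarrow> fixv x w"
  by (induction w arbitrary: x) auto

text \<open>The coinductive model is faithful: an automorphism fixing every vertex is 0 by
  bisimulation.\<close>

lemma inj_ac: "inj ac"
proof (rule injI)
  fix x y assume "ac x = ac y"
  then have "act w x = act w y" for w by (metis ac_def)
  then have "act w (x + - y) = w" for w by (simp add: act_add)
  then have "x + - y = 0" by (intro fixv_all_eq_zero act_eq_self_fixv)
  then show "x = y" by (simp add: add_eq_0_iff2)
qed

lemma act_snoc: "\<exists>j. act (w @ [i]) x = act w x @ [j]"
  by (induction w arbitrary: x) auto

lemma ac_in_Aut_T: "ac x \<in> carrier Aut_T"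
proof (rule Aut_T_memI[where g = "ac (- x)"])
  show "ac (- x) (ac x w) = w" for w by (simp add: ac_def)
  show "ac x (ac (- x) w) = w" for w using act_uminus_cancel[of w "- x"] by (simp add: ac_def)
qed (auto simp: ac_def act_snoc)

lemma ac_apow: "ac (apow k) (i # w) = (i + k) # w" "ac (apow k) [] = []"
  by (simp_all add: ac_def)

lemma ac_a: "ac (apow 1) = gs_a"
proof
  show "ac (apow 1) w = gs_a w" for w by (cases w) (simp_all add: ac_apow)
qed

lemma ac_b: "ac (bpow 1) = gs_b"
proof
  have a2: "act w (apow 2) = gs_a (gs_a w)" for w by (cases w) (simp_all add: add.assoc)
  show "ac (bpow 1) w = gs_b w" for w
  proof (induction w)
    case (Cons i w)
    then show ?case
      using ac_a a2[of w] by (auto simp: ac_def inv_gs_a fun_eq_iff)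
  qed (simp add: ac_def)
qed

lemma mult_GS: "f \<otimes>\<^bsub>Gupta_Sidki\<^esub> g = g \<circ> f" and one_GS: "\<one>\<^bsub>Gupta_Sidki\<^esub> = id"
  by (simp_all add: Gupta_Sidki_def Aut_T_def)

lemma inv_ac: "inv\<^bsub>Aut_T\<^esub> (ac x) = ac (- x)"
proof -
  interpret group Aut_T by (rule group_Aut_T)
  have "ac (- x) \<otimes>\<^bsub>Aut_T\<^esub> ac x = \<one>\<^bsub>Aut_T\<^esub>"
    using ac_add[of "- x" x] by (simp add: Aut_T_def ac_zero)
  then show ?thesis using ac_in_Aut_T by (intro inv_equality)
qed

lemma carrier_GS: "carrier Gupta_Sidki = ac ` GS"
proof -
  interpret group Aut_T by (rule group_Aut_T)
  have ab: "{gs_a, gs_b} \<subseteq> carrier Aut_T" using gs_a_in gs_b_in by auto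
  have "generate Aut_T {gs_a, gs_b} = ac ` GS"
  proof
    show "generate Aut_T {gs_a, gs_b} \<subseteq> ac ` GS"
    proof
      fix f assume "f \<in> generate Aut_T {gs_a, gs_b}"
      then show "f \<in> ac ` GS"
      proof induction
        case one
        then show ?case using GS_closed(1) ac_zero by (force simp: Aut_T_def)
      next
        case (incl h)
        then show ?case using apow_in_GS bpow_in_GS by (auto simp flip: ac_a ac_b)
      next
        case (inv h)
        then show ?case using apow_in_GS bpow_in_GS GS_closed(3)
          by (auto simp: inv_ac simp flip: ac_a ac_b)
      next
        case (eng h1 h2)
        then obtain x y where "x \<in> GS" "y \<in> GS" "h1 = ac x" "h2 = ac y" by auto
        then have "h1 \<otimes>\<^bsub>Aut_T\<^esub> h2 = ac (x + y)" "x + y \<in> GS"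
          by (auto simp: ac_add Aut_T_def intro: GS_closed)
        then show ?case by blast
      qed
    qed
    have sg: "subgroup (generate Aut_T {gs_a, gs_b}) Aut_T" by (rule generate_is_subgroup[OF ab])
    have "ac x \<in> generate Aut_T {gs_a, gs_b}" if "x \<in> GS" for x
      using that unfolding GS_def
    proof induction
      case (gen_base x)
      then show ?case by (auto simp: ac_a ac_b intro: generate.incl)
    next
      case gen_zero
      have "ac 0 = \<one>\<^bsub>Aut_T\<^esub>" by (simp add: ac_zero Aut_T_def)
      then show ?case by (simp only: generate.one)
    next
      case (gen_add x y)
      have "ac (x + y) = ac x \<otimes>\<^bsub>Aut_T\<^esub> ac y" by (simp add: ac_add Aut_T_def)
      then show ?case using gen_add.IH by (simp only: generate.eng)
    next
      case (gen_uminus x)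
      then show ?case using subgroup.m_inv_closed[OF sg] by (simp flip: inv_ac)
    qed
    then show "ac ` GS \<subseteq> generate Aut_T {gs_a, gs_b}" by auto
  qed
  then show ?thesis by (simp add: Gupta_Sidki_def)
qed

section \<open>Transfer to permutation groups\<close>

definition MG :: "aut set \<Rightarrow> (word3 \<Rightarrow> word3) monoid" where
  "MG H = Gupta_Sidki\<lparr>carrier := ac ` H\<rparr>"

lemma carrier_MG [simp]: "carrier (MG H) = ac ` H"
  and mult_MG [simp]: "f \<otimes>\<^bsub>MG H\<^esub> g = g \<circ> f"
  and one_MG [simp]: "\<one>\<^bsub>MG H\<^esub> = id"
  and MG_update: "(MG H)\<lparr>carrier := ac ` K\<rparr> = MG K"
  by (simp_all add: MG_def mult_GS one_GS)

lemma mult_MG_ac: "ac x \<otimes>\<^bsub>MG H\<^esub> ac y = ac (x + y)"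
  by (simp add: ac_add)

lemma MG_GS: "MG GS = Gupta_Sidki"
  by (simp add: MG_def flip: carrier_GS)

lemma group_MG: assumes "subgp H" shows "group (MG H)"
proof (rule groupI)
  fix f assume "f \<in> carrier (MG H)"
  then obtain x where x: "x \<in> H" "f = ac x" by auto
  then have "ac (- x) \<otimes>\<^bsub>MG H\<^esub> f = \<one>\<^bsub>MG H\<^esub>" "ac (- x) \<in> carrier (MG H)"
    using subgp_uminus[OF assms] by (auto simp del: mult_MG simp: mult_MG_ac ac_zero)
  then show "\<exists>g\<in>carrier (MG H). g \<otimes>\<^bsub>MG H\<^esub> f = \<one>\<^bsub>MG H\<^esub>" by blast
qed (use subgp_closed[OF assms] in \<open>auto simp: comp_assoc simp flip: ac_add ac_zero\<close>)

lemma inv_MG: "subgp H \<Longrightarrow> x \<in> H \<Longrightarrow> inv\<^bsub>MG H\<^esub> (ac x) = ac (- x)"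
  by (rule group.inv_equality[OF group_MG])
     (auto simp del: mult_MG simp: mult_MG_ac ac_zero subgp_uminus)

lemma finite_indexI:
  assumes "group G" "subgroup A G" "finite (f ` carrier G)"
    and eq: "\<And>x y. x \<in> carrier G \<Longrightarrow> y \<in> carrier G \<Longrightarrow> f x = f y \<Longrightarrow> x \<otimes>\<^bsub>G\<^esub> inv\<^bsub>G\<^esub> y \<in> A"
  shows "finite_index A G"
proof -
  interpret group G by fact
  define r where "r v = (SOME x. x \<in> carrier G \<and> f x = v)" for v
  have r: "r (f x) \<in> carrier G \<and> f (r (f x)) = f x" if "x \<in> carrier G" for x
    unfolding r_def by (rule someI[where x = x]) (use that in auto)
  have "rcosets\<^bsub>G\<^esub> A \<subseteq> (\<lambda>v. A #>\<^bsub>G\<^esub> r v) ` f ` carrier G"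
  proof
    fix C assume "C \<in> rcosets\<^bsub>G\<^esub> A"
    then obtain x where x: "x \<in> carrier G" "C = A #>\<^bsub>G\<^esub> x" by (auto simp: RCOSETS_def)
    have "r (f x) \<otimes>\<^bsub>G\<^esub> inv\<^bsub>G\<^esub> x \<in> A" using r x(1) by (intro eq) auto
    then have "r (f x) \<in> A #>\<^bsub>G\<^esub> x"
      using subgroup.rcos_module_rev[OF assms(2,1) x(1)] r[OF x(1)] by blast
    then have "A #>\<^bsub>G\<^esub> x = A #>\<^bsub>G\<^esub> r (f x)" by (rule repr_independence[OF _ x(1) assms(2)])
    then show "C \<in> (\<lambda>v. A #>\<^bsub>G\<^esub> r v) ` f ` carrier G" using x by blast
  qed
  then have "finite (rcosets\<^bsub>G\<^esub> A)" using assms(3) by (meson finite_imageI finite_subset)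
  with assms(2) show ?thesis by (simp add: finite_index_def)
qed

lemma finite_index_MG:
  assumes "subgp H" "subgp K" "K \<subseteq> H" "fi K H" shows "finite_index (ac ` K) (MG H)"
proof -
  interpret group "MG H" by (rule group_MG[OF assms(1)])
  obtain f :: "aut \<Rightarrow> aut" where f: "finite (f ` H)" "\<And>x y. x \<in> H \<Longrightarrow> y \<in> H \<Longrightarrow> f x = f y \<Longrightarrow> x - y \<in> K"
    using fiE[OF assms(4,2)] by blast
  show ?thesis
  proof (rule finite_indexI[OF group_MG[OF assms(1)]])
    show "subgroup (ac ` K) (MG H)"
    proof (rule subgroupI)
      show "inv\<^bsub>MG H\<^esub> a \<in> ac ` K" if "a \<in> ac ` K" for a
        using that assms inv_MG[OF assms(1)] subgp_uminus[OF assms(2)] by auto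
      show "a \<otimes>\<^bsub>MG H\<^esub> b \<in> ac ` K" if "a \<in> ac ` K" "b \<in> ac ` K" for a b
        using that subgp_add[OF assms(2)] by (auto simp flip: ac_add)
    qed (use assms subgp_zero in auto)
    show "finite ((f \<circ> the_inv ac) ` carrier (MG H))"
      using f(1) by (simp add: image_image the_inv_f_f[OF inj_ac])
    fix u v assume "u \<in> carrier (MG H)" "v \<in> carrier (MG H)" and e: "(f \<circ> the_inv ac) u = (f \<circ> the_inv ac) v"
    then obtain x y where x: "x \<in> H" "u = ac x" "y \<in> H" "v = ac y" by auto
    with e have "f x = f y" by (simp add: the_inv_f_f[OF inj_ac])
    then have "x + - y \<in> K" using f(2)[OF x(1,3)] by (simp add: diff_conv_add_uminus)
    then show "u \<otimes>\<^bsub>MG H\<^esub> inv\<^bsub>MG H\<^esub> v \<in> ac ` K"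
      using x inv_MG[OF assms(1)] by (simp del: mult_MG add: mult_MG_ac)
  qed
qed

lemma commensurable_one:
  assumes H: "subgp H" and K: "subgp K" "K \<subseteq> H" "fi K H"
    and f: "hom_on K f" "inj_on f K" "f ` K \<subseteq> GS" "fi (f ` K) GS"
  shows "commensurable (MG H) Gupta_Sidki"
  unfolding commensurable_def MG_GS[symmetric]
proof (intro exI conjI)
  show "finite_index (ac ` K) (MG H)" by (rule finite_index_MG[OF H K])
  show "finite_index (ac ` f ` K) (MG GS)"
    by (rule finite_index_MG[OF subgp_GS subgp_image[OF f(1) K(1)] f(3,4)])
  have "(\<lambda>u. ac (f (the_inv ac u))) \<in> iso (MG K) (MG (f ` K))"
  proof (rule isoI)
    show "(\<lambda>u. ac (f (the_inv ac u))) \<in> hom (MG K) (MG (f ` K))"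
      by (rule homI) (auto simp del: mult_MG simp: mult_MG_ac the_inv_f_f[OF inj_ac] hom_onD[OF f(1)])
    show "bij_betw (\<lambda>u. ac (f (the_inv ac u))) (carrier (MG K)) (carrier (MG (f ` K)))"
      unfolding bij_betw_def using f(2)
      by (auto simp: inj_on_def the_inv_f_f[OF inj_ac] inj_eq[OF inj_ac] image_image)
  qed
  then show "(MG H)\<lparr>carrier := ac ` K\<rparr> \<cong> (MG GS)\<lparr>carrier := ac ` f ` K\<rparr>"
    unfolding MG_update is_iso_def by blast
qed

text \<open>The image of \<open>K\<close> under \<open>(f, g)\<close> contains the product of
  \<open>f (ker g)\<close> and \<open>g (ker f)\<close>: a pair with preimages \<open>k\<close> and
  \<open>k'\<close> in these kernels comes from \<open>k + k'\<close>.\<close>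

lemma commensurable_two:
  assumes H: "subgp H" and K: "subgp K" "K \<subseteq> H" "fi K H"
    and f: "hom_on K f" "f ` K \<subseteq> GS" and g: "hom_on K g" "g ` K \<subseteq> GS"
    and inj: "\<And>k. k \<in> K \<Longrightarrow> f k = 0 \<Longrightarrow> g k = 0 \<Longrightarrow> k = 0"
    and M: "fi (f ` {k \<in> K. g k = 0}) GS" "fi (g ` {k \<in> K. f k = 0}) GS"
  shows "commensurable (MG H) (Gupta_Sidki \<times>\<times> Gupta_Sidki)"
  unfolding commensurable_def MG_GS[symmetric]
proof (intro exI conjI)
  show "finite_index (ac ` K) (MG H)" by (rule finite_index_MG[OF H K])
  define \<theta> where "\<theta> k = (ac (f k), ac (g k))" for k
  have \<theta>_add: "\<theta> (x + y) = \<theta> x \<otimes>\<^bsub>MG GS \<times>\<times> MG GS\<^esub> \<theta> y" if "x \<in> K" "y \<in> K" for x y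
    using that by (simp add: \<theta>_def hom_onD[OF f(1)] hom_onD[OF g(1)] ac_add)
  have inj_\<theta>: "inj_on \<theta> K"
  proof (rule inj_onI)
    fix x y assume xy: "x \<in> K" "y \<in> K" "\<theta> x = \<theta> y"
    then have "f (x - y) = 0" "g (x - y) = 0"
      by (simp_all add: \<theta>_def inj_eq[OF inj_ac] hom_on_diff[OF f(1) K(1)] hom_on_diff[OF g(1) K(1)])
    then have "x - y = 0" by (rule inj[OF subgp_diff[OF K(1) xy(1,2)]])
    then show "x = y" by simp
  qed
  interpret G: group "MG GS" by (rule group_MG[OF subgp_GS])
  have grp: "group (MG GS \<times>\<times> MG GS)" by (rule DirProd_group[OF G.is_group G.is_group])
  define kf where "kf = {k \<in> K. f k = 0}"
  define kg where "kg = {k \<in> K. g k = 0}"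
  have sub: "subgp kf" "subgp kg"
  proof -
    have z: "subgp {0}" by (rule subgpI) auto
    show "subgp kf" "subgp kg"
      unfolding kf_def kg_def using subgp_vimage[OF f(1) K(1) z] subgp_vimage[OF g(1) K(1) z] by simp_all
  qed
  have img: "subgp (f ` kg)" "subgp (g ` kf)"
    by (intro subgp_image sub hom_on_subset[OF f(1)] hom_on_subset[OF g(1)]; auto simp: kf_def kg_def)+
  obtain \<kappa> \<mu> :: "aut \<Rightarrow> aut" where \<kappa>: "finite (\<kappa> ` GS)" "\<And>x y. x \<in> GS \<Longrightarrow> y \<in> GS \<Longrightarrow> \<kappa> x = \<kappa> y \<Longrightarrow> x - y \<in> f ` kg"
    and \<mu>: "finite (\<mu> ` GS)" "\<And>x y. x \<in> GS \<Longrightarrow> y \<in> GS \<Longrightarrow> \<mu> x = \<mu> y \<Longrightarrow> x - y \<in> g ` kf"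
    using fiE[OF M(1)[folded kg_def] img(1)] fiE[OF M(2)[folded kf_def] img(2)] by blast
  show "finite_index (\<theta> ` K) (MG GS \<times>\<times> MG GS)"
  proof (rule finite_indexI[OF grp])
    show "subgroup (\<theta> ` K) (MG GS \<times>\<times> MG GS)"
    proof (rule group.subgroupI[OF grp])
      show "\<theta> ` K \<subseteq> carrier (MG GS \<times>\<times> MG GS)" using f(2) g(2) by (auto simp: \<theta>_def)
      show "\<theta> ` K \<noteq> {}" using subgp_zero[OF K(1)] by blast
      show "inv\<^bsub>MG GS \<times>\<times> MG GS\<^esub> a \<in> \<theta> ` K" if a: "a \<in> \<theta> ` K" for a
      proof -
        obtain k where k: "k \<in> K" "a = \<theta> k" using a by auto
        have fg: "f k \<in> GS" "g k \<in> GS" using k f g by auto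
        have "inv\<^bsub>MG GS \<times>\<times> MG GS\<^esub> a = (ac (- f k), ac (- g k))"
          using inv_DirProd[OF G.is_group G.is_group, of "ac (f k)" "ac (g k)"] fg
          by (simp add: k \<theta>_def inv_MG[OF subgp_GS])
        also have "\<dots> = \<theta> (- k)"
          using k by (simp add: \<theta>_def hom_on_uminus[OF f(1) K(1)] hom_on_uminus[OF g(1) K(1)])
        finally show ?thesis using subgp_uminus[OF K(1) k(1)] by blast
      qed
      show "a \<otimes>\<^bsub>MG GS \<times>\<times> MG GS\<^esub> b \<in> \<theta> ` K" if "a \<in> \<theta> ` K" "b \<in> \<theta> ` K" for a b
        using that subgp_add[OF K(1)] by (auto simp flip: \<theta>_add)
    qed
    define \<rho> where "\<rho> = (\<lambda>(u, v). (\<kappa> (the_inv ac u), \<mu> (the_inv ac v)))"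
    have "\<rho> ` carrier (MG GS \<times>\<times> MG GS) \<subseteq> \<kappa> ` GS \<times> \<mu> ` GS"
      by (auto simp: \<rho>_def the_inv_f_f[OF inj_ac])
    then show "finite (\<rho> ` carrier (MG GS \<times>\<times> MG GS))" using \<kappa>(1) \<mu>(1) by (meson finite_SigmaI finite_subset)
    fix u v assume uv: "u \<in> carrier (MG GS \<times>\<times> MG GS)" "v \<in> carrier (MG GS \<times>\<times> MG GS)" "\<rho> u = \<rho> v"
    then obtain x x' y y' where x: "x \<in> GS" "x' \<in> GS" "y \<in> GS" "y' \<in> GS" "u = (ac x, ac x')" "v = (ac y, ac y')"
      by auto
    with uv(3) have "\<kappa> x = \<kappa> y" "\<mu> x' = \<mu> y'" by (simp_all add: \<rho>_def the_inv_f_f[OF inj_ac])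
    then have "x - y \<in> f ` kg" "x' - y' \<in> g ` kf" using \<kappa>(2) \<mu>(2) x by blast+
    then obtain k k' where k: "k \<in> K" "k' \<in> K" "g k = 0" "f k' = 0" "f k = x - y" "g k' = x' - y'"
      by (auto simp: kf_def kg_def)
    have "inv\<^bsub>MG GS \<times>\<times> MG GS\<^esub> v = (ac (- y), ac (- y'))"
      using inv_DirProd[OF G.is_group G.is_group, of "ac y" "ac y'"] x by (simp add: inv_MG[OF subgp_GS])
    then have "u \<otimes>\<^bsub>MG GS \<times>\<times> MG GS\<^esub> inv\<^bsub>MG GS \<times>\<times> MG GS\<^esub> v = (ac (x + - y), ac (x' + - y'))"
      by (simp add: x ac_add)
    also have "\<dots> = \<theta> (k + k')"
      using k by (simp add: \<theta>_def hom_onD[OF f(1)] hom_onD[OF g(1)] diff_conv_add_uminus)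
    finally show "u \<otimes>\<^bsub>MG GS \<times>\<times> MG GS\<^esub> inv\<^bsub>MG GS \<times>\<times> MG GS\<^esub> v \<in> \<theta> ` K"
      using subgp_add[OF K(1) k(1,2)] by blast
  qed
  have "(\<lambda>u. \<theta> (the_inv ac u)) \<in> iso (MG K) ((MG GS \<times>\<times> MG GS)\<lparr>carrier := \<theta> ` K\<rparr>)"
  proof (rule isoI)
    show "(\<lambda>u. \<theta> (the_inv ac u)) \<in> hom (MG K) ((MG GS \<times>\<times> MG GS)\<lparr>carrier := \<theta> ` K\<rparr>)"
      by (rule homI) (auto simp del: mult_MG simp: mult_MG_ac the_inv_f_f[OF inj_ac] \<theta>_add)
    show "bij_betw (\<lambda>u. \<theta> (the_inv ac u)) (carrier (MG K)) (carrier ((MG GS \<times>\<times> MG GS)\<lparr>carrier := \<theta> ` K\<rparr>))"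
      unfolding bij_betw_def using inj_\<theta>
      by (auto simp: inj_on_def the_inv_f_f[OF inj_ac] image_image)
  qed
  then show "(MG H)\<lparr>carrier := ac ` K\<rparr> \<cong> (MG GS \<times>\<times> MG GS)\<lparr>carrier := \<theta> ` K\<rparr>"
    unfolding MG_update is_iso_def by blast
qed

lemma coords_inj_on:
  assumes "coords K {f}" shows "inj_on f K"
proof (rule inj_onI)
  fix x y assume xy: "x \<in> K" "y \<in> K" "f x = f y"
  note K = coordsD(1)[OF assms]
  have "f (x - y) = 0" using hom_on_diff[OF coordsD(3)[OF assms] K xy(1,2), of f] xy(3) by simp
  then have "x - y = 0" by (intro coordsD(6)[OF assms subgp_diff[OF K xy(1,2)]]) blast
  then show "x = y" by simp
qed

theorem theorem1:
  fixes H :: "(word3 \<Rightarrow> word3) set"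
  assumes "subgroup H Gupta_Sidki"
    and "infinite H"
    and "fin_gen (Gupta_Sidki\<lparr>carrier := H\<rparr>)"
  shows "commensurable (Gupta_Sidki\<lparr>carrier := H\<rparr>) Gupta_Sidki
    \<or> commensurable (Gupta_Sidki\<lparr>carrier := H\<rparr>) (Gupta_Sidki \<times>\<times> Gupta_Sidki)"
proof -
  have sub: "subgroup H (MG GS)" using assms(1) by (simp only: MG_GS)
  define L where "L = {x \<in> GS. ac x \<in> H}"
  have HL: "H = ac ` L" using subgroup.subset[OF sub] by (auto simp: L_def)
  have L: "subgp L"
  proof (rule subgpI)
    show "0 \<in> L" using subgroup.one_closed[OF sub] by (simp add: L_def GS_closed ac_zero)
    show "x + y \<in> L" if "x \<in> L" "y \<in> L" for x y
      using that subgroup.m_closed[OF sub, of "ac x" "ac y"] by (simp add: L_def GS_closed ac_add)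
    show "- x \<in> L" if "x \<in> L" for x
      using that subgroup.m_inv_closed[OF sub, of "ac x"] by (simp add: L_def GS_closed inv_MG[OF subgp_GS])
  qed
  have MGL: "Gupta_Sidki\<lparr>carrier := H\<rparr> = MG L" by (simp add: MG_def HL)
  obtain S where S: "finite S" "S \<subseteq> H" "generate (MG L) S = H"
    using assms(3) unfolding MGL fin_gen_def by (auto simp: HL)
  define T where "T = {x \<in> L. ac x \<in> S}"
  have ST: "S = ac ` T" using S(2) by (auto simp: T_def HL)
  have T: "finite T" "T \<subseteq> GS" "T \<subseteq> L"
  proof -
    show "finite T" using S(1) unfolding ST by (rule finite_imageD) (rule inj_on_subset[OF inj_ac subset_UNIV])
  qed (auto simp: T_def L_def)
  have "generate (MG L) S \<subseteq> ac ` gen T"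
  proof
    fix u assume "u \<in> generate (MG L) S"
    then show "u \<in> ac ` gen T"
    proof induction
      case one
      have "\<one>\<^bsub>MG L\<^esub> = ac 0" by (simp add: ac_zero)
      then show ?case using gen_zero[of T] by blast
    next
      case (incl h)
      then show ?case by (auto simp: ST intro: gen_base)
    next
      case (inv h)
      then obtain x where x: "x \<in> T" "h = ac x" by (auto simp: ST)
      then have "inv\<^bsub>MG L\<^esub> h = ac (- x)" using T(3) inv_MG[OF L] by auto
      then show ?case using x by (auto intro: gen_base gen_uminus)
    next
      case (eng u v)
      then show ?case by (auto simp del: mult_MG simp: mult_MG_ac intro: gen_add)
    qed
  qed
  then have "ac ` L \<subseteq> ac ` gen T" using S(3) HL by simp
  then have "L \<subseteq> gen T" by (simp add: inj_image_subset_iff[OF inj_ac])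
  then have "L = gen T" using gen_least[OF L T(3)] by blast
  then have "virt L" using virt_fin_gen[OF T(1,2)] by simp
  then obtain K U where K: "K \<subseteq> L" "fi K L" "coords K U" "\<forall>f\<in>U. good K U f" "card U \<le> 2"
    using virt_coords2[OF _ L] by blast
  note Ks = coordsD(1)[OF K(3)]
  \<comment> \<open>Without homomorphisms joint injectivity makes \<open>K\<close> trivial, hence
    \<open>H\<close> finite.\<close>
  have "U \<noteq> {}"
  proof
    assume "U = {}"
    then have "K \<subseteq> {0}" using coordsD(6)[OF K(3)] by auto
    then have "fi {0} L" using K(2) fi_mono by blast
    then obtain R where "finite R" "\<forall>x\<in>L. \<exists>t\<in>R. x - t \<in> {0}" by (auto simp: fi_def)
    then have "finite L" by (auto intro: finite_subset[of L R])
    then show False using assms(2) HL by simp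
  qed
  then have "card U = 1 \<or> card U = 2" using K(5) coordsD(2)[OF K(3)] card_gt_0_iff[of U] by linarith
  then show ?thesis
  proof
    assume "card U = 1"
    then obtain f where U: "U = {f}" by (auto simp: card_1_singleton_iff)
    then have "commensurable (MG L) Gupta_Sidki"
      using K(3) coordsD[OF K(3)] by (intro commensurable_one[OF L Ks K(1,2)] coords_inj_on) auto
    then show ?thesis by (simp add: MGL)
  next
    assume "card U = 2"
    then obtain f g where U: "U = {f, g}" "f \<noteq> g" by (auto simp: card_2_iff)
    have "others_ker K U f = {k \<in> K. g k = 0}" "others_ker K U g = {k \<in> K. f k = 0}"
      using U by (auto simp: others_ker_def)
    then have "fi (f ` {k \<in> K. g k = 0}) GS" "fi (g ` {k \<in> K. f k = 0}) GS"
      using K(4) U by (auto simp: good_def)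
    then have "commensurable (MG L) (Gupta_Sidki \<times>\<times> Gupta_Sidki)"
      using coordsD[OF K(3)] U by (intro commensurable_two[OF L Ks K(1,2)]) auto
    then show ?thesis by (simp add: MGL)
  qed
qed

end
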